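(* Fix $T>0$. Starting from (DIC) or (LEM) initial conditions with profile $\gamma$, there is a constant $c_1=c_1(\gamma)<\infty$ such that $\limsup_{a\to v_T}\frac{\sqrt T}{(a-v_T)^2}\mathbb J(a)\le c_1$, $\limsup_{|a|\to\infty}\frac{T}{|a|^3}\mathbb J(a)\le c_1$, $\limsup_{a\to u_T}\frac{\sqrt T}{(a-u_T)^2}\mathbb I(a)\le c_1$, $\limsup_{|a|\to\infty}\frac{T}{|a|^3}\mathbb I(a)\le c_1$. Moreover, starting from (DIC) initial conditions, there is a constant $c_2=c_2(\gamma)>0$ such that $\liminf_{a\to v_T}\frac{\sqrt T}{(a-v_T)^2}\mathbb J(a)\ge c_2$, $\liminf_{|a|\to\infty}\frac{T}{|a|^3}\mathbb J(a)\ge c_2$, $\liminf_{a\to u_T}\frac{\sqrt T}{(a-u_T)^2}\mathbb I(a)\ge c_2$, $\liminf_{|a|\to\infty}\frac{T}{|a|^3}\mathbb I(a)\ge c_2$.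
   Context: Profiles: $M_1$ is the set of measurable $\gamma:\mathbb R\to[0,1]$ with the vague topology. For $0<\rho_*,\rho^*<1$, $M_1(\rho_*,\rho^* )$ is the set of $\gamma\in M_1$ with $\gamma(x)=\rho_*$ for $x\le x_*$ and $\gamma(x)=\rho^*$ for $x\ge x^*$, for some $x_*\le x^*$. (LEM) profile: $\gamma\in M_1(\rho_*,\rho^* )$ piecewise continuous with $0<\gamma<1$. (DIC) profile: $\gamma\in M_1(\rho_*,\rho^* )$ piecewise continuous. $\sigma_t(y)=(2\pi t)^{-1/2}e^{-y^2/(2t)}$; $v_T=\int_0^\infty[\sigma_T*\gamma-\gamma]dx$, and $u_T$ is the unique real with $\int_0^{u_T}\sigma_T*\gamma\,dx=v_T$. A density is $\mu\in D([0,T];M_1)$. $l(\mu;G)=\int G(T,\cdot)\mu_T-\int G(0,\cdot)\mu_0-\int_0^T\int\mu_t(\partial_t+\frac12\partial_x^2)G$ for $G\in C^{1,2}_K([0,T]\times\mathbb R)$; $I_0(\mu)=\sup_G\{l(\mu;G)-\frac12\int_0^T\int\mu(1-\mu)G_x^2\}$; $h(\mu_0;\gamma)=\int[\mu_0\log(\mu_0/\gamma)+(1-\mu_0)\log((1-\mu_0)/(1-\gamma))]dx$. $I_\gamma=I^{LE}_\gamma=I_0+h(\mu_0;\gamma)$ in the (LEM) case; $I_\gamma=I^{DC}_\gamma$ equals $I_0(\mu)$ if $\mu_0=\gamma$ and $\infty$ otherwise in the (DIC) case. $\mathbb J(a)=\inf\{I_\gamma(\mu):I_\gamma(\mu)<\infty,\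 \int_0^\infty(\mu_T-\mu_0)dx=a\}$, $\mathbb I(a)=\inf\{I_\gamma(\mu):I_\gamma(\mu)<\infty,\ \int_0^\infty(\mu_T-\mu_0)dx=\int_0^a\mu_Tdx\}$, where $\int_0^\infty:=\lim_{L\to\infty}\int_0^L$ (which exists when $I_\gamma(\mu)<\infty$). These are the large deviation rate functions of the scaled current $J_{-1,0}(N^2T)/N$ across the bond $(-1,0)$ and scaled tagged particle position $X_{N^2T}/N$ in one-dimensional nearest-neighbor symmetric simple exclusion. *)

theory Defs
  imports "HOL-Analysis.Analysis" "HOL-Library.Liminf_Limsup"
begin

definition M1 :: "(real \<Rightarrow> real) \<Rightarrow> bool" where
  "M1 g \<longleftrightarrow> g \<in> borel_measurable lborel \<and> (\<forall>x. 0 \<le> g x \<and> g x \<le> 1)"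

definition M1_bc :: "real \<Rightarrow> real \<Rightarrow> (real \<Rightarrow> real) \<Rightarrow> bool" where
  "M1_bc rl rr g \<longleftrightarrow> M1 g \<and>
     (\<exists>xl xr. xl \<le> xr \<and> (\<forall>x. x \<le> xl \<longrightarrow> g x = rl) \<and> (\<forall>x. xr \<le> x \<longrightarrow> g x = rr))"

definition piecewise_cont :: "(real \<Rightarrow> real) \<Rightarrow> bool" where
  "piecewise_cont g \<longleftrightarrow> (\<exists>S. finite S \<and> (\<forall>x. x \<notin> S \<longrightarrow> isCont g x) \<and>
     (\<forall>x\<in>S. (\<exists>l. (g \<longlongrightarrow> l) (at_left x)) \<and> (\<exists>r. (g \<longlongrightarrow> r) (at_right x))))"

definition LEM_profile :: "real \<Rightarrow> real \<Rightarrow> (real \<Rightarrow> real) \<Rightarrow> bool" where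
  "LEM_profile rl rr g \<longleftrightarrow> M1_bc rl rr g \<and> piecewise_cont g \<and> (\<forall>x. 0 < g x \<and> g x < 1)"

definition DIC_profile :: "real \<Rightarrow> real \<Rightarrow> (real \<Rightarrow> real) \<Rightarrow> bool" where
  "DIC_profile rl rr g \<longleftrightarrow> M1_bc rl rr g \<and> piecewise_cont g"

datatype initcond = LEM | DIC

definition admissible :: "initcond \<Rightarrow> real \<Rightarrow> real \<Rightarrow> (real \<Rightarrow> real) \<Rightarrow> bool" where
  "admissible m rl rr g = (case m of LEM \<Rightarrow> LEM_profile rl rr g | DIC \<Rightarrow> DIC_profile rl rr g)"

definition sigma :: "real \<Rightarrow> real \<Rightarrow> real" where
  "sigma t y = exp (- (y\<^sup>2) / (2 * t)) / sqrt (2 * pi * t)"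

definition gconv :: "real \<Rightarrow> (real \<Rightarrow> real) \<Rightarrow> real \<Rightarrow> real" where
  "gconv t g x = (LINT y|lborel. sigma t (x - y) * g y)"

definition vT :: "real \<Rightarrow> (real \<Rightarrow> real) \<Rightarrow> real" where
  "vT T g = (LINT x:{0..}|lborel. gconv T g x - g x)"

definition uT :: "real \<Rightarrow> (real \<Rightarrow> real) \<Rightarrow> real" where
  "uT T g = (THE u. interval_lebesgue_integral lborel (ereal 0) (ereal u) (gconv T g) = vT T g)"

definition Cc :: "(real \<Rightarrow> real) \<Rightarrow> bool" where
  "Cc f \<longleftrightarrow> continuous_on UNIV f \<and> (\<exists>L. \<forall>x. L < \<bar>x\<bar> \<longrightarrow> f x = 0)"

definition cadlag_on :: "real \<Rightarrow> (real \<Rightarrow> real) \<Rightarrow> bool" where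
  "cadlag_on T f \<longleftrightarrow> (\<forall>t\<in>{0..<T}. continuous (at_right t) f) \<and>
     (\<forall>t\<in>{0<..T}. \<exists>l. (f \<longlongrightarrow> l) (at_left t))"

text \<open>A density: a path t -> mu t in M_1, cadlag on [0,T] for the vague topology
  (i.e. every pairing with a compactly supported continuous function is cadlag).\<close>
definition density :: "real \<Rightarrow> (real \<Rightarrow> real \<Rightarrow> real) \<Rightarrow> bool" where
  "density T mu \<longleftrightarrow> (\<forall>t. M1 (mu t)) \<and>
     (\<forall>f. Cc f \<longrightarrow> cadlag_on T (\<lambda>t. LINT x|lborel. f x * mu t x))"

definition C12K :: "(real \<Rightarrow> real \<Rightarrow> real) \<Rightarrow> (real \<Rightarrow> real \<Rightarrow> real) \<Rightarrow>
    (real \<Rightarrow> real \<Rightarrow> real) \<Rightarrow> (real \<Rightarrow> real \<Rightarrow> real) \<Rightarrow> bool" where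
  "C12K G Gt Gx Gxx \<longleftrightarrow>
     (\<forall>t x. ((\<lambda>s. G s x) has_real_derivative Gt t x) (at t)) \<and>
     (\<forall>t x. ((\<lambda>y. G t y) has_real_derivative Gx t x) (at x)) \<and>
     (\<forall>t x. ((\<lambda>y. Gx t y) has_real_derivative Gxx t x) (at x)) \<and>
     continuous_on UNIV (\<lambda>(t, x). G t x) \<and> continuous_on UNIV (\<lambda>(t, x). Gt t x) \<and>
     continuous_on UNIV (\<lambda>(t, x). Gx t x) \<and> continuous_on UNIV (\<lambda>(t, x). Gxx t x) \<and>
     (\<exists>L. \<forall>t x. L < \<bar>x\<bar> \<longrightarrow> G t x = 0)"

definition lfun :: "real \<Rightarrow> (real \<Rightarrow> real \<Rightarrow> real) \<Rightarrow> (real \<Rightarrow> real \<Rightarrow> real) \<Rightarrow>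
    (real \<Rightarrow> real \<Rightarrow> real) \<Rightarrow> (real \<Rightarrow> real \<Rightarrow> real) \<Rightarrow> real" where
  "lfun T mu G Gt Gxx =
     (LINT x|lborel. G T x * mu T x) - (LINT x|lborel. G 0 x * mu 0 x)
     - (LINT t:{0..T}|lborel. (LINT x|lborel. mu t x * (Gt t x + Gxx t x / 2)))"

definition qfun :: "real \<Rightarrow> (real \<Rightarrow> real \<Rightarrow> real) \<Rightarrow> (real \<Rightarrow> real \<Rightarrow> real) \<Rightarrow> real" where
  "qfun T mu Gx = (1/2) * (LINT t:{0..T}|lborel. (LINT x|lborel. mu t x * (1 - mu t x) * (Gx t x)\<^sup>2))"

definition I0 :: "real \<Rightarrow> (real \<Rightarrow> real \<Rightarrow> real) \<Rightarrow> ereal" where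
  "I0 T mu = Sup {ereal (lfun T mu G Gt Gxx - qfun T mu Gx) | G Gt Gx Gxx. C12K G Gt Gx Gxx}"

definition bent :: "real \<Rightarrow> real \<Rightarrow> real" where
  "bent p q = (if p = 0 then 0 else p * ln (p / q)) + (if p = 1 then 0 else (1 - p) * ln ((1 - p) / (1 - q)))"

definition hent :: "(real \<Rightarrow> real) \<Rightarrow> (real \<Rightarrow> real) \<Rightarrow> ereal" where
  "hent m0 g = enn2ereal (\<integral>\<^sup>+ x. ennreal (bent (m0 x) (g x)) \<partial>lborel)"

definition Igam :: "initcond \<Rightarrow> real \<Rightarrow> (real \<Rightarrow> real) \<Rightarrow> (real \<Rightarrow> real \<Rightarrow> real) \<Rightarrow> ereal" where
  "Igam m T g mu =
     (if \<not> density T mu then \<infinity> else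
      (case m of LEM \<Rightarrow> I0 T mu + hent (mu 0) g
               | DIC \<Rightarrow> (if (AE x in lborel. mu 0 x = g x) then I0 T mu else \<infinity>)))"

text \<open>Current rate function; int_0^infty := lim_{L->infty} int_0^L.\<close>
definition Jrate :: "initcond \<Rightarrow> real \<Rightarrow> (real \<Rightarrow> real) \<Rightarrow> real \<Rightarrow> ereal" where
  "Jrate m T g a = Inf {Igam m T g mu | mu. Igam m T g mu < \<infinity> \<and>
     ((\<lambda>L. interval_lebesgue_integral lborel (ereal 0) (ereal L) (\<lambda>x. mu T x - mu 0 x)) \<longlongrightarrow> a) at_top}"

definition Irate :: "initcond \<Rightarrow> real \<Rightarrow> (real \<Rightarrow> real) \<Rightarrow> real \<Rightarrow> ereal" where
  "Irate m T g a = Inf {Igam m T g mu | mu. Igam m T g mu < \<infinity> \<and>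
     ((\<lambda>L. interval_lebesgue_integral lborel (ereal 0) (ereal L) (\<lambda>x. mu T x - mu 0 x))
        \<longlongrightarrow> interval_lebesgue_integral lborel (ereal 0) (ereal a) (mu T)) at_top}"

end

theory Submission
  imports Defs "HOL-Probability.Distributions" "HOL-Probability.Sinc_Integral"
begin

text \<open>Let \<open>\<rho>\<^sub>t\<close> be the heat flow started from \<open>\<gamma>\<close>; it has zero cost. Both rate functions ask for the
  cheapest path that carries an excess \<open>b\<close> over \<open>\<rho>\<^sub>T\<close> through a point \<open>s\<close>: for the current, \<open>s = 0\<close> and
  \<open>b = a - v\<^sub>T\<close>; for the tagged particle, \<open>s = a\<close> and \<open>b\<close> is the integral of \<open>\<rho>\<^sub>T\<close> from \<open>u\<^sub>T\<close> to \<open>a\<close>,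
  which is comparable to \<open>a - u\<^sub>T\<close>.

  Upper bound: on \<open>[T/2, T]\<close> the heat flow stays away from \<open>0\<close> and \<open>1\<close>, so a smooth dipole of height
  \<open>b / R\<close> and width \<open>R\<close> of order \<open>1 + \<bar>b\<bar>\<close>, switched on during that interval, costs at most a constant
  times \<open>b\<^sup>2 R\<close>.

  Lower bound: test with multiples of \<open>\<Phi>((x - s) / \<surd>\<tau>(t))\<close>, where \<open>\<Phi>\<close> is the Gaussian distribution
  function. For \<open>\<tau>(t) = T + \<epsilon> - t\<close> this solves the backward heat equation and yields a multiple of
  \<open>b\<^sup>2\<close>; for constant \<open>\<tau>\<close> of order \<open>b\<^sup>2\<close> it yields a multiple of \<open>\<bar>b\<bar>\<^sup>3\<close>.\<close>

text \<open>Both exponents reflect the constraint \<open>0 \<le> mu \<le> 1\<close>. An excess b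
  needs a length of at least |b|, so for large b mass has to travel a distance of order |b|, and
  moving b over a width R costs about \<open>b\<^sup>2 * R\<close>. In the lower bound the
  constraint says that reading b with a smoothed step of width r instead of a sharp one is wrong by
  at most a multiple of r; hence r may be a small fraction of |b|, and wide steps have little
  energy. Two obstacles shape the work. The profile is merely measurable, so the heat flow cannot be
  differentiated down to time 0: the Gaussian is moved onto the test function and time is written as
  \<open>r\<^sup>2\<close>, which removes the singularity of the square root. The current is an
  improper limit with no absolute convergence, whereas test functions have compact support, so a
  cut-off must be inserted and removed. The competitors in the upper bound start exactly at
  \<open>g\<close>, so the entropy vanishes and (LEM) and (DIC) cost the same. As T is fixed, all
  constants may depend on it.\<close>

section \<open>Integration preliminaries: bounds by a majorant, Fubini, the Cauchy kernel\<close>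

text \<open>If \<open>f\<close> is not integrable its integral is 0 by convention, and the majorant
  is nonnegative. The lower bounds rely on this: it spares any argument that the spatial integrals
  in \<open>lfun\<close> and \<open>qfun\<close> of a general density depend measurably on
  time.\<close>

lemma abs_integral_le:
  fixes f h :: "'a \<Rightarrow> real"
  assumes "integrable M h" "\<And>x. \<bar>f x\<bar> \<le> h x"
  shows "\<bar>\<integral>x. f x \<partial>M\<bar> \<le> (\<integral>x. h x \<partial>M)"
proof (cases "integrable M f")
  case True
  have "\<bar>\<integral>x. f x \<partial>M\<bar> \<le> (\<integral>x. \<bar>f x\<bar> \<partial>M)"
    using integral_norm_bound[of M f] by simp
  also have "\<dots> \<le> (\<integral>x. h x \<partial>M)"
    using assms True by (intro integral_mono) auto
  finally show ?thesis .
next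
  case False
  have "0 \<le> h x" for x
    using assms(2)[of x] by linarith
  then show ?thesis
    using False by (simp add: not_integrable_integral_eq)
qed

lemma abs_set_integral_le:
  fixes f h :: "'a \<Rightarrow> real"
  assumes "set_integrable M A h" "\<And>x. x \<in> A \<Longrightarrow> \<bar>f x\<bar> \<le> h x"
  shows "\<bar>LINT x:A|M. f x\<bar> \<le> (LINT x:A|M. h x)"
  unfolding set_lebesgue_integral_def
  by (rule abs_integral_le) (use assms in \<open>auto simp: set_integrable_def indicator_def\<close>)

lemma set_integrable_const_Icc [simp]: "set_integrable lborel {a..b::real} (\<lambda>x. c::real)"
  using borel_integrable_atLeastAtMost'[of a b "\<lambda>x. c"] by simp

lemma abs_set_integral_Icc_le:
  fixes f :: "real \<Rightarrow> real"
  assumes "a \<le> b" "\<And>x. x \<in> {a..b} \<Longrightarrow> \<bar>f x\<bar> \<le> K"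
  shows "\<bar>LBINT x:{a..b}. f x\<bar> \<le> (b - a) * K"
proof -
  have "\<bar>LBINT x:{a..b}. f x\<bar> \<le> (LBINT x:{a..b}. K)"
    by (rule abs_set_integral_le) (use assms in auto)
  then show ?thesis
    using assms(1) by (simp add: set_lebesgue_integral_def)
qed

lemma integrable_product_bound:
  fixes f :: "real \<Rightarrow> real \<Rightarrow> real"
  assumes meas: "case_prod f \<in> borel_measurable (borel \<Otimes>\<^sub>M borel)"
    and h: "integrable lborel h" "integrable lborel k"
    and bound: "\<And>x y. \<bar>f x y\<bar> \<le> h x * k y"
  shows "integrable (lborel \<Otimes>\<^sub>M lborel) (case_prod f)"
proof -
  have [measurable]: "h \<in> borel_measurable borel" "k \<in> borel_measurable borel"
    using h by auto
  have "integrable (lborel \<Otimes>\<^sub>M lborel) (\<lambda>(x, y). h x * k y)"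
    by (intro lborel_pair.Fubini_integrable)
       (use h in \<open>auto simp: abs_mult split_beta'\<close>)
  moreover have "case_prod f \<in> borel_measurable (lborel \<Otimes>\<^sub>M lborel)"
    using meas by simp
  ultimately show ?thesis
  proof (rule Bochner_Integration.integrable_bound, intro AE_I2)
    fix p :: "real \<times> real"
    show "norm (case_prod f p) \<le> norm (case p of (x, y) \<Rightarrow> h x * k y)"
      using order_trans[OF bound[of "fst p" "snd p"] abs_ge_self] by (simp add: split_beta)
  qed
qed

text \<open>All interchanges of integrals below have this form, which is why joint bounds are always
  arranged as a product of two one-variable functions.\<close>

lemma Fubini_product_bound:
  fixes f :: "real \<Rightarrow> real \<Rightarrow> real"
  assumes "case_prod f \<in> borel_measurable (borel \<Otimes>\<^sub>M borel)"
    and "integrable lborel h" "integrable lborel k"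
    and "\<And>x y. \<bar>f x y\<bar> \<le> h x * k y"
  shows "(LBINT y. (LBINT x. f x y)) = (LBINT x. (LBINT y. f x y))"
  by (rule lborel_pair.Fubini_integral[OF integrable_product_bound[OF assms]])

lemma continuous_on_case_prod_measurable:
  fixes F :: "real \<Rightarrow> real \<Rightarrow> real"
  assumes "continuous_on UNIV (\<lambda>(t, x). F t x)"
  shows "case_prod F \<in> borel_measurable (borel \<Otimes>\<^sub>M borel)"
  using borel_measurable_continuous_onI[OF assms] by (simp add: borel_prod)

text \<open>The Cauchy kernel is the integrable majorant for every Gaussian tail below; second
  moments suffice to produce it. Its mass pi reappears in the error term of the lower
  bounds.\<close>

lemma integrable_inverse_square: "integrable lborel (\<lambda>x::real. 1 / (1 + x\<^sup>2))"
  and integral_inverse_square: "(LBINT x. 1 / (1 + (x::real)\<^sup>2)) = pi"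
  using integrable_inverse_1_plus_square LBINT_inverse_1_plus_square
  by (simp_all add: set_integrable_def interval_lebesgue_integral_def set_lebesgue_integral_def
      einterval_def inverse_eq_divide)

lemma integrable_inverse_square_affine:
  assumes "0 < (c::real)"
  shows "integrable lborel (\<lambda>x. 1 / (1 + ((x - s) / c)\<^sup>2))"
proof -
  have "integrable lborel (\<lambda>x. 1 / (1 + (- s / c + 1 / c * x)\<^sup>2))"
    using assms by (intro lborel_integrable_real_affine integrable_inverse_square) auto
  moreover have "- s / c + 1 / c * x = (x - s) / c" for x
    by (simp add: diff_divide_distrib)
  ultimately show ?thesis
    by simp
qed

lemma integral_inverse_square_affine:
  assumes "0 < (c::real)"
  shows "(LBINT x. 1 / (1 + ((x - s) / c)\<^sup>2)) = c * pi"
proof -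
  have "pi = \<bar>1 / c\<bar> *\<^sub>R (LBINT x. 1 / (1 + (- s / c + 1 / c * x)\<^sup>2))"
    using assms lborel_integral_real_affine[of "1 / c" "\<lambda>x. 1 / (1 + x\<^sup>2)" "- s / c"]
    by (simp add: integral_inverse_square)
  moreover have "- s / c + 1 / c * x = (x - s) / c" for x
    by (simp add: diff_divide_distrib)
  ultimately have "pi = 1 / c * (LBINT x. 1 / (1 + ((x - s) / c)\<^sup>2))"
    using assms by simp
  then show ?thesis
    using assms by (simp add: nonzero_eq_divide_eq mult.commute)
qed

section \<open>Gaussian estimates\<close>

lemma std_normal_density_le_1: "std_normal_density x \<le> 1"
proof -
  have "1 \<le> sqrt (2 * pi)"
    using pi_ge_two by simp
  moreover have "exp (- x\<^sup>2 / 2) \<le> 1"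
    by simp
  ultimately have "exp (- x\<^sup>2 / 2) \<le> sqrt (2 * pi)" "0 < sqrt (2 * pi)"
    by linarith+
  then show ?thesis
    unfolding std_normal_density_def by (simp add: divide_le_eq)
qed

lemma std_normal_density_pos: "0 < std_normal_density x"
  by (rule normal_density_pos) simp

lemma std_normal_density_even: "std_normal_density (- x) = std_normal_density x"
  by (simp add: std_normal_density_def)

lemma continuous_on_std_normal_density [continuous_intros]:
  "continuous_on A f \<Longrightarrow> continuous_on A (\<lambda>x. std_normal_density (f x))"
  unfolding std_normal_density_def by (intro continuous_intros) auto

lemma std_normal_density_deriv:
  "(std_normal_density has_real_derivative - x * std_normal_density x) (at x)"
proof -
  have "((\<lambda>x. exp (- x\<^sup>2 / 2)) has_real_derivative - x * exp (- x\<^sup>2 / 2)) (at x)"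
    by (auto intro!: derivative_eq_intros)
  from DERIV_cmult[OF this, of "1 / sqrt (2 * pi)"] show ?thesis
    unfolding std_normal_density_def[abs_def] by (simp add: mult_ac)
qed

lemma integrable_std_normal_poly:
  "integrable lborel (\<lambda>z. std_normal_density z * ((a + b * \<bar>z\<bar>) * (1 + (c + d * \<bar>z\<bar>)\<^sup>2)))"
proof -
  have "integrable lborel (\<lambda>z. (a * (1 + c\<^sup>2)) * (std_normal_density z * \<bar>z\<bar> ^ 0)
      + (2 * a * c * d + b * (1 + c\<^sup>2)) * (std_normal_density z * \<bar>z\<bar> ^ 1)
      + (a * d\<^sup>2 + 2 * b * c * d) * (std_normal_density z * \<bar>z\<bar> ^ 2)
      + b * d\<^sup>2 * (std_normal_density z * \<bar>z\<bar> ^ 3))"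
    by (intro Bochner_Integration.integrable_add integrable_mult_right integrable_std_normal_moment_abs)
  then show ?thesis
    by (rule Bochner_Integration.integrable_cong[THEN iffD1, rotated 2])
       (auto simp: power2_eq_square power3_eq_cube algebra_simps)
qed

lemma integral_std_normal_abs_le: "(LBINT z. std_normal_density z * \<bar>z\<bar>) \<le> 1"
proof -
  have "(LBINT z. std_normal_density z * \<bar>z\<bar> ^ (2 * 0 + 1)) = sqrt (2 / pi) * 2 ^ 0 * fact 0"
    by (rule integral_std_normal_moment_abs_odd)
  then have "(LBINT z. std_normal_density z * \<bar>z\<bar>) = sqrt (2 / pi)"
    by simp
  also have "\<dots> \<le> 1"
    using pi_ge_two by (simp add: divide_le_eq)
  finally show ?thesis .
qed

definition Phi :: "real \<Rightarrow> real" where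
  "Phi x = (LBINT z:{..x}. std_normal_density z)"

lemma set_integrable_std_normal [simp]:
  "A \<in> sets borel \<Longrightarrow> set_integrable lborel A std_normal_density"
  by (rule set_integrable_subset[of _ UNIV]) (auto simp: set_integrable_def)

lemma Phi_has_derivative: "(Phi has_real_derivative std_normal_density x) (at x)"
proof -
  have "((\<lambda>u. LBINT y=(x-1)..u. std_normal_density y) has_vector_derivative std_normal_density x)
      (at x within {x-1..x+1})"
    by (rule interval_integral_FTC2) (auto intro!: continuous_intros)
  then have "((\<lambda>u. LBINT y=(x-1)..u. std_normal_density y) has_real_derivative std_normal_density x) (at x)"
    using at_within_interior[of x "{x-1..x+1}"]
    by (simp add: has_real_derivative_iff_has_vector_derivative)
  then have deriv: "((\<lambda>u. Phi (x - 1) + (LBINT y=(x-1)..u. std_normal_density y)) has_real_derivative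
      std_normal_density x) (at x)"
    by (auto intro!: derivative_eq_intros)
  have ev: "\<forall>\<^sub>F u in nhds x. Phi (x - 1) + (LBINT y=(x-1)..u. std_normal_density y) = Phi u"
  proof -
    have "Phi (x - 1) + (LBINT y=(x-1)..u. std_normal_density y) = Phi u" if "x - 1 < u" for u
    proof -
      have "Phi u = (LINT z:{..x-1} \<union> {x-1<..u}|lborel. std_normal_density z)"
        using that unfolding Phi_def by (auto intro!: arg_cong2[where f="set_lebesgue_integral lborel"])
      also have "\<dots> = Phi (x-1) + (LBINT z:{x-1<..u}. std_normal_density z)"
        unfolding Phi_def by (rule set_integral_Un) auto
      also have "(LBINT z:{x-1<..u}. std_normal_density z) = (LBINT y=(x-1)..u. std_normal_density y)"
        using that by (subst interval_integral_Ioc) auto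
      finally show ?thesis ..
    qed
    then show ?thesis
      by (intro eventually_mono[OF eventually_nhds_in_open[of "{x-1<..}"]]) auto
  qed
  show ?thesis
    using DERIV_cong_ev[OF refl ev refl] deriv by simp
qed

lemma integrable_one_plus_square_std_normal:
  "integrable lborel (\<lambda>z. (1 + z\<^sup>2) * std_normal_density z)"
  and integral_one_plus_square_std_normal:
  "(LBINT z. (1 + z\<^sup>2) * std_normal_density z) = 2"
proof -
  have eq: "(1 + z\<^sup>2) * std_normal_density z = std_normal_density z + std_normal_density z * z ^ (2 * 1)" for z
    by (simp add: algebra_simps power2_eq_square)
  have i: "integrable lborel (\<lambda>z. std_normal_density z * z ^ (2 * 1))"
    by (rule integrable_std_normal_moment)
  show "integrable lborel (\<lambda>z. (1 + z\<^sup>2) * std_normal_density z)"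
    unfolding eq by (intro Bochner_Integration.integrable_add i) auto
  show "(LBINT z. (1 + z\<^sup>2) * std_normal_density z) = 2"
    unfolding eq using integral_std_normal_moment_even[of 1]
    by (subst Bochner_Integration.integral_add[OF _ i]) (auto)
qed

lemma Phi_nonneg: "0 \<le> Phi x"
  unfolding Phi_def set_lebesgue_integral_def by (intro integral_nonneg_AE) auto

text \<open>Chebyshev: for z below x the weight \<open>(1 + z\<^sup>2) / (1 + x\<^sup>2)\<close> is
  at least 1, and \<open>1 + z\<^sup>2\<close> has Gaussian mean 2.\<close>

lemma Phi_le_tail: "x \<le> 0 \<Longrightarrow> Phi x \<le> 2 / (1 + x\<^sup>2)"
proof -
  assume x: "x \<le> 0"
  have "\<bar>Phi x\<bar> \<le> (LBINT z. (1 + z\<^sup>2) * std_normal_density z / (1 + x\<^sup>2))"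
    unfolding Phi_def set_lebesgue_integral_def
  proof (rule abs_integral_le)
    show "integrable lborel (\<lambda>z. (1 + z\<^sup>2) * std_normal_density z / (1 + x\<^sup>2))"
      using integrable_one_plus_square_std_normal by simp
    fix z
    have "1 + x\<^sup>2 \<le> 1 + z\<^sup>2" if "z \<le> x"
      using that x power_mono[of "- x" "- z" 2] by simp
    moreover have "0 < 1 + x\<^sup>2"
      by (simp add: add_pos_nonneg)
    ultimately show "\<bar>indicat_real {..x} z *\<^sub>R std_normal_density z\<bar> \<le> (1 + z\<^sup>2) * std_normal_density z / (1 + x\<^sup>2)"
      by (auto simp: indicator_def le_divide_eq mult.commute intro!: mult_left_mono)
  qed
  then show ?thesis
    by (simp add: integral_one_plus_square_std_normal)
qed

lemma Phi_reflect: "(LBINT z:{x..}. std_normal_density z) = Phi (- x)"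
proof -
  have "(LBINT z:{x..}. std_normal_density z) =
      \<bar>-1\<bar> *\<^sub>R (LBINT z. indicator {x..} (0 + (-1) * z) *\<^sub>R std_normal_density (0 + (-1) * z))"
    unfolding set_lebesgue_integral_def by (rule lborel_integral_real_affine) simp
  also have "\<dots> = Phi (- x)"
    unfolding Phi_def set_lebesgue_integral_def
    by (auto intro!: Bochner_Integration.integral_cong simp: std_normal_density_even indicator_def)
  finally show ?thesis .
qed

lemma Phi_compl: "Phi x = 1 - Phi (- x)"
proof -
  have "{..x} \<union> {x<..} = UNIV"
    by auto
  then have "1 = (LINT z:{..x} \<union> {x<..}|lborel. std_normal_density z)"
    by (simp only: set_lebesgue_integral_def) simp
  also have "\<dots> = Phi x + (LBINT z:{x<..}. std_normal_density z)"
    unfolding Phi_def by (rule set_integral_Un) auto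
  also have "(LBINT z:{x<..}. std_normal_density z) = (LBINT z:{x..}. std_normal_density z)"
    using AE_lborel_singleton[of x] unfolding set_lebesgue_integral_def
    by (intro integral_cong_AE) (auto simp: indicator_def)
  finally show ?thesis
    by (simp add: Phi_reflect)
qed

lemma Phi_le_1: "Phi x \<le> 1"
  using Phi_compl[of x] Phi_nonneg[of "- x"] by simp

lemma Phi_pos: "0 < Phi x"
proof -
  have "(LBINT z. std_normal_density (\<bar>x\<bar> + 1) * indicator {x - 1..x} z) \<le> Phi x"
    unfolding Phi_def set_lebesgue_integral_def
  proof (rule integral_mono)
    show "integrable lborel (\<lambda>z. indicat_real {..x} z *\<^sub>R std_normal_density z)"
      using set_integrable_std_normal[of "{..x}"] by (simp add: set_integrable_def)
    fix z
    show "std_normal_density (\<bar>x\<bar> + 1) * indicator {x - 1..x} z \<le> indicat_real {..x} z *\<^sub>R std_normal_density z"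
    proof (cases "z \<in> {x-1..x}")
      case True
      then have "z\<^sup>2 \<le> (\<bar>x\<bar> + 1)\<^sup>2"
        by (intro power2_le_iff_abs_le[THEN iffD2]) auto
      then show ?thesis
        using True by (simp add: std_normal_density_def divide_right_mono)
    qed auto
  qed auto
  moreover have "0 < std_normal_density (\<bar>x\<bar> + 1)"
    by (rule std_normal_density_pos)
  ultimately show ?thesis
    by (simp)
qed

text \<open>The left tail and its reflection. After rescaling, the integral of this bound is the
  price of reading a current with a smoothed step.\<close>

lemma Phi_step_bound: "\<bar>Phi x - (if 0 < x then 1 else 0)\<bar> \<le> 2 / (1 + x\<^sup>2)"
  using Phi_le_tail[of x] Phi_le_tail[of "- x"] Phi_compl[of x] Phi_nonneg[of x] Phi_nonneg[of "-x"]
  by auto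

section \<open>A bump function\<close>

text \<open>At the corner 0 the difference quotient is at most
  \<open>\<bar>h\<bar> ^ (n + 1)\<close>, so every power from the square on is differentiable
  everywhere. This gives smooth enough bumps and time switches without exponentials.\<close>

lemma max_power_deriv:
  "((\<lambda>u::real. max 0 u ^ (n + 2)) has_real_derivative real (n + 2) * max 0 u ^ (n + 1)) (at u)"
proof (cases "u = 0")
  case True
  have "((\<lambda>h::real. max 0 h ^ (n + 2) / h) \<longlongrightarrow> 0) (at 0)"
  proof (rule Lim_null_comparison)
    show "\<forall>\<^sub>F h in at (0::real). norm (max 0 h ^ (n + 2) / h) \<le> \<bar>h\<bar> ^ (n + 1)"
    proof (rule always_eventually, rule allI)
      fix h :: real
      show "norm (max 0 h ^ (n + 2) / h) \<le> \<bar>h\<bar> ^ (n + 1)"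
      proof (cases "h \<le> 0")
        case True
        then have "max 0 h ^ (n + 2) / h = 0"
          by (simp add: max_absorb1)
        then show ?thesis
          by (metis norm_zero zero_le_power abs_ge_zero)
      qed auto
    qed
    show "((\<lambda>h::real. \<bar>h\<bar> ^ (n + 1)) \<longlongrightarrow> 0) (at 0)"
      by (auto intro!: tendsto_eq_intros)
  qed
  then show ?thesis
    using True by (simp add: DERIV_def)
next
  case False
  then consider "u < 0" | "u > 0" by linarith
  then show ?thesis
  proof cases
    case 1
    have "((\<lambda>u. 0) has_real_derivative real (n + 2) * max 0 u ^ (n + 1)) (at u)"
      using 1 by simp
    then show ?thesis
      by (rule has_field_derivative_transform_within_open[of _ _ _ "{..<0}"]) (use 1 in auto)
  next
    case 2
    have "((\<lambda>u. u ^ (n + 2)) has_real_derivative real (n + 2) * max 0 u ^ (n + 1)) (at u)"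
      using DERIV_pow[of "n + 2" u] 2 by (simp add: max_def)
    then show ?thesis
      by (rule has_field_derivative_transform_within_open[of _ _ _ "{0<..}"]) (use 2 in auto)
  qed
qed

lemma max_power_deriv_chain [derivative_intros]:
  assumes "(f has_real_derivative f') (at x)"
  shows "((\<lambda>x. max 0 (f x) ^ 3) has_real_derivative 3 * max 0 (f x) ^ 2 * f') (at x)"
    and "((\<lambda>x. max 0 (f x) ^ 2) has_real_derivative 2 * max 0 (f x) * f') (at x)"
  using DERIV_chain2[OF max_power_deriv[of 1] assms] DERIV_chain2[OF max_power_deriv[of 0] assms]
  by (simp_all add: numeral_3_eq_3 power2_eq_square)

text \<open>The cube is the least integer power of the positive part of \<open>1 - x\<^sup>2\<close>
  that is twice continuously differentiable, as \<open>C12K\<close> requires in the space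
  variable.\<close>

definition bump :: "real \<Rightarrow> real" where
  "bump x = max 0 (1 - x\<^sup>2) ^ 3"

definition bump' :: "real \<Rightarrow> real" where
  "bump' x = - 6 * x * max 0 (1 - x\<^sup>2) ^ 2"

definition bump'' :: "real \<Rightarrow> real" where
  "bump'' x = - 6 * max 0 (1 - x\<^sup>2) ^ 2 + 24 * x\<^sup>2 * max 0 (1 - x\<^sup>2)"

lemma bump_deriv: "(bump has_real_derivative bump' x) (at x)"
  unfolding bump_def[abs_def] bump'_def
  by (rule derivative_eq_intros refl)+ simp

lemma bump'_deriv: "(bump' has_real_derivative bump'' x) (at x)"
  unfolding bump'_def[abs_def] bump''_def
  by (rule derivative_eq_intros refl)+ (simp add: power2_eq_square algebra_simps)

lemma continuous_on_bump [continuous_intros]: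
  assumes "continuous_on A f"
  shows "continuous_on A (\<lambda>x. bump (f x))" "continuous_on A (\<lambda>x. bump' (f x))"
    "continuous_on A (\<lambda>x. bump'' (f x))"
  unfolding bump_def bump'_def bump''_def by (intro continuous_intros assms)+

lemma bump_outside: "1 < \<bar>x\<bar> \<Longrightarrow> bump x = 0 \<and> bump' x = 0 \<and> bump'' x = 0"
proof -
  assume "1 < \<bar>x\<bar>"
  then have "1 < x\<^sup>2"
    by (metis abs_1 abs_le_square_iff linorder_not_le one_power2)
  then show ?thesis
    by (simp add: bump_def bump'_def bump''_def)
qed

lemma bump_0 [simp]: "bump 0 = 1"
  by (simp add: bump_def)

lemma bump_bounds: "0 \<le> bump x" "bump x \<le> 1" "\<bar>bump' x\<bar> \<le> 6" "\<bar>bump'' x\<bar> \<le> 30"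
proof -
  let ?m = "max 0 (1 - x\<^sup>2)"
  have m: "0 \<le> ?m" "?m \<le> 1" by auto
  have m2: "?m ^ 2 \<le> 1" "?m ^ 3 \<le> 1"
    using m by (auto intro: power_le_one)
  show "0 \<le> bump x" "bump x \<le> 1"
    using m m2 by (auto simp: bump_def)
  have "\<bar>bump' x\<bar> \<le> 6 \<and> \<bar>bump'' x\<bar> \<le> 30"
  proof (cases "1 < \<bar>x\<bar>")
    case True
    then show ?thesis
      using bump_outside by auto
  next
    case False
    then have x: "\<bar>x\<bar> \<le> 1" "x\<^sup>2 \<le> 1"
      by (auto simp: abs_square_le_1)
    have "\<bar>x\<bar> * ?m ^ 2 \<le> 1 * 1"
      using x m2 by (intro mult_mono) auto
    then have "\<bar>bump' x\<bar> \<le> 6"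
      by (simp add: bump'_def abs_mult)
    moreover have "x\<^sup>2 * ?m \<le> 1 * 1"
      using x m by (intro mult_mono) auto
    moreover have "0 \<le> x\<^sup>2 * ?m"
      by simp
    ultimately show ?thesis
      unfolding bump''_def using m2 zero_le_power2[of ?m] unfolding abs_le_iff mult.assoc by linarith
  qed
  then show "\<bar>bump' x\<bar> \<le> 6" "\<bar>bump'' x\<bar> \<le> 30"
    by auto
qed

section \<open>The heat flow\<close>

text \<open>The mean of \<open>g\<close> at x plus a normal variable of variance t. Unlike
  \<open>gconv\<close>, this form gives exactly \<open>g\<close> at t = 0. For negative t the odd
  real \<open>sqrt\<close> still yields an average of \<open>g\<close>, so the values stay in [0,1]
  at all times, as \<open>density\<close> demands.\<close>

definition rho :: "(real \<Rightarrow> real) \<Rightarrow> real \<Rightarrow> real \<Rightarrow> real" where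
  "rho g t x = (LBINT z. std_normal_density z * g (x + sqrt t * z))"

text \<open>The heat semigroup acting on test functions, parametrised by the standard deviation c
  instead of the time, so that it stays differentiable at c = 0 for smooth \<open>f\<close>.\<close>

definition gauss_mean :: "(real \<Rightarrow> real) \<Rightarrow> real \<Rightarrow> real \<Rightarrow> real" where
  "gauss_mean f c y = (LBINT z. std_normal_density z * f (y - c * z))"

lemma measurable_case_prod_compose:
  fixes F :: "real \<Rightarrow> real \<Rightarrow> real"
  assumes "case_prod F \<in> borel_measurable (borel \<Otimes>\<^sub>M borel)" "f \<in> borel_measurable M" "h \<in> borel_measurable M"
  shows "(\<lambda>p. F (f p) (h p)) \<in> borel_measurable M"
  using measurable_compose[OF measurable_Pair[OF assms(2,3)] assms(1)] by simp

lemma integrable_indicator_Icc [simp]: "integrable lborel (indicat_real {a..b::real})"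
  by (intro integrable_real_indicator) (auto simp: emeasure_lborel_Icc_eq)

lemma M1_measurable: "M1 g \<Longrightarrow> g \<in> borel_measurable borel"
  by (simp add: M1_def)

lemma M1_bounds: "M1 g \<Longrightarrow> 0 \<le> g x \<and> g x \<le> 1"
  by (simp add: M1_def)

lemma integrable_std_normal_mult_bounded:
  fixes f :: "real \<Rightarrow> real"
  assumes "f \<in> borel_measurable borel" "\<And>x. \<bar>f x\<bar> \<le> K"
  shows "integrable lborel (\<lambda>z. std_normal_density z * f z)"
proof (rule Bochner_Integration.integrable_bound)
  show "integrable lborel (\<lambda>z. std_normal_density z * K)"
    by simp
  show "AE z in lborel. norm (std_normal_density z * f z) \<le> norm (std_normal_density z * K)"
    using assms(2) by (intro AE_I2) (auto simp: abs_mult intro!: mult_left_mono order_trans[OF assms(2) abs_ge_self])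
qed (use assms(1) in simp)

lemma integrable_bounded_compact_support:
  fixes f :: "real \<Rightarrow> real"
  assumes "f \<in> borel_measurable borel" "\<And>x. \<bar>f x\<bar> \<le> K" "\<And>x. L < \<bar>x\<bar> \<Longrightarrow> f x = 0"
  shows "integrable lborel f"
proof (rule Bochner_Integration.integrable_bound)
  show "integrable lborel (\<lambda>x. K * indicator {-L..L} x)"
    by simp
  have "\<bar>f x\<bar> \<le> \<bar>K * indicator {-L..L} x\<bar>" for x
  proof (cases "L < \<bar>x\<bar>")
    case False
    then have "x \<in> {-L..L}"
      by auto
    then show ?thesis
      using order_trans[OF assms(2) abs_ge_self] by simp
  qed (simp add: assms(3))
  then show "AE x in lborel. norm (f x) \<le> norm (K * indicator {-L..L} x)"
    by simp
qed (use assms(1) in simp)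

lemma abs_mult_M1_le: "M1 u \<Longrightarrow> \<bar>y\<bar> \<le> K \<Longrightarrow> \<bar>y * u x\<bar> \<le> K"
  using M1_bounds[of u x] mult_mono[of "\<bar>y\<bar>" K "\<bar>u x\<bar>" 1] by (simp add: abs_mult)

lemma integrable_rho:
  assumes "M1 g"
  shows "integrable lborel (\<lambda>z. std_normal_density z * g (x + c * z))"
proof -
  note [measurable] = M1_measurable[OF assms]
  show ?thesis
    using M1_bounds[OF assms] by (intro integrable_std_normal_mult_bounded[where K=1]) auto
qed

lemma rho_0 [simp]: "rho g 0 x = g x"
  by (simp add: rho_def)

lemma rho_nonneg: "M1 g \<Longrightarrow> 0 \<le> rho g t x"
  unfolding rho_def using M1_bounds by (intro integral_nonneg_AE AE_I2) simp

lemma rho_compl: "M1 g \<Longrightarrow> rho (\<lambda>x. 1 - g x) t x = 1 - rho g t x"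
  unfolding rho_def right_diff_distrib using integrable_rho[of g x "sqrt t"]
  by (subst Bochner_Integration.integral_diff) auto

lemma M1_compl: "M1 g \<Longrightarrow> M1 (\<lambda>x. 1 - g x)"
  by (auto simp: M1_def)

lemma rho_le_1: "M1 g \<Longrightarrow> rho g t x \<le> 1"
  using rho_nonneg[OF M1_compl, of g t x] rho_compl[of g t x] by simp

lemma rho_measurable:
  assumes "M1 g"
  shows "case_prod (rho g) \<in> borel_measurable (borel \<Otimes>\<^sub>M borel)"
proof -
  have [measurable]: "g \<in> borel_measurable borel"
    by (rule M1_measurable[OF assms])
  have eq: "case_prod (rho g) = (\<lambda>p. LBINT z. std_normal_density z * g (snd p + sqrt (fst p) * z))"
    by (rule ext) (simp only: split_beta rho_def)
  show ?thesis
    unfolding eq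
    by (rule lborel.borel_measurable_lebesgue_integral, simp only: split_beta', measurable)
qed

lemma M1_rho:
  assumes "M1 g"
  shows "M1 (rho g t)"
proof -
  have "(\<lambda>x. rho g t x) \<in> borel_measurable borel"
    by (rule measurable_case_prod_compose[OF rho_measurable[OF assms]]) auto
  then show ?thesis
    unfolding M1_def using rho_nonneg[OF assms] rho_le_1[OF assms] by simp
qed

lemma gconv_eq_rho:
  assumes "0 < t"
  shows "gconv t g x = rho g t x"
proof -
  have "gconv t g x = \<bar>sqrt t\<bar> *\<^sub>R (LBINT z. sigma t (x - (x + sqrt t * z)) * g (x + sqrt t * z))"
    unfolding gconv_def using assms by (intro lborel_integral_real_affine) auto
  also have "\<dots> = (LBINT z. sqrt t * (sigma t (x - (x + sqrt t * z)) * g (x + sqrt t * z)))"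
    using assms by simp
  also have "(\<lambda>z. sqrt t * (sigma t (x - (x + sqrt t * z)) * g (x + sqrt t * z))) =
      (\<lambda>z. std_normal_density z * g (x + sqrt t * z))"
    using assms by (auto simp: fun_eq_iff sigma_def std_normal_density_def power_mult_distrib real_sqrt_mult)
  finally show ?thesis
    by (simp add: rho_def)
qed

text \<open>The support condition \<open>\<bar>y - c z\<bar> \<le> L\<close> forces \<open>\<bar>y\<bar> \<le> L + S \<bar>z\<bar>\<close>; this trades the
  coupling of the two variables for a product of integrable functions.\<close>

lemma shifted_bound:
  fixes f :: "real \<Rightarrow> real"
  assumes "\<And>u. \<bar>f u\<bar> \<le> K" "\<And>u. L < \<bar>u\<bar> \<Longrightarrow> f u = 0" "0 \<le> L" "\<bar>c\<bar> \<le> S"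
  shows "\<bar>f (y - c * z)\<bar> \<le> K * (1 + (L + S * \<bar>z\<bar>)\<^sup>2) * (1 / (1 + y\<^sup>2))"
proof (cases "L < \<bar>y - c * z\<bar>")
  case True
  moreover have "0 \<le> K"
    using assms(1)[of 0] by linarith
  ultimately show ?thesis
    using assms(2) by simp
next
  case False
  have "\<bar>y\<bar> \<le> \<bar>y - c * z\<bar> + \<bar>c * z\<bar>"
    by linarith
  also have "\<dots> \<le> L + S * \<bar>z\<bar>"
    using False assms(4) by (intro add_mono) (auto simp: abs_mult intro!: mult_right_mono)
  finally have "y\<^sup>2 \<le> (L + S * \<bar>z\<bar>)\<^sup>2"
    using power_mono[of "\<bar>y\<bar>" _ 2] by simp
  then have "1 \<le> (1 + (L + S * \<bar>z\<bar>)\<^sup>2) * (1 / (1 + y\<^sup>2))"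
    by (simp add: le_divide_eq add_pos_nonneg)
  moreover have "0 \<le> K"
    using assms(1)[of 0] by linarith
  ultimately have "K * 1 \<le> K * ((1 + (L + S * \<bar>z\<bar>)\<^sup>2) * (1 / (1 + y\<^sup>2)))"
    by (rule mult_left_mono)
  then show ?thesis
    using assms(1)[of "y - c * z"] by (simp only: mult.assoc)
qed

lemma gauss_mean_measurable [measurable]:
  assumes [measurable]: "f \<in> borel_measurable borel"
  shows "gauss_mean f c \<in> borel_measurable borel"
  unfolding gauss_mean_def[abs_def]
  by (rule lborel.borel_measurable_lebesgue_integral, simp only: split_beta', measurable)

lemma integrable_std_normal_shift:
  "integrable lborel (\<lambda>z. std_normal_density z * (K * (1 + (L + S * \<bar>z\<bar>)\<^sup>2)))"
  using integrable_std_normal_poly[of K 0 L S] by simp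

lemma gauss_mean_bound:
  fixes f :: "real \<Rightarrow> real"
  assumes "\<And>u. \<bar>f u\<bar> \<le> K" "\<And>u. L < \<bar>u\<bar> \<Longrightarrow> f u = 0" "0 \<le> L" "\<bar>c\<bar> \<le> S"
  shows "\<bar>gauss_mean f c y\<bar> \<le>
    (LBINT z. std_normal_density z * (K * (1 + (L + S * \<bar>z\<bar>)\<^sup>2))) * (1 / (1 + y\<^sup>2))"
proof -
  have "\<bar>gauss_mean f c y\<bar> \<le>
      (LBINT z. std_normal_density z * (K * (1 + (L + S * \<bar>z\<bar>)\<^sup>2)) * (1 / (1 + y\<^sup>2)))"
    unfolding gauss_mean_def
  proof (rule abs_integral_le)
    show "integrable lborel (\<lambda>z. std_normal_density z * (K * (1 + (L + S * \<bar>z\<bar>)\<^sup>2)) * (1 / (1 + y\<^sup>2)))"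
      by (intro integrable_mult_left integrable_std_normal_shift)
    show "\<bar>std_normal_density z * f (y - c * z)\<bar> \<le>
        std_normal_density z * (K * (1 + (L + S * \<bar>z\<bar>)\<^sup>2)) * (1 / (1 + y\<^sup>2))" for z
      using mult_left_mono[OF shifted_bound[where f=f and y=y and z=z, OF assms], of "std_normal_density z"]
      by (simp add: abs_mult mult.assoc)
  qed
  then show ?thesis
    by simp
qed

lemma integral_shift: "(LBINT x. f (x + c)) = (LBINT x. f (x::real) :: real)"
  using lborel_integral_real_affine[of 1 f c] by (simp add: add.commute)

text \<open>Symmetry of the heat semigroup: for each z the substitution y = x + c z moves the shift
  from \<open>g\<close> to \<open>f\<close>. From here on limits and derivatives fall on the test
  function, and \<open>g\<close> may be merely measurable.\<close>

lemma rho_pairing: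
  fixes f :: "real \<Rightarrow> real"
  assumes g: "M1 g" and [measurable]: "f \<in> borel_measurable borel"
    and f: "\<And>u. \<bar>f u\<bar> \<le> K" "\<And>u. L < \<bar>u\<bar> \<Longrightarrow> f u = 0" "0 \<le> L"
  shows "(LBINT x. f x * rho g t x) = (LBINT y. g y * gauss_mean f (sqrt t) y)"
proof -
  note [measurable] = M1_measurable[OF g]
  let ?c = "sqrt t"
  have K: "0 \<le> K"
    using f(1)[of 0] by linarith
  have "(LBINT x. f x * rho g t x) =
      (LBINT x. (LBINT z. f x * (std_normal_density z * g (x + ?c * z))))"
    by (simp add: rho_def)
  also have "\<dots> = (LBINT z. (LBINT x. f x * (std_normal_density z * g (x + ?c * z))))"
  proof (rule Fubini_product_bound[where h=std_normal_density and k="\<lambda>x. K * indicator {-L..L} x"])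
    show "integrable lborel (\<lambda>x. K * indicator {-L..L} x)"
      by simp
    fix z x
    have "\<bar>std_normal_density z * g (x + ?c * z)\<bar> \<le> std_normal_density z"
      using M1_bounds[OF g] by (simp add: abs_mult mult_left_le)
    moreover have "\<bar>f x\<bar> \<le> K * indicator {-L..L} x"
      using f(1)[of x] f(2)[of x] by (auto simp: indicator_def)
    ultimately have "\<bar>f x\<bar> * \<bar>std_normal_density z * g (x + ?c * z)\<bar> \<le> K * indicator {-L..L} x * std_normal_density z"
      using K by (intro mult_mono) auto
    then show "\<bar>f x * (std_normal_density z * g (x + ?c * z))\<bar> \<le> std_normal_density z * (K * indicator {-L..L} x)"
      by (simp add: abs_mult mult_ac)
  qed auto
  also have "\<dots> = (LBINT z. (LBINT y. f (y - ?c * z) * (std_normal_density z * g y)))"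
  proof (rule Bochner_Integration.integral_cong[OF refl])
    fix z
    show "(LBINT x. f x * (std_normal_density z * g (x + ?c * z))) =
        (LBINT y. f (y - ?c * z) * (std_normal_density z * g y))"
      using integral_shift[of "\<lambda>y. f (y - ?c * z) * (std_normal_density z * g y)" "?c * z"] by simp
  qed
  also have "\<dots> = (LBINT y. (LBINT z. f (y - ?c * z) * (std_normal_density z * g y)))"
  proof (rule Fubini_product_bound[where h="\<lambda>y. 1 / (1 + y\<^sup>2)"
        and k="\<lambda>z. std_normal_density z * (K * (1 + (L + \<bar>?c\<bar> * \<bar>z\<bar>)\<^sup>2))"])
    show "integrable lborel (\<lambda>y. 1 / (1 + y\<^sup>2) :: real)"
      by (rule integrable_inverse_square)
    show "integrable lborel (\<lambda>z. std_normal_density z * (K * (1 + (L + \<bar>?c\<bar> * \<bar>z\<bar>)\<^sup>2)))"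
      by (rule integrable_std_normal_shift)
    fix y z
    have "\<bar>std_normal_density z * g y\<bar> \<le> std_normal_density z"
      using M1_bounds[OF g] by (simp add: abs_mult mult_left_le)
    then have "\<bar>f (y - ?c * z)\<bar> * \<bar>std_normal_density z * g y\<bar> \<le>
        K * (1 + (L + \<bar>?c\<bar> * \<bar>z\<bar>)\<^sup>2) * (1 / (1 + y\<^sup>2)) * std_normal_density z"
      using K by (intro mult_mono shifted_bound[OF f]) auto
    then show "\<bar>f (y - ?c * z) * (std_normal_density z * g y)\<bar> \<le>
        1 / (1 + y\<^sup>2) * (std_normal_density z * (K * (1 + (L + \<bar>?c\<bar> * \<bar>z\<bar>)\<^sup>2)))"
      by (simp add: abs_mult mult_ac)
  qed auto
  also have "\<dots> = (LBINT y. g y * gauss_mean f ?c y)"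
    unfolding gauss_mean_def by (simp add: mult_ac flip: integral_mult_right_zero)
  finally show ?thesis .
qed

section \<open>Compactly supported test functions and vague continuity of the heat flow\<close>

lemma continuous_compact_support_bounded:
  fixes f :: "real \<Rightarrow> real"
  assumes "continuous_on UNIV f" "\<And>x. L < \<bar>x\<bar> \<Longrightarrow> f x = 0"
  shows "\<exists>K. \<forall>x. \<bar>f x\<bar> \<le> K"
proof -
  have "compact (f ` {-L..L})"
    by (intro compact_continuous_image continuous_on_subset[OF assms(1)]) auto
  then obtain K where K: "\<And>x. x \<in> {-L..L} \<Longrightarrow> \<bar>f x\<bar> \<le> K"
    using compact_imp_bounded[of "f ` {-L..L}"] unfolding bounded_iff by force
  have "\<bar>f x\<bar> \<le> max 0 K" for x
  proof (cases "L < \<bar>x\<bar>")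
    case False
    then have "x \<in> {-L..L}"
      by auto
    from K[OF this] show ?thesis
      by linarith
  qed (simp add: assms(2))
  then show ?thesis
    by blast
qed

lemma continuous_strip_bounded:
  fixes F :: "real \<Rightarrow> real \<Rightarrow> real"
  assumes "continuous_on UNIV (\<lambda>(t, x). F t x)" "\<And>t x. L < \<bar>x\<bar> \<Longrightarrow> F t x = 0"
  shows "\<exists>K. \<forall>t\<in>{a..b}. \<forall>x. \<bar>F t x\<bar> \<le> K"
proof -
  have "compact ((\<lambda>(t, x). F t x) ` ({a..b} \<times> {-L..L}))"
    by (intro compact_continuous_image continuous_on_subset[OF assms(1)] compact_Times) auto
  then obtain K where K: "\<And>t x. t \<in> {a..b} \<Longrightarrow> x \<in> {-L..L} \<Longrightarrow> \<bar>F t x\<bar> \<le> K"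
    using compact_imp_bounded[of "(\<lambda>(t, x). F t x) ` ({a..b} \<times> {-L..L})"] unfolding bounded_iff by force
  have "\<bar>F t x\<bar> \<le> max 0 K" if "t \<in> {a..b}" for t x
  proof (cases "L < \<bar>x\<bar>")
    case False
    then have "x \<in> {-L..L}"
      by auto
    from K[OF that this] show ?thesis
      by linarith
  qed (simp add: assms(2))
  then show ?thesis by blast
qed

lemma continuous_on_compose_pair:
  fixes F :: "real \<Rightarrow> real \<Rightarrow> real"
  assumes "continuous_on UNIV (\<lambda>(t, x). F t x)" "continuous_on A a" "continuous_on A b"
  shows "continuous_on A (\<lambda>r. F (a r) (b r))"
  using continuous_on_compose2[OF assms(1) continuous_on_Pair[OF assms(2,3)]] by simp

lemma continuous_on_section:
  fixes F :: "real \<Rightarrow> real \<Rightarrow> real"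
  shows "continuous_on UNIV (\<lambda>(t, x). F t x) \<Longrightarrow> continuous_on UNIV (F t)"
  using continuous_on_compose_pair[of F UNIV "\<lambda>_. t" "\<lambda>x. x"] by simp

lemma tendsto_gauss_mean:
  fixes f :: "real \<Rightarrow> real"
  assumes cont: "continuous_on UNIV f" and K: "\<And>x. \<bar>f x\<bar> \<le> K" and c: "c \<longlonglongrightarrow> c0"
  shows "(\<lambda>n. gauss_mean f (c n) y) \<longlonglongrightarrow> gauss_mean f c0 y"
  unfolding gauss_mean_def
proof (rule integral_dominated_convergence[where w="\<lambda>z. std_normal_density z * K"])
  have [measurable]: "f \<in> borel_measurable borel"
    by (rule borel_measurable_continuous_onI[OF cont])
  show "(\<lambda>z. std_normal_density z * f (y - c0 * z)) \<in> borel_measurable lborel"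
    "\<And>n. (\<lambda>z. std_normal_density z * f (y - c n * z)) \<in> borel_measurable lborel"
    by simp_all
  show "integrable lborel (\<lambda>z. std_normal_density z * K)"
    by simp
  show "AE z in lborel. norm (std_normal_density z * f (y - c n * z)) \<le> std_normal_density z * K" for n
    using K by (intro AE_I2) (auto simp: abs_mult intro!: mult_left_mono)
  show "AE z in lborel. (\<lambda>n. std_normal_density z * f (y - c n * z)) \<longlonglongrightarrow> std_normal_density z * f (y - c0 * z)"
  proof (rule AE_I2, rule tendsto_mult[OF tendsto_const])
    fix z
    have "isCont f (y - c0 * z)"
      using cont by (simp add: continuous_on_eq_continuous_at)
    then show "(\<lambda>n. f (y - c n * z)) \<longlonglongrightarrow> f (y - c0 * z)"
      by (rule isCont_tendsto_compose) (intro tendsto_intros c)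
  qed
qed

text \<open>Supplies the cadlag condition of \<open>density\<close>. By duality only the mean of
  \<open>f\<close> varies with time. Along a convergent sequence of times the standard deviations
  are bounded by some S, which gives one Cauchy-type majorant for the whole sequence.\<close>

lemma rho_vaguely_continuous:
  assumes g: "M1 g" and f: "Cc f"
  shows "isCont (\<lambda>t. LBINT x. f x * rho g t x) t"
proof -
  note [measurable] = M1_measurable[OF g]
  obtain L where cont: "continuous_on UNIV f" and L: "\<And>x. L < \<bar>x\<bar> \<Longrightarrow> f x = 0" "0 \<le> L"
    using f unfolding Cc_def by (metis abs_ge_self abs_ge_zero order_le_less_trans)
  obtain K where K: "\<And>x. \<bar>f x\<bar> \<le> K"
    using continuous_compact_support_bounded[OF cont L(1)] by auto
  have [measurable]: "f \<in> borel_measurable borel"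
    by (rule borel_measurable_continuous_onI[OF cont])
  have eq: "(LBINT x. f x * rho g t x) = (LBINT y. g y * gauss_mean f (sqrt t) y)" for t
    by (rule rho_pairing[OF g _ K L]) simp_all
  show ?thesis
    unfolding continuous_at_sequentially comp_def eq
  proof (intro allI impI)
    fix X assume X: "X \<longlonglongrightarrow> t"
    then have sX: "(\<lambda>n. sqrt (X n)) \<longlonglongrightarrow> sqrt t"
      by (rule tendsto_real_sqrt)
    then obtain S where S: "\<And>n. \<bar>sqrt (X n)\<bar> \<le> S"
      using convergent_imp_Bseq[of "\<lambda>n. sqrt (X n)"] by (force simp: convergent_def Bseq_def)
    let ?C = "LBINT z. std_normal_density z * (K * (1 + (L + S * \<bar>z\<bar>)\<^sup>2))"
    show "(\<lambda>n. LBINT y. g y * gauss_mean f (sqrt (X n)) y) \<longlonglongrightarrow> (LBINT y. g y * gauss_mean f (sqrt t) y)"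
    proof (rule integral_dominated_convergence[where w="\<lambda>y. ?C * (1 / (1 + y\<^sup>2))"])
      show "integrable lborel (\<lambda>y. ?C * (1 / (1 + y\<^sup>2)))"
        by (intro integrable_mult_right integrable_inverse_square)
      show "AE y in lborel. norm (g y * gauss_mean f (sqrt (X n)) y) \<le> ?C * (1 / (1 + y\<^sup>2))" for n
      proof (rule AE_I2)
        fix y
        have "\<bar>g y\<bar> * \<bar>gauss_mean f (sqrt (X n)) y\<bar> \<le> 1 * (?C * (1 / (1 + y\<^sup>2)))"
          using M1_bounds[OF g, of y] by (intro mult_mono gauss_mean_bound[OF K L S]) auto
        then show "norm (g y * gauss_mean f (sqrt (X n)) y) \<le> ?C * (1 / (1 + y\<^sup>2))"
          by (simp add: abs_mult)
      qed
      show "AE y in lborel. (\<lambda>n. g y * gauss_mean f (sqrt (X n)) y) \<longlonglongrightarrow> g y * gauss_mean f (sqrt t) y"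
        by (intro AE_I2 tendsto_mult tendsto_const tendsto_gauss_mean[OF cont K sX])
    qed auto
  qed
qed

section \<open>The weak heat equation\<close>

lemma tendsto_std_normal_density:
  "(std_normal_density \<longlongrightarrow> 0) at_top" "(std_normal_density \<longlongrightarrow> 0) at_bot"
proof -
  have "((\<lambda>x::real. (1 / sqrt (2 * pi)) * exp (- (x\<^sup>2 / 2))) \<longlongrightarrow> (1 / sqrt (2 * pi)) * 0) F"
    if "filterlim (\<lambda>x::real. x\<^sup>2 / 2) at_top F" for F
    by (intro tendsto_mult tendsto_const filterlim_compose[OF exp_at_bot]
        filterlim_compose[OF filterlim_uminus_at_bot_at_top] that)
  moreover have "filterlim (\<lambda>x::real. x\<^sup>2 / 2) at_top at_top"
    by (intro filterlim_at_top_mult_tendsto_pos[of "\<lambda>_. 1/2" "1/2", simplified] filterlim_pow_at_top filterlim_ident) auto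
  moreover have "filterlim (\<lambda>x::real. x\<^sup>2 / 2) at_top at_bot"
    unfolding filterlim_at_bot_mirror using calculation(2) by simp
  ultimately show "(std_normal_density \<longlongrightarrow> 0) at_top" "(std_normal_density \<longlongrightarrow> 0) at_bot"
    by (simp_all add: std_normal_density_def[abs_def])
qed

text \<open>Stein's identity: \<open>z * std_normal_density z\<close> is minus the derivative of the
  density, and the boundary terms of \<open>std_normal_density z * u (y - r * z)\<close> vanish
  because \<open>u\<close> is bounded.\<close>

lemma gauss_integration_by_parts:
  fixes u u' :: "real \<Rightarrow> real"
  assumes deriv: "\<And>x. (u has_real_derivative u' x) (at x)" and cont: "continuous_on UNIV u'"
    and bound: "\<And>x. \<bar>u x\<bar> \<le> K" "\<And>x. \<bar>u' x\<bar> \<le> K"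
  shows "(LBINT z. std_normal_density z * (z * u (y - r * z))) =
    - r * (LBINT z. std_normal_density z * u' (y - r * z))"
proof -
  have K: "0 \<le> K"
    using bound(1)[of 0] by linarith
  have contu: "continuous_on UNIV u"
    using deriv by (meson DERIV_isCont continuous_at_imp_continuous_on)
  have [measurable]: "u \<in> borel_measurable borel" "u' \<in> borel_measurable borel"
    using contu cont by (auto intro: borel_measurable_continuous_onI)
  have int1: "integrable lborel (\<lambda>z. std_normal_density z * (z * u (y - r * z)))"
  proof (rule Bochner_Integration.integrable_bound)
    show "integrable lborel (\<lambda>z. (std_normal_density z * \<bar>z\<bar> ^ 1) * K)"
      by (intro integrable_mult_left integrable_std_normal_moment_abs)
    show "AE z in lborel. norm (std_normal_density z * (z * u (y - r * z))) \<le> norm (std_normal_density z * \<bar>z\<bar> ^ 1 * K)"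
      using bound(1) K by (intro AE_I2) (simp add: abs_mult mult_left_mono mult.assoc)
  qed simp
  have int2: "integrable lborel (\<lambda>z. std_normal_density z * u' (y - r * z))"
    using bound(2) by (intro integrable_std_normal_mult_bounded) auto
  let ?f = "\<lambda>z. - (std_normal_density z * (z * u (y - r * z))) - r * (std_normal_density z * u' (y - r * z))"
  have "(LBINT z=-\<infinity>..\<infinity>. ?f z) = 0 - 0"
  proof (rule interval_integral_FTC_integrable)
    fix z
    have "((\<lambda>z. std_normal_density z * u (y - r * z)) has_real_derivative ?f z) (at z)"
      by (auto intro!: derivative_eq_intros std_normal_density_deriv DERIV_chain2[OF deriv])
    then show "((\<lambda>z. std_normal_density z * u (y - r * z)) has_vector_derivative ?f z) (at z)"
      by (simp add: has_real_derivative_iff_has_vector_derivative)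
    have "continuous_on UNIV ?f"
      by (intro continuous_intros continuous_on_compose2[OF contu] continuous_on_compose2[OF cont]) auto
    then show "isCont ?f z"
      by (simp add: continuous_on_eq_continuous_at)
  next
    show "set_integrable lborel (einterval (-\<infinity>) \<infinity>) ?f"
      unfolding set_integrable_def by (simp add: einterval_def int1 int2)
    have 0: "((\<lambda>z. std_normal_density z * u (y - r * z)) \<longlongrightarrow> 0) F"
      if "(std_normal_density \<longlongrightarrow> 0) F" for F
    proof (rule Lim_null_comparison)
      show "\<forall>\<^sub>F z in F. norm (std_normal_density z * u (y - r * z)) \<le> std_normal_density z * K"
        using bound(1) by (intro always_eventually) (auto simp: abs_mult intro!: mult_left_mono)
      show "((\<lambda>z. std_normal_density z * K) \<longlongrightarrow> 0) F"
        using tendsto_mult_right[OF that, of K] by simp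
    qed
    show "(((\<lambda>z. std_normal_density z * u (y - r * z)) \<circ> real_of_ereal) \<longlongrightarrow> 0) (at_right (-\<infinity>))"
      "(((\<lambda>z. std_normal_density z * u (y - r * z)) \<circ> real_of_ereal) \<longlongrightarrow> 0) (at_left \<infinity>)"
      by (simp_all add: ereal_tendsto_simps1 0 tendsto_std_normal_density)
  qed simp
  then have "(LBINT z. ?f z) = 0"
    by (simp add: interval_lebesgue_integral_def set_lebesgue_integral_def einterval_def)
  then show ?thesis
    using int1 int2 by (simp add: Bochner_Integration.integral_diff)
qed

text \<open>\<open>C12K\<close> provides partial derivatives only. Continuity of one of them, here
  \<open>Gx\<close>, upgrades them to a total derivative, to which the chain rule applies.\<close>

lemma partials_imp_derivative_along_curve:
  fixes G :: "real \<Rightarrow> real \<Rightarrow> real"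
  assumes "\<And>t x. ((\<lambda>s. G s x) has_real_derivative Gt t x) (at t)"
    and "\<And>t x. ((\<lambda>y. G t y) has_real_derivative Gx t x) (at x)"
    and "continuous_on UNIV (\<lambda>(t, x). Gx t x)"
    and "(a has_real_derivative a') (at r)" "(b has_real_derivative b') (at r)"
  shows "((\<lambda>r. G (a r) (b r)) has_real_derivative Gt (a r) (b r) * a' + Gx (a r) (b r) * b') (at r)"
proof -
  have "((\<lambda>(t, x). G t x) has_derivative
      (\<lambda>(tx, ty). Gt (a r) (b r) * tx + blinfun_scaleR_left (Gx (a r) (b r)) ty))
      (at (a r, b r) within UNIV \<times> UNIV)"
  proof (rule has_derivative_partialsI)
    show "((\<lambda>x. G x (b r)) has_derivative (*) (Gt (a r) (b r))) (at (a r) within UNIV)"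
      using assms(1) by (simp add: has_field_derivative_def)
    show "((\<lambda>y. G x y) has_derivative blinfun_apply (blinfun_scaleR_left (Gx x y))) (at y within UNIV)" for x y
      using assms(2)[of x y] by (simp add: has_field_derivative_def mult_commute_abs)
    have "continuous_on UNIV (\<lambda>p. blinfun_scaleR_left ((\<lambda>(t, x). Gx t x) p))"
      by (intro continuous_intros assms(3))
    then show "continuous (at (a r, b r) within UNIV \<times> UNIV) (\<lambda>(x, y). blinfun_scaleR_left (Gx x y))"
      by (simp add: continuous_on_eq_continuous_within split_beta')
  qed auto
  then have G: "((\<lambda>(t, x). G t x) has_derivative (\<lambda>(tx, ty). Gt (a r) (b r) * tx + Gx (a r) (b r) * ty))
      (at (a r, b r))"
    by (simp add: mult.commute)
  have ab: "((\<lambda>r. (a r, b r)) has_derivative (\<lambda>h. (a' * h, b' * h))) (at r)"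
    using assms(4,5) by (intro has_derivative_Pair) (simp_all add: has_field_derivative_def)
  from diff_chain_at[OF ab, unfolded comp_def, OF G] show ?thesis
    unfolding has_field_derivative_def split_conv
    by (rule has_derivative_eq_rhs) (simp add: fun_eq_iff algebra_simps)
qed


text \<open>\<open>C12K\<close> confines only \<open>G\<close> to a strip. The outside is open, so
  the space derivatives vanish there; the time derivative vanishes because \<open>G\<close> is zero
  at all times at such a point.\<close>

lemma C12K_support:
  assumes "C12K G Gt Gx Gxx"
  shows "\<exists>L\<ge>0. \<forall>t x. L < \<bar>x\<bar> \<longrightarrow> G t x = 0 \<and> Gt t x = 0 \<and> Gx t x = 0 \<and> Gxx t x = 0"
proof -
  note C = assms[unfolded C12K_def]
  from C obtain L where L: "\<And>t x. L < \<bar>x\<bar> \<Longrightarrow> G t x = 0"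
    by blast
  have op: "open {y. max 0 L < \<bar>y::real\<bar>}"
    by (intro open_Collect_less continuous_intros)
  have zero: "h' = 0" if "(h has_real_derivative h') (at x)" "max 0 L < \<bar>x\<bar>" "\<And>y. max 0 L < \<bar>y\<bar> \<Longrightarrow> h y = 0" for h h' x
  proof -
    have "((\<lambda>_. 0) has_real_derivative h') (at x)"
      by (rule has_field_derivative_transform_within_open[OF that(1) op]) (use that in auto)
    then show ?thesis
      by (rule DERIV_unique) simp
  qed
  have 1: "G t x = 0" if "max 0 L < \<bar>x\<bar>" for t x
    using L that by simp
  have 2: "Gx t x = 0" if "max 0 L < \<bar>x\<bar>" for t x
    by (rule zero[of "G t"]) (use C 1 that in auto)
  have 3: "Gxx t x = 0" if "max 0 L < \<bar>x\<bar>" for t x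
    by (rule zero[of "Gx t"]) (use C 2 that in auto)
  have 4: "Gt t x = 0" if "max 0 L < \<bar>x\<bar>" for t x
  proof -
    have "(\<lambda>s. G s x) = (\<lambda>_. 0)"
      using 1 that by auto
    then have "((\<lambda>_. 0) has_real_derivative Gt t x) (at t)"
      using C by metis
    then show ?thesis
      by (rule DERIV_unique) simp
  qed
  show ?thesis
    using 1 2 3 4 by (intro exI[of _ "max 0 L"]) auto
qed

text \<open>Ito's formula for \<open>G\<close> along a Brownian motion, in elementary form. With
  variance \<open>r\<^sup>2\<close> as time, the curve r to \<open>G (r\<^sup>2) (y - r * z)\<close>
  is continuously differentiable up to r = 0. Averaging its derivative over z, Stein's identity
  turns the term with \<open>z * Gx\<close> into \<open>r * Gxx\<close>.\<close>

lemma gauss_mean_heat: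
  assumes C: "C12K G Gt Gx Gxx" and "0 \<le> S"
  shows "gauss_mean (G (S\<^sup>2)) S y - G 0 y =
    (LBINT r:{0..S}. 2 * r * gauss_mean (\<lambda>x. Gt (r\<^sup>2) x + Gxx (r\<^sup>2) x / 2) r y)"
proof -
  note C' = C[unfolded C12K_def]
  obtain L where L: "0 \<le> L" "\<And>t x. L < \<bar>x\<bar> \<Longrightarrow> G t x = 0 \<and> Gt t x = 0 \<and> Gx t x = 0 \<and> Gxx t x = 0"
    using C12K_support[OF C] by metis
  obtain K1 where K1: "\<And>t x. t \<in> {0..S\<^sup>2} \<Longrightarrow> \<bar>G t x\<bar> \<le> K1"
    using continuous_strip_bounded[of G L 0 "S\<^sup>2"] C' L by metis
  obtain K2 where K2: "\<And>t x. t \<in> {0..S\<^sup>2} \<Longrightarrow> \<bar>Gt t x\<bar> \<le> K2"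
    using continuous_strip_bounded[of Gt L 0 "S\<^sup>2"] C' L by metis
  obtain K3 where K3: "\<And>t x. t \<in> {0..S\<^sup>2} \<Longrightarrow> \<bar>Gx t x\<bar> \<le> K3"
    using continuous_strip_bounded[of Gx L 0 "S\<^sup>2"] C' L by metis
  obtain K4 where K4: "\<And>t x. t \<in> {0..S\<^sup>2} \<Longrightarrow> \<bar>Gxx t x\<bar> \<le> K4"
    using continuous_strip_bounded[of Gxx L 0 "S\<^sup>2"] C' L by metis
  have sq: "r\<^sup>2 \<in> {0..S\<^sup>2}" if "r \<in> {0..S}" for r
    using that by (auto intro: power_mono)
  have mG: "case_prod G \<in> borel_measurable (borel \<Otimes>\<^sub>M borel)" "case_prod Gt \<in> borel_measurable (borel \<Otimes>\<^sub>M borel)"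
    "case_prod Gx \<in> borel_measurable (borel \<Otimes>\<^sub>M borel)" "case_prod Gxx \<in> borel_measurable (borel \<Otimes>\<^sub>M borel)"
    using C' by (auto intro: continuous_on_case_prod_measurable)
  note meas [measurable (raw)] = mG[THEN measurable_case_prod_compose]
  let ?d = "\<lambda>r z. 2 * r * Gt (r\<^sup>2) (y - r * z) - z * Gx (r\<^sup>2) (y - r * z)"
  have path: "G (S\<^sup>2) (y - S * z) - G 0 y = (LBINT r:{0..S}. ?d r z)" for z
  proof -
    have "((\<lambda>r. G (r\<^sup>2) (y - r * z)) has_real_derivative Gt (r\<^sup>2) (y - r * z) * (2 * r) + Gx (r\<^sup>2) (y - r * z) * (- z)) (at r)" for r
      by (rule partials_imp_derivative_along_curve[where Gt=Gt and Gx=Gx]) (use C' in \<open>auto intro!: derivative_eq_intros\<close>)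
    then have deriv: "((\<lambda>r. G (r\<^sup>2) (y - r * z)) has_real_derivative ?d r z) (at r)" for r
      by (simp add: mult_ac)
    have "continuous_on UNIV (\<lambda>r. Gt (r\<^sup>2) (y - r * z))"
      using C' by (intro continuous_on_compose_pair[of Gt] continuous_intros) auto
    moreover have "continuous_on UNIV (\<lambda>r. Gx (r\<^sup>2) (y - r * z))"
      using C' by (intro continuous_on_compose_pair[of Gx] continuous_intros) auto
    ultimately have "continuous_on UNIV (\<lambda>r. ?d r z)"
      by (intro continuous_intros)
    then have "isCont (\<lambda>r. ?d r z) r" for r
      by (simp add: continuous_on_eq_continuous_at)
    from integral_FTC_Icc_real[OF \<open>0 \<le> S\<close> deriv this] show ?thesis
      by (simp add: set_lebesgue_integral_def mult.commute)
  qed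
  have "gauss_mean (G (S\<^sup>2)) S y - G 0 y = (LBINT z. std_normal_density z * (G (S\<^sup>2) (y - S * z) - G 0 y))"
  proof -
    have "integrable lborel (\<lambda>z. std_normal_density z * G (S\<^sup>2) (y - S * z))"
      by (intro integrable_std_normal_mult_bounded[where K=K1]) (use K1 in \<open>auto\<close>)
    then show ?thesis
      unfolding gauss_mean_def right_diff_distrib by (subst Bochner_Integration.integral_diff) auto
  qed
  also have "\<dots> = (LBINT z. (LBINT r. std_normal_density z * (indicator {0..S} r * ?d r z)))"
    unfolding path set_lebesgue_integral_def by simp
  also have "\<dots> = (LBINT r. (LBINT z. std_normal_density z * (indicator {0..S} r * ?d r z)))"
  \<comment> \<open>The last factor of \<open>k\<close> is 1; it is there only to match the shape of
    \<open>integrable_std_normal_poly\<close>.\<close>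
  proof (rule Fubini_product_bound[where h="\<lambda>r. indicator {0..S} r" and k="\<lambda>z. std_normal_density z * ((2 * S * K2 + K3 * \<bar>z\<bar>) * (1 + (0 + 0 * \<bar>z\<bar>)\<^sup>2))"])
    show "integrable lborel (\<lambda>z. std_normal_density z * ((2 * S * K2 + K3 * \<bar>z\<bar>) * (1 + (0 + 0 * \<bar>z\<bar>)\<^sup>2)))"
      by (rule integrable_std_normal_poly)
    show "(\<lambda>(r, z). std_normal_density z * (indicator {0..S} r * ?d r z)) \<in> borel_measurable (borel \<Otimes>\<^sub>M borel)"
      unfolding split_beta' by measurable
    fix r z
    have "\<bar>?d r z\<bar> \<le> 2 * S * K2 + K3 * \<bar>z\<bar>" if r: "r \<in> {0..S}"
    proof -
      have "\<bar>?d r z\<bar> \<le> \<bar>2 * r * Gt (r\<^sup>2) (y - r * z)\<bar> + \<bar>z * Gx (r\<^sup>2) (y - r * z)\<bar>"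
        by (rule abs_triangle_ineq4)
      also have "\<dots> = 2 * r * \<bar>Gt (r\<^sup>2) (y - r * z)\<bar> + \<bar>Gx (r\<^sup>2) (y - r * z)\<bar> * \<bar>z\<bar>"
        using r by (simp add: abs_mult)
      also have "\<dots> \<le> 2 * S * K2 + K3 * \<bar>z\<bar>"
        using r K2[OF sq[OF r]] K3[OF sq[OF r]] order_trans[OF abs_ge_zero K3[OF sq[OF r]]]
        by (intro add_mono mult_mono) auto
      finally show ?thesis .
    qed
    then show "\<bar>std_normal_density z * (indicator {0..S} r * ?d r z)\<bar> \<le>
        indicator {0..S} r * (std_normal_density z * ((2 * S * K2 + K3 * \<bar>z\<bar>) * (1 + (0 + 0 * \<bar>z\<bar>)\<^sup>2)))"
      by (auto simp: abs_mult indicator_def intro!: mult_left_mono)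
  qed simp
  also have "\<dots> = (LBINT r:{0..S}. 2 * r * gauss_mean (\<lambda>x. Gt (r\<^sup>2) x + Gxx (r\<^sup>2) x / 2) r y)"
    unfolding set_lebesgue_integral_def
  proof (rule Bochner_Integration.integral_cong[OF refl])
    fix r
    have "(LBINT z. std_normal_density z * ?d r z) = 2 * r * gauss_mean (\<lambda>x. Gt (r\<^sup>2) x + Gxx (r\<^sup>2) x / 2) r y"
      if r: "r \<in> {0..S}"
    proof -
      let ?x = "\<lambda>z. y - r * z"
      have i1: "integrable lborel (\<lambda>z. std_normal_density z * Gt (r\<^sup>2) (?x z))"
        by (intro integrable_std_normal_mult_bounded[where K=K2]) (use K2[OF sq[OF r]] in \<open>auto\<close>)
      have i3: "integrable lborel (\<lambda>z. std_normal_density z * Gxx (r\<^sup>2) (?x z))"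
        by (intro integrable_std_normal_mult_bounded[where K=K4]) (use K4[OF sq[OF r]] in \<open>auto\<close>)
      have i2: "integrable lborel (\<lambda>z. std_normal_density z * (z * Gx (r\<^sup>2) (?x z)))"
      proof (rule Bochner_Integration.integrable_bound)
        show "integrable lborel (\<lambda>z. (std_normal_density z * \<bar>z\<bar> ^ 1) * K3)"
          by (intro integrable_mult_left integrable_std_normal_moment_abs)
        show "AE z in lborel. norm (std_normal_density z * (z * Gx (r\<^sup>2) (?x z))) \<le> norm (std_normal_density z * \<bar>z\<bar> ^ 1 * K3)"
          using order_trans[OF K3[OF sq[OF r]] abs_ge_self]
          by (intro AE_I2) (simp add: abs_mult mult_left_mono mult.assoc)
      qed simp
      have ibp: "(LBINT z. std_normal_density z * (z * Gx (r\<^sup>2) (?x z))) = - r * (LBINT z. std_normal_density z * Gxx (r\<^sup>2) (?x z))"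
      proof (rule gauss_integration_by_parts[where K="max K3 K4"])
        show "continuous_on UNIV (Gxx (r\<^sup>2))"
          using C' by (intro continuous_on_section) auto
      qed (use C' order_trans[OF K3[OF sq[OF r]]] order_trans[OF K4[OF sq[OF r]]] in auto)
      have "(LBINT z. std_normal_density z * ?d r z) = (LBINT z. 2 * r * (std_normal_density z * Gt (r\<^sup>2) (?x z)) - std_normal_density z * (z * Gx (r\<^sup>2) (?x z)))"
        by (simp add: algebra_simps)
      also have "\<dots> = 2 * r * (LBINT z. std_normal_density z * Gt (r\<^sup>2) (?x z)) + r * (LBINT z. std_normal_density z * Gxx (r\<^sup>2) (?x z))"
        using i1 i2 ibp by (subst Bochner_Integration.integral_diff) auto
      also have "\<dots> = 2 * r * ((LBINT z. std_normal_density z * Gt (r\<^sup>2) (?x z)) + (LBINT z. std_normal_density z * Gxx (r\<^sup>2) (?x z) / 2))"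
        by (simp add: algebra_simps)
      also have "(LBINT z. std_normal_density z * Gt (r\<^sup>2) (?x z)) + (LBINT z. std_normal_density z * Gxx (r\<^sup>2) (?x z) / 2) = gauss_mean (\<lambda>x. Gt (r\<^sup>2) x + Gxx (r\<^sup>2) x / 2) r y"
        unfolding gauss_mean_def distrib_left using i1 i3 by (subst Bochner_Integration.integral_add) auto
      finally show ?thesis .
    qed
    then show "(LBINT z. std_normal_density z * (indicator {0..S} r * ?d r z)) =
        indicator {0..S} r *\<^sub>R (2 * r * gauss_mean (\<lambda>x. Gt (r\<^sup>2) x + Gxx (r\<^sup>2) x / 2) r y)"
      by (simp add: indicator_def)
  qed
  finally show ?thesis .
qed

text \<open>The heat flow is a weak solution down to time 0. The increment formula for
  \<open>gauss_mean\<close> is integrated against \<open>g\<close>, and duality turns the result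
  back into pairings with \<open>rho\<close>.\<close>

lemma lfun_rho_eq_0:
  assumes C: "C12K G Gt Gx Gxx" and g: "M1 g" and T: "0 \<le> T"
  shows "lfun T (rho g) G Gt Gxx = 0"
proof -
  define S where "S = sqrt T"
  have S: "0 \<le> S" "T = S\<^sup>2"
    using T by (auto simp: S_def)
  define F where "F = (\<lambda>t x. Gt t x + Gxx t x / 2)"
  note C' = C[unfolded C12K_def]
  obtain L where L: "0 \<le> L" "\<And>t x. L < \<bar>x\<bar> \<Longrightarrow> G t x = 0 \<and> Gt t x = 0 \<and> Gx t x = 0 \<and> Gxx t x = 0"
    using C12K_support[OF C] by metis
  have cont: "continuous_on UNIV (\<lambda>(t, x). G t x)" "continuous_on UNIV (\<lambda>(t, x). F t x)"
    using C' unfolding F_def split_beta' by (auto intro!: continuous_intros)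
  have supp: "G t x = 0" "F t x = 0" if "L < \<bar>x\<bar>" for t x
    using L that by (auto simp: F_def)
  obtain K1 where K1: "\<And>t x. t \<in> {0..S\<^sup>2} \<Longrightarrow> \<bar>G t x\<bar> \<le> K1"
    using continuous_strip_bounded[OF cont(1), of L 0 "S\<^sup>2"] supp(1) by metis
  obtain K2 where K2: "\<And>t x. t \<in> {0..S\<^sup>2} \<Longrightarrow> \<bar>F t x\<bar> \<le> K2"
    using continuous_strip_bounded[OF cont(2), of L 0 "S\<^sup>2"] supp(2) by metis
  have K2_nonneg: "0 \<le> K2"
    using K2[of 0 0] by auto
  have sq: "r\<^sup>2 \<in> {0..S\<^sup>2}" if "r \<in> {0..S}" for r
    using that by (auto intro: power_mono)
  note [measurable] = M1_measurable[OF g]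
  note meas [measurable (raw)] = cont[THEN continuous_on_case_prod_measurable, THEN measurable_case_prod_compose]
    rho_measurable[OF g, THEN measurable_case_prod_compose]
  define C1 where "C1 K = (LBINT z. std_normal_density z * (K * (1 + (L + S * \<bar>z\<bar>)\<^sup>2)))" for K
  have kb: "\<bar>gauss_mean (F (r\<^sup>2)) r y\<bar> \<le> C1 K2 * (1 / (1 + y\<^sup>2))" if "r \<in> {0..S}" for r y
    unfolding C1_def using that K2[OF sq[OF that]] supp L by (intro gauss_mean_bound) auto
  have kbG: "\<bar>gauss_mean (G (S\<^sup>2)) S y\<bar> \<le> C1 K1 * (1 / (1 + y\<^sup>2))" for y
    unfolding C1_def using K1 supp L S by (intro gauss_mean_bound) auto
  define N where "N t = (LBINT x. rho g t x * F t x)" for t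
  have N_measurable [measurable]: "N \<in> borel_measurable borel"
    unfolding N_def[abs_def]
    by (rule lborel.borel_measurable_lebesgue_integral, simp only: split_beta', measurable)
  have N_eq: "N (r\<^sup>2) = (LBINT y. g y * gauss_mean (F (r\<^sup>2)) r y)" if r: "r \<in> {0..S}" for r
  proof -
    have "N (r\<^sup>2) = (LBINT x. F (r\<^sup>2) x * rho g (r\<^sup>2) x)"
      by (simp add: N_def mult.commute)
    also have "\<dots> = (LBINT y. g y * gauss_mean (F (r\<^sup>2)) (sqrt (r\<^sup>2)) y)"
      by (rule rho_pairing[OF g _ K2[OF sq[OF r]] supp(2) L(1)]) auto
    finally show ?thesis
      using r by simp
  qed
  have N_bound: "\<bar>N t\<bar> \<le> K2 * (2 * L)" if t: "t \<in> {0..S\<^sup>2}" for t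
  proof -
    have "\<bar>N t\<bar> \<le> (LBINT x. K2 * indicator {-L..L} x)"
      unfolding N_def
    proof (rule abs_integral_le)
      fix x
      have "\<bar>rho g t x\<bar> * \<bar>F t x\<bar> \<le> 1 * (K2 * indicator {-L..L} x)"
        using rho_nonneg[OF g, of t x] rho_le_1[OF g, of t x] K2[OF t, of x] supp(2)[of x t] K2_nonneg
        by (intro mult_mono) (auto simp: indicator_def)
      then show "\<bar>rho g t x * F t x\<bar> \<le> K2 * indicator {-L..L} x"
        by (simp add: abs_mult)
    qed simp
    then show ?thesis
      using L by simp
  qed
  have "(LBINT x. G T x * rho g T x) = (LBINT y. g y * gauss_mean (G (S\<^sup>2)) (sqrt T) y)"
    unfolding S(2)[symmetric] by (rule rho_pairing[OF g _ K1 supp(1) L(1)]) (use S in auto)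
  then have GT: "(LBINT x. G T x * rho g T x) = (LBINT y. g y * gauss_mean (G (S\<^sup>2)) S y)"
    by (simp add: S_def)
  have i1: "integrable lborel (\<lambda>y. g y * gauss_mean (G (S\<^sup>2)) S y)"
  proof (rule Bochner_Integration.integrable_bound)
    show "integrable lborel (\<lambda>y. C1 K1 * (1 / (1 + y\<^sup>2)))"
      by (intro integrable_mult_right integrable_inverse_square)
    have "\<bar>g y\<bar> * \<bar>gauss_mean (G (S\<^sup>2)) S y\<bar> \<le> 1 * (C1 K1 * (1 / (1 + y\<^sup>2)))" for y
      using M1_bounds[OF g, of y] kbG by (intro mult_mono) auto
    then show "AE y in lborel. norm (g y * gauss_mean (G (S\<^sup>2)) S y) \<le> norm (C1 K1 * (1 / (1 + y\<^sup>2)))"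
      by (intro AE_I2) (metis abs_ge_self abs_mult mult_1 order_trans real_norm_def)
  qed simp
  have i2: "integrable lborel (\<lambda>y. g y * G 0 y)"
    unfolding mult.commute[of "g _"]
    by (rule integrable_bounded_compact_support[where K=K1 and L=L]) (use K1[of 0] supp in \<open>auto intro: abs_mult_M1_le g\<close>)
  have "(LBINT x. G T x * rho g T x) - (LBINT x. G 0 x * rho g 0 x) =
      (LBINT y. g y * (gauss_mean (G (S\<^sup>2)) S y - G 0 y))"
    unfolding GT right_diff_distrib using i1 i2 by (subst Bochner_Integration.integral_diff) (auto simp: mult.commute)
  also have "\<dots> = (LBINT y. (LBINT r. g y * (indicator {0..S} r * (2 * r * gauss_mean (F (r\<^sup>2)) r y))))"
    unfolding gauss_mean_heat[OF C S(1)] set_lebesgue_integral_def F_def by simp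
  also have "\<dots> = (LBINT r. (LBINT y. g y * (indicator {0..S} r * (2 * r * gauss_mean (F (r\<^sup>2)) r y))))"
  proof (rule Fubini_product_bound[where h="\<lambda>r. indicator {0..S} r" and k="\<lambda>y. 2 * S * C1 K2 * (1 / (1 + y\<^sup>2))"])
    show "integrable lborel (\<lambda>y. 2 * S * C1 K2 * (1 / (1 + y\<^sup>2)))"
      by (intro integrable_mult_right integrable_inverse_square)
    have [measurable]: "(\<lambda>p. gauss_mean (F ((fst p)\<^sup>2)) (fst p) (snd p)) \<in> borel_measurable (borel \<Otimes>\<^sub>M borel)"
      unfolding gauss_mean_def
      by (rule lborel.borel_measurable_lebesgue_integral, simp only: split_beta', measurable)
    show "(\<lambda>(r, y). g y * (indicator {0..S} r * (2 * r * gauss_mean (F (r\<^sup>2)) r y))) \<in> borel_measurable (borel \<Otimes>\<^sub>M borel)"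
      unfolding split_beta' by measurable
    fix r y
    have "\<bar>g y\<bar> * \<bar>2 * r * gauss_mean (F (r\<^sup>2)) r y\<bar> \<le> 1 * (2 * S * (C1 K2 * (1 / (1 + y\<^sup>2))))" if "r \<in> {0..S}"
      unfolding abs_mult using M1_bounds[OF g, of y] kb[OF that] that by (intro mult_mono) auto
    then show "\<bar>g y * (indicator {0..S} r * (2 * r * gauss_mean (F (r\<^sup>2)) r y))\<bar> \<le>
        indicator {0..S} r * (2 * S * C1 K2 * (1 / (1 + y\<^sup>2)))"
      by (auto simp: abs_mult indicator_def)
  qed simp
  also have "\<dots> = (LBINT r. N (r\<^sup>2) * (2 * r) * indicator {0..S} r)"
    by (intro Bochner_Integration.integral_cong refl) (auto simp: indicator_def N_eq simp flip: integral_mult_left_zero intro!: Bochner_Integration.integral_cong)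
  \<comment> \<open>Substitution \<open>t = r\<^sup>2\<close>; the factor \<open>2 * r\<close> from
    the curve derivative is exactly the Jacobian.\<close>
  also have "\<dots> = (LBINT t. N t * indicator {0\<^sup>2..S\<^sup>2} t)"
  proof (rule integral_substitution(2)[symmetric])
    show "set_integrable lborel {0\<^sup>2..S\<^sup>2} N"
      unfolding set_integrable_def
    proof (rule Bochner_Integration.integrable_bound)
      show "integrable lborel (\<lambda>t. K2 * (2 * L) * indicator {0..S\<^sup>2} t)"
        by simp
      show "AE t in lborel. norm (indicat_real {0\<^sup>2..S\<^sup>2} t *\<^sub>R N t) \<le> norm (K2 * (2 * L) * indicator {0..S\<^sup>2} t)"
        using order_trans[OF N_bound abs_ge_self] by (intro AE_I2) (auto simp: indicator_def)
    qed simp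
  qed (use S in \<open>auto intro!: derivative_eq_intros continuous_intros\<close>)
  also have "\<dots> = (LBINT t:{0..T}. (LBINT x. rho g t x * (Gt t x + Gxx t x / 2)))"
    using S by (simp add: set_lebesgue_integral_def N_def[abs_def] F_def mult.commute)
  finally show ?thesis
    by (simp add: lfun_def)
qed

section \<open>Currents and the hydrodynamic profile\<close>

text \<open>An improper integral, as in the rate functions, since \<open>mu T - mu 0\<close> is not
  known to be absolutely integrable. The base point is kept free for the tagged particle.\<close>

definition has_current :: "(real \<Rightarrow> real) \<Rightarrow> real \<Rightarrow> real \<Rightarrow> bool" where
  "has_current h s b \<longleftrightarrow> ((\<lambda>L. LBINT x=ereal s..ereal L. h x) \<longlongrightarrow> b) at_top"

definition bounded_measurable :: "(real \<Rightarrow> real) \<Rightarrow> bool" where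
  "bounded_measurable h \<longleftrightarrow> h \<in> borel_measurable borel \<and> (\<exists>K. \<forall>x. \<bar>h x\<bar> \<le> K)"

lemma bounded_measurable_M1: "M1 g \<Longrightarrow> bounded_measurable g"
  unfolding bounded_measurable_def M1_def by (auto intro!: exI[of _ 1] simp: abs_le_iff intro: order_trans[of _ 0])

lemma bounded_measurable_diff:
  assumes "bounded_measurable f" "bounded_measurable h"
  shows "bounded_measurable (\<lambda>x. f x - h x)"
proof -
  from assms obtain K1 K2 where *: "\<And>x. \<bar>f x\<bar> \<le> K1" "\<And>x. \<bar>h x\<bar> \<le> K2"
    unfolding bounded_measurable_def by blast
  have "\<bar>f x - h x\<bar> \<le> K1 + K2" for x
    using *(1)[of x] *(2)[of x] by linarith
  then show ?thesis
    using assms unfolding bounded_measurable_def by auto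
qed

lemma interval_integrable_bounded_measurable:
  assumes "bounded_measurable h"
  shows "interval_lebesgue_integrable lborel (ereal a) (ereal b) h"
proof -
  from assms obtain K where [measurable]: "h \<in> borel_measurable borel" and K: "\<And>x. \<bar>h x\<bar> \<le> K"
    unfolding bounded_measurable_def by blast
  have "set_integrable lborel {c<..<d} h" for c d
    unfolding set_integrable_def
  proof (rule Bochner_Integration.integrable_bound)
    show "integrable lborel (\<lambda>x. K * indicator {c..d} x)"
      by simp
    show "AE x in lborel. norm (indicat_real {c<..<d} x *\<^sub>R h x) \<le> norm (K * indicator {c..d} x)"
      using order_trans[OF K abs_ge_self] by (intro AE_I2) (auto simp: indicator_def)
  qed simp
  then show ?thesis
    by (simp add: interval_lebesgue_integrable_def einterval_eq)
qed

lemma interval_integral_split: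
  assumes "bounded_measurable h"
  shows "(LBINT x=ereal a..ereal b. h x) + (LBINT x=ereal b..ereal c. h x) = (LBINT x=ereal a..ereal c. h x)"
proof (rule interval_integral_sum)
  show "interval_lebesgue_integrable lborel (min (ereal a) (min (ereal b) (ereal c))) (max (ereal a) (max (ereal b) (ereal c))) h"
    using interval_integrable_bounded_measurable[OF assms, of "min a (min b c)" "max a (max b c)"]
    by (simp add: ereal_min ereal_max)
qed

lemma interval_integral_diff_bm:
  assumes "bounded_measurable f" "bounded_measurable h"
  shows "(LBINT x=ereal a..ereal b. f x - h x) = (LBINT x=ereal a..ereal b. f x) - (LBINT x=ereal a..ereal b. h x)"
  using assms by (intro interval_lebesgue_integral_diff interval_integrable_bounded_measurable)

lemma has_current_shift:
  assumes "bounded_measurable h" "has_current h a b"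
  shows "has_current h s (b - (LBINT x=ereal a..ereal s. h x))"
proof -
  have "(LBINT x=ereal s..ereal L. h x) = (LBINT x=ereal a..ereal L. h x) - (LBINT x=ereal a..ereal s. h x)" for L
    using interval_integral_split[OF assms(1), of a s L] by simp
  then show ?thesis
    using assms(2) unfolding has_current_def by (auto intro!: tendsto_diff)
qed

lemma has_current_diff:
  assumes "bounded_measurable f" "bounded_measurable h" "has_current f s b" "has_current h s c"
  shows "has_current (\<lambda>x. f x - h x) s (b - c)"
  using assms unfolding has_current_def by (simp add: interval_integral_diff_bm tendsto_diff)

lemma has_current_AE_cong:
  assumes "bounded_measurable f" "bounded_measurable h" "AE x in lborel. f x = h x" "has_current f s b"
  shows "has_current h s b"
proof -
  have "(LBINT x=ereal s..ereal L. f x) = (LBINT x=ereal s..ereal L. h x)" for L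
    using assms(1-3) unfolding bounded_measurable_def by (intro interval_integral_cong_AE) auto
  then show ?thesis
    using assms(4) by (simp add: has_current_def)
qed

lemma has_current_integrable:
  assumes "set_integrable lborel {s..} h"
  shows "has_current h s (LBINT x:{s..}. h x)"
proof -
  have "((\<lambda>L. LBINT x. indicator {..L} x *\<^sub>R (indicator {s..} x *\<^sub>R h x)) \<longlongrightarrow>
      (LBINT x:{s..}. h x)) at_top"
    using assms unfolding set_integrable_def set_lebesgue_integral_def
    by (intro tendsto_integral_at_top) auto
  moreover have "\<forall>\<^sub>F L in at_top. (LBINT x. indicator {..L} x *\<^sub>R (indicator {s..} x *\<^sub>R h x)) =
      (LBINT x=ereal s..ereal L. h x)"
    using eventually_ge_at_top[of s]
  proof eventually_elim
    case (elim L)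
    then show ?case
      by (subst interval_integral_Icc) (auto simp: set_lebesgue_integral_def indicator_def intro!: Bochner_Integration.integral_cong)
  qed
  ultimately show ?thesis
    unfolding has_current_def by (rule Lim_transform_eventually)
qed

lemma M1_bc_compl: "M1_bc rl rr g \<Longrightarrow> M1_bc (1 - rl) (1 - rr) (\<lambda>x. 1 - g x)"
  unfolding M1_bc_def using M1_compl by auto

section \<open>Positivity and spatial decay of the heat flow; the numbers \<open>vT\<close> and
  \<open>uT\<close>\<close>

text \<open>From time \<open>t0\<close> on, \<open>xl\<close> and \<open>xr\<close> lie within k
  standard deviations of 0. From x at most 0 the Gaussian reaches the left plateau with probability
  at least \<open>Phi (- k)\<close>, from positive x the right plateau; both bounds are uniform in x
  and t, although \<open>g\<close> may vanish in between.\<close>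

lemma rho_lower_bound:
  assumes g: "M1_bc rl rr g" and "0 < rl" "0 < rr" "0 < t0"
  shows "\<exists>\<delta>>0. \<forall>t\<ge>t0. \<forall>x. \<delta> \<le> rho g t x"
proof -
  from g obtain xl xr where M: "M1 g" and xl: "\<And>x. x \<le> xl \<Longrightarrow> g x = rl" and xr: "\<And>x. xr \<le> x \<Longrightarrow> g x = rr"
    unfolding M1_bc_def by blast
  define k where "k = max \<bar>xl\<bar> \<bar>xr\<bar> / sqrt t0"
  have k: "\<bar>xl\<bar> \<le> k * sqrt t" "\<bar>xr\<bar> \<le> k * sqrt t" if "t0 \<le> t" for t
  proof -
    have "0 \<le> k"
      using \<open>0 < t0\<close> by (simp add: k_def)
    then have "k * sqrt t0 \<le> k * sqrt t"
      using that by (intro mult_left_mono) auto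
    moreover have "k * sqrt t0 = max \<bar>xl\<bar> \<bar>xr\<bar>"
      using \<open>0 < t0\<close> by (simp add: k_def)
    ultimately show "\<bar>xl\<bar> \<le> k * sqrt t" "\<bar>xr\<bar> \<le> k * sqrt t"
      by linarith+
  qed
  have *: "c * Phi (- k) \<le> rho g t x"
    if A: "A \<in> sets borel" "(LBINT z:A. std_normal_density z) = Phi (- k)"
      and ge: "\<And>z. z \<in> A \<Longrightarrow> g (x + sqrt t * z) = c" for A c t x
  proof -
    have "(LBINT z. c * (indicator A z *\<^sub>R std_normal_density z)) \<le> rho g t x"
      unfolding rho_def
    proof (rule integral_mono)
      show "integrable lborel (\<lambda>z. c * (indicator A z *\<^sub>R std_normal_density z))"
        using set_integrable_std_normal[OF A(1)] unfolding set_integrable_def by (rule integrable_mult_right)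
      show "integrable lborel (\<lambda>z. std_normal_density z * g (x + sqrt t * z))"
        by (rule integrable_rho[OF M])
      show "c * (indicator A z *\<^sub>R std_normal_density z) \<le> std_normal_density z * g (x + sqrt t * z)" for z
        using ge[of z] M1_bounds[OF M] by (cases "z \<in> A") (auto simp: mult.commute)
    qed
    then show ?thesis
      using A(2) by (simp add: set_lebesgue_integral_def)
  qed
  have "min rl rr * Phi (- k) \<le> rho g t x" if t: "t0 \<le> t" for t x
  proof (cases "x \<le> 0")
    case True
    have "rl * Phi (- k) \<le> rho g t x"
    proof (rule *[of "{..- k}"])
      fix z assume "z \<in> {..- k}"
      then have "sqrt t * z \<le> sqrt t * (- k)"
        using t \<open>0 < t0\<close> by (intro mult_left_mono) auto
      then show "g (x + sqrt t * z) = rl"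
        using True k(1)[OF t] by (intro xl) (simp add: mult.commute)
    qed (auto simp: Phi_def)
    then show ?thesis
      using Phi_nonneg[of "- k"] by (meson min.cobounded1 mult_right_mono order_trans)
  next
    case False
    have "rr * Phi (- k) \<le> rho g t x"
    proof (rule *[of "{k..}"])
      fix z assume "z \<in> {k..}"
      then have "sqrt t * k \<le> sqrt t * z"
        using t \<open>0 < t0\<close> by (intro mult_left_mono) auto
      then show "g (x + sqrt t * z) = rr"
        using False k(2)[OF t] by (intro xr) (simp add: mult.commute)
    qed (auto simp: Phi_reflect)
    then show ?thesis
      using Phi_nonneg[of "- k"] by (meson min.cobounded2 mult_right_mono order_trans)
  qed
  moreover have "0 < min rl rr * Phi (- k)"
    using assms Phi_pos by simp
  ultimately show ?thesis
    by blast
qed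

text \<open>Particle-hole symmetry: the upper bound is the lower bound for \<open>1 - g\<close>,
  whose plateaus are again strictly positive.\<close>

lemma rho_two_sided_bound:
  assumes g: "M1_bc rl rr g" and "0 < rl" "rl < 1" "0 < rr" "rr < 1" "0 < t0"
  shows "\<exists>\<delta>>0. \<forall>t\<ge>t0. \<forall>x. \<delta> \<le> rho g t x \<and> rho g t x \<le> 1 - \<delta>"
proof -
  obtain d1 where d1: "d1 > 0" "\<And>t x. t0 \<le> t \<Longrightarrow> d1 \<le> rho g t x"
    using rho_lower_bound[OF g] assms by metis
  obtain d2 where d2: "d2 > 0" "\<And>t x. t0 \<le> t \<Longrightarrow> d2 \<le> rho (\<lambda>x. 1 - g x) t x"
    using rho_lower_bound[OF M1_bc_compl[OF g], of t0] assms by (metis diff_gt_0_iff_gt)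
  have "rho (\<lambda>x. 1 - g x) t x = 1 - rho g t x" for t x
    using g rho_compl unfolding M1_bc_def by blast
  then show ?thesis
    using d1 d2 by (intro exI[of _ "min d1 d2"]) (auto simp: min_le_iff_disj, smt (verit))
qed

text \<open>A path from x deviates from the plateau only if it ends left of \<open>xr\<close>, which
  has probability \<open>Phi ((xr - x) / sqrt t)\<close>. The bound is integrable in x, so
  \<open>vT\<close> is an honest integral.\<close>

lemma rho_right_tail:
  assumes g: "M1 g" and xr: "\<And>x. xr \<le> x \<Longrightarrow> g x = rr" and x: "xr \<le> x" and t: "0 < t"
  shows "\<bar>rho g t x - rr\<bar> \<le> 2 * (1 / (1 + ((x - xr) / sqrt t)\<^sup>2))"
proof -
  let ?a = "(xr - x) / sqrt t"
  have rr: "0 \<le> rr" "rr \<le> 1"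
    using M1_bounds[OF g, of xr] xr[of xr] by auto
  have "rho g t x - rr = (LBINT z. std_normal_density z * (g (x + sqrt t * z) - rr))"
    unfolding rho_def right_diff_distrib using integrable_rho[OF g]
    by (subst Bochner_Integration.integral_diff) auto
  also have "\<bar>\<dots>\<bar> \<le> (LBINT z. indicator {..?a} z *\<^sub>R std_normal_density z)"
  proof (rule abs_integral_le)
    show "integrable lborel (\<lambda>z. indicator {..?a} z *\<^sub>R std_normal_density z)"
      using set_integrable_std_normal[of "{..?a}"] by (simp add: set_integrable_def)
    fix z
    show "\<bar>std_normal_density z * (g (x + sqrt t * z) - rr)\<bar> \<le> indicator {..?a} z *\<^sub>R std_normal_density z"
    proof (cases "z \<le> ?a")
      case True
      have "\<bar>g (x + sqrt t * z) - rr\<bar> \<le> 1"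
        using rr M1_bounds[OF g, of "x + sqrt t * z"] by auto
      then show ?thesis
        using True by (simp add: abs_mult mult_left_le)
    next
      case False
      then have "xr - x \<le> sqrt t * z"
        using t by (simp add: divide_less_eq not_le mult.commute)
      then show ?thesis
        using xr[of "x + sqrt t * z"] by simp
    qed
  qed
  also have "\<dots> = Phi ?a"
    by (simp add: Phi_def set_lebesgue_integral_def)
  also have "\<dots> \<le> 2 / (1 + ?a\<^sup>2)"
    using x t by (intro Phi_le_tail) (simp add: divide_le_0_iff)
  also have "?a\<^sup>2 = ((x - xr) / sqrt t)\<^sup>2"
    by (simp add: power_divide power2_commute)
  finally show ?thesis
    by simp
qed

lemma set_integrable_rho_diff:
  assumes g: "M1_bc rl rr g" and t: "0 < t"
  shows "set_integrable lborel {s..} (\<lambda>x. rho g t x - g x)"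
proof -
  from g obtain xr where M: "M1 g" and xr: "\<And>x. xr \<le> x \<Longrightarrow> g x = rr"
    unfolding M1_bc_def by blast
  have [measurable]: "g \<in> borel_measurable borel" "rho g t \<in> borel_measurable borel"
    using M1_measurable[OF M] M1_measurable[OF M1_rho[OF M]] by auto
  show ?thesis
    unfolding set_integrable_def
  proof (rule Bochner_Integration.integrable_bound)
    show "integrable lborel (\<lambda>x. indicator {s..xr} x + 2 * (1 / (1 + ((x - xr) / sqrt t)\<^sup>2)))"
      using t by (intro Bochner_Integration.integrable_add integrable_mult_right integrable_inverse_square_affine) auto
    have "\<bar>indicat_real {s..} x * (rho g t x - g x)\<bar> \<le> indicator {s..xr} x + 2 * (1 / (1 + ((x - xr) / sqrt t)\<^sup>2))" for x
    proof (cases "xr \<le> x")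
      case True
      have "\<bar>indicat_real {s..} x * (rho g t x - g x)\<bar> \<le> \<bar>rho g t x - g x\<bar>"
        by (simp add: indicator_def)
      then show ?thesis
        using rho_right_tail[OF M xr True t] xr[OF True] by (simp add: add_increasing)
    next
      case False
      have "\<bar>rho g t x - g x\<bar> \<le> 1"
        using M1_bounds[OF M, of x] M1_bounds[OF M1_rho[OF M], of t x] by auto
      then have "\<bar>indicat_real {s..} x * (rho g t x - g x)\<bar> \<le> indicator {s..xr} x"
        using False by (auto simp: indicator_def)
      moreover have "0 \<le> 2 * (1 / (1 + ((x - xr) / sqrt t)\<^sup>2))"
        by simp
      ultimately show ?thesis
        by linarith
    qed
    then show "AE x in lborel. norm (indicat_real {s..} x *\<^sub>R (rho g t x - g x)) \<le>
        norm (indicator {s..xr} x + 2 * (1 / (1 + ((x - xr) / sqrt t)\<^sup>2)))"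
      by (intro AE_I2) (metis abs_ge_self order_trans real_norm_def real_scaleR_def)
  qed simp
qed

lemma has_current_vT:
  assumes "M1_bc rl rr g" "0 < T"
  shows "has_current (\<lambda>x. rho g T x - g x) 0 (vT T g)"
  using has_current_integrable[OF set_integrable_rho_diff[OF assms, of 0]] assms(2)
  by (simp add: vT_def gconv_eq_rho)

text \<open>The integral of \<open>rho g T\<close> from 0 to a has slope between \<delta> and 1 in
  a, so it is a bi-Lipschitz bijection of the line. This justifies the definite description in
  \<open>uT\<close> and makes the excess comparable to the distance from \<open>uT\<close>.\<close>

lemma uT_estimate:
  assumes g: "M1_bc rl rr g" and T: "0 < T" and \<delta>: "0 < \<delta>" "\<And>x. \<delta> \<le> rho g T x"
  shows "\<delta> * \<bar>a - uT T g\<bar> \<le> \<bar>(LBINT x=ereal 0..ereal a. rho g T x) - vT T g\<bar>"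
    and "\<bar>(LBINT x=ereal 0..ereal a. rho g T x) - vT T g\<bar> \<le> \<bar>a - uT T g\<bar>"
proof -
  have M: "M1 g"
    using g by (simp add: M1_bc_def)
  define U where "U a = (LBINT x=ereal 0..ereal a. rho g T x)" for a
  have bm: "bounded_measurable (rho g T)"
    by (intro bounded_measurable_M1 M1_rho M)
  have incr: "\<delta> * (w - u) \<le> U w - U u \<and> U w - U u \<le> w - u" if "u \<le> w" for u w
  proof -
    have "U w - U u = (LBINT x=ereal u..ereal w. rho g T x)"
      unfolding U_def using interval_integral_split[OF bm, of 0 u w] by simp
    also have "\<dots> = (LBINT x:{u..w}. rho g T x)"
      using that by (rule interval_integral_Icc)
    finally have eq: "U w - U u = (LBINT x:{u..w}. rho g T x)" .
    have i: "set_integrable lborel {u..w} (rho g T)"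
      unfolding set_integrable_def
    proof (rule Bochner_Integration.integrable_bound)
      show "integrable lborel (indicat_real {u..w})"
        by simp
      show "AE x in lborel. norm (indicat_real {u..w} x *\<^sub>R rho g T x) \<le> norm (indicat_real {u..w} x)"
        using M1_bounds[OF M1_rho[OF M]] by (intro AE_I2) (auto simp: indicator_def)
    qed (use M1_measurable[OF M1_rho[OF M]] in simp)
    have "(LBINT x:{u..w}. \<delta>) \<le> U w - U u"
      unfolding eq using \<delta> by (intro set_integral_mono i) auto
    moreover have "U w - U u \<le> (LBINT x:{u..w}. 1)"
      unfolding eq using M1_bounds[OF M1_rho[OF M]] by (intro set_integral_mono i) auto
    ultimately show ?thesis
      using that by (simp add: set_lebesgue_integral_def mult.commute)
  qed
  have lip: "\<delta> * \<bar>w - u\<bar> \<le> \<bar>U w - U u\<bar> \<and> \<bar>U w - U u\<bar> \<le> \<bar>w - u\<bar>" for u w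
  proof (cases "u \<le> w")
    case True
    moreover have "0 \<le> \<delta> * (w - u)"
      using True \<delta>(1) by simp
    ultimately show ?thesis
      using incr[OF True] by (simp add: abs_of_nonneg)
  next
    case False
    then have "w \<le> u" "0 \<le> \<delta> * (u - w)"
      using \<delta>(1) by simp_all
    then show ?thesis
      using incr[of w u] by (simp add: abs_of_nonneg abs_minus_commute[of w u] abs_minus_commute[of "U w" "U u"])
  qed
  have cont: "continuous_on UNIV U"
    unfolding continuous_on_iff dist_real_def using lip by (meson order_le_less_trans)
  have U0: "U 0 = 0"
    by (simp add: U_def)
  \<comment> \<open>Since the slope is at least \<delta> and \<open>U 0 = 0\<close>, the root must
    lie in [-B, B]; this is the bracket for the intermediate value theorem.\<close>
  let ?B = "\<bar>vT T g\<bar> / \<delta>"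
  have B: "0 \<le> ?B" "\<delta> * ?B = \<bar>vT T g\<bar>"
    using \<delta> by auto
  have "\<bar>vT T g\<bar> \<le> - U (- ?B)" "\<bar>vT T g\<bar> \<le> U ?B"
    using incr[of "- ?B" 0] incr[of 0 ?B] B U0 by auto
  then have "U (- ?B) \<le> vT T g" "vT T g \<le> U ?B"
    by linarith+
  then obtain u where u: "U u = vT T g"
    using IVT'[of U "- ?B" "vT T g" ?B] B cont continuous_on_subset by (metis neg_le_0_iff_le order_trans subset_UNIV)
  have "uT T g = u"
    unfolding uT_def
  proof (rule the_equality)
    have eq: "gconv T g = rho g T"
      using gconv_eq_rho[OF T] by auto
    show "(LBINT x=ereal 0..ereal u. gconv T g x) = vT T g"
      using u by (simp add: eq U_def)
    fix w assume "(LBINT x=ereal 0..ereal w. gconv T g x) = vT T g"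
    then have "U w = U u"
      using u by (simp add: eq U_def)
    then show "w = u"
      using lip[of w u] \<delta>(1) by (simp add: mult_le_0_iff)
  qed
  then show "\<delta> * \<bar>a - uT T g\<bar> \<le> \<bar>(LBINT x=ereal 0..ereal a. rho g T x) - vT T g\<bar>"
    "\<bar>(LBINT x=ereal 0..ereal a. rho g T x) - vT T g\<bar> \<le> \<bar>a - uT T g\<bar>"
    using lip[of a u] u by (auto simp: U_def)
qed

section \<open>Upper bounds\<close>

lemma integral_derivative_compact_support:
  fixes f f' :: "real \<Rightarrow> real"
  assumes "\<And>x. (f has_real_derivative f' x) (at x)" "continuous_on UNIV f'"
    and "\<And>x. L < \<bar>x\<bar> \<Longrightarrow> f x = 0 \<and> f' x = 0" "0 \<le> L"
  shows "(LBINT x. f' x) = 0"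
proof -
  have "isCont f' x" for x
    using assms(2) by (simp add: continuous_on_eq_continuous_at)
  \<comment> \<open>The endpoints are L + 1 because vanishing is assumed only for |x| > L.\<close>
  then have "(LBINT x. f' x * indicator {-(L+1)..L+1} x) = f (L+1) - f (-(L+1))"
    using assms(4) by (intro integral_FTC_Icc_real assms(1)) auto
  moreover have "(\<lambda>x. f' x * indicator {-(L+1)..L+1} x) = f'"
  proof
    fix x
    show "f' x * indicator {-(L+1)..L+1} x = f' x"
      using assms(3)[of x] by (cases "L < \<bar>x\<bar>") (auto simp: indicator_def)
  qed
  moreover have "f (L+1) = 0" "f (-(L+1)) = 0"
    using assms(3,4) by auto
  ultimately show ?thesis
    by (simp only:)
qed

lemma integrable_strip_product:
  fixes F u :: "real \<Rightarrow> real \<Rightarrow> real"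
  assumes F: "continuous_on UNIV (\<lambda>(t, x). F t x)" "\<And>t x. L < \<bar>x\<bar> \<Longrightarrow> F t x = 0" and "0 \<le> L"
    and u: "case_prod u \<in> borel_measurable (borel \<Otimes>\<^sub>M borel)" "\<And>t x. t \<in> {0..T} \<Longrightarrow> \<bar>u t x\<bar> \<le> K"
  shows "t \<in> {0..T} \<Longrightarrow> integrable lborel (\<lambda>x. u t x * F t x)"
    and "set_integrable lborel {0..T} (\<lambda>t. LBINT x. u t x * F t x)"
proof -
  obtain B where B: "\<And>t x. t \<in> {0..T} \<Longrightarrow> \<bar>F t x\<bar> \<le> B"
    using continuous_strip_bounded[OF F(1), of L 0 T] F(2) by metis
  have le1: "\<bar>u t x * F t x\<bar> \<le> K * B" if "t \<in> {0..T}" for t x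
    unfolding abs_mult using u(2)[OF that, of x] B[OF that, of x] by (intro mult_mono) auto
  have le: "\<bar>u t x * F t x\<bar> \<le> K * B * indicator {-L..L} x" if "t \<in> {0..T}" for t x
  proof (cases "L < \<bar>x\<bar>")
    case False
    note le1[OF that, of x]
    moreover have "x \<in> {-L..L}"
      using False by auto
    ultimately show ?thesis
      by (simp add: abs_mult)
  qed (auto simp: F(2) indicator_def)
  note meas [measurable (raw)] = continuous_on_case_prod_measurable[OF F(1), THEN measurable_case_prod_compose]
    u(1)[THEN measurable_case_prod_compose]
  show *: "integrable lborel (\<lambda>x. u t x * F t x)" if "t \<in> {0..T}" for t
    by (rule integrable_bounded_compact_support[where K="K * B" and L=L]) (use le1[OF that] F(2) in auto)
  show "set_integrable lborel {0..T} (\<lambda>t. LBINT x. u t x * F t x)"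
    unfolding set_integrable_def
  proof (rule Bochner_Integration.integrable_bound)
    show "integrable lborel (\<lambda>t. K * B * (2 * L) * indicator {0..T} t)"
      by simp
    have "\<bar>LBINT x. u t x * F t x\<bar> \<le> K * B * (2 * L)" if "t \<in> {0..T}" for t
    proof -
      have "\<bar>LBINT x. u t x * F t x\<bar> \<le> (LBINT x. K * B * indicator {-L..L} x)"
        using le[OF that] by (intro abs_integral_le) auto
      then show ?thesis
        using \<open>0 \<le> L\<close> by simp
    qed
    then show "AE t in lborel. norm (indicat_real {0..T} t *\<^sub>R (LBINT x. u t x * F t x)) \<le>
        norm (K * B * (2 * L) * indicator {0..T} t)"
      using order_trans[OF _ abs_ge_self] by (intro AE_I2) (auto simp: indicator_def)
    have "(\<lambda>t. LBINT x. u t x * F t x) \<in> borel_measurable borel"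
      by (rule lborel.borel_measurable_lebesgue_integral, simp only: split_beta', measurable)
    then show "(\<lambda>t. indicat_real {0..T} t *\<^sub>R (LBINT x. u t x * F t x)) \<in> borel_measurable lborel"
      by simp
  qed
qed

lemma C12K_combined:
  assumes "C12K G Gt Gx Gxx"
  shows "continuous_on UNIV (\<lambda>(t, x). Gt t x + Gxx t x / 2)" "continuous_on UNIV (\<lambda>(t, x). (Gx t x)\<^sup>2)"
  using assms unfolding C12K_def split_beta' by (auto intro!: continuous_intros)

text \<open>A path whose weak form is \<open>\<integral>\<integral> w \<partial>\<^sub>x G\<close> is driven by the field \<open>w / (\<mu> (1 - \<mu>))\<close>;
  its energy is estimated pointwise by \<open>w p \<le> w\<^sup>2 / (2 \<kappa>) + \<kappa> p\<^sup>2 / 2\<close>.\<close>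

lemma I0_le_driven:
  fixes mu w :: "real \<Rightarrow> real \<Rightarrow> real"
  assumes T: "0 \<le> T"
    and mu: "case_prod mu \<in> borel_measurable (borel \<Otimes>\<^sub>M borel)" "\<And>t x. 0 \<le> mu t x \<and> mu t x \<le> 1"
    and w: "case_prod w \<in> borel_measurable (borel \<Otimes>\<^sub>M borel)"
      "\<And>t x. t \<in> {0..T} \<Longrightarrow> \<bar>w t x\<bar> \<le> W * indicator {s - R..s + R} x"
    and \<kappa>: "0 < \<kappa>" "\<And>t x. t \<in> {0..T} \<Longrightarrow> w t x \<noteq> 0 \<Longrightarrow> \<kappa> \<le> mu t x * (1 - mu t x)"
    and "0 \<le> R"
    and weak: "\<And>G Gt Gx Gxx. C12K G Gt Gx Gxx \<Longrightarrow>
      lfun T mu G Gt Gxx = (LBINT t:{0..T}. (LBINT x. w t x * Gx t x))"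
  shows "I0 T mu \<le> ereal (T * R * W\<^sup>2 / \<kappa>)"
  unfolding I0_def
proof (rule Sup_least, clarify)
  fix G Gt Gx Gxx assume C: "C12K G Gt Gx Gxx"
  obtain L where L: "0 \<le> L" "\<And>t x. L < \<bar>x\<bar> \<Longrightarrow> Gx t x = 0"
    using C12K_support[OF C] by metis
  have cGx: "continuous_on UNIV (\<lambda>(t, x). Gx t x)"
    using C by (simp add: C12K_def)
  have wW: "\<bar>w t x\<bar> \<le> \<bar>W\<bar>" if "t \<in> {0..T}" for t x
    using w(2)[OF that, of x] abs_ge_self[of W] by (cases "x \<in> {s - R..s + R}") simp_all
  have m1: "\<bar>mu t x * (1 - mu t x)\<bar> \<le> 1" for t x
    using mu(2)[of t x] by (simp add: abs_mult mult_le_one)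
  have m2: "(\<lambda>(t, x). mu t x * (1 - mu t x)) \<in> borel_measurable (borel \<Otimes>\<^sub>M borel)"
    using mu(1) by (simp add: split_beta')
  have i1: "integrable lborel (\<lambda>x. w t x * Gx t x)"
      "set_integrable lborel {0..T} (\<lambda>t. LBINT x. w t x * Gx t x)" if "t \<in> {0..T}" for t
    using integrable_strip_product[of Gx L w T "\<bar>W\<bar>"] cGx L w(1) wW that by blast+
  have i2: "integrable lborel (\<lambda>x. mu t x * (1 - mu t x) * (Gx t x)\<^sup>2)"
      "set_integrable lborel {0..T} (\<lambda>t. LBINT x. mu t x * (1 - mu t x) * (Gx t x)\<^sup>2)" if "t \<in> {0..T}" for t
    using integrable_strip_product[of "\<lambda>t x. (Gx t x)\<^sup>2" L "\<lambda>t x. mu t x * (1 - mu t x)" T 1]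
      C12K_combined(2)[OF C] L m1 m2 that by auto
  have T0: "0 \<in> {0..T}"
    using T by simp
  have "lfun T mu G Gt Gxx - qfun T mu Gx =
      (LBINT t:{0..T}. (LBINT x. w t x * Gx t x) - (LBINT x. mu t x * (1 - mu t x) * (Gx t x)\<^sup>2) / 2)"
    unfolding weak[OF C] qfun_def using i1(2)[OF T0] i2(2)[OF T0] by (subst set_integral_diff(2)) auto
  also have "\<dots> \<le> (LBINT t:{0..T}. R * W\<^sup>2 / \<kappa>)"
  proof (rule set_integral_mono)
    show "set_integrable lborel {0..T} (\<lambda>t. (LBINT x. w t x * Gx t x) - (LBINT x. mu t x * (1 - mu t x) * (Gx t x)\<^sup>2) / 2)"
      using i1(2)[OF T0] i2(2)[OF T0] by (intro set_integral_diff(1)) auto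
    fix t assume t: "t \<in> {0..T}"
    have "(LBINT x. w t x * Gx t x) - (LBINT x. mu t x * (1 - mu t x) * (Gx t x)\<^sup>2) / 2 =
        (LBINT x. w t x * Gx t x - mu t x * (1 - mu t x) * (Gx t x)\<^sup>2 / 2)"
      using i1(1)[OF t] i2(1)[OF t] by (subst Bochner_Integration.integral_diff) auto
    also have "\<dots> \<le> (LBINT x. W\<^sup>2 / (2 * \<kappa>) * indicator {s - R..s + R} x)"
    proof (rule integral_mono)
      show "integrable lborel (\<lambda>x. w t x * Gx t x - mu t x * (1 - mu t x) * (Gx t x)\<^sup>2 / 2)"
        using i1(1)[OF t] i2(1)[OF t] by auto
      fix x
      show "w t x * Gx t x - mu t x * (1 - mu t x) * (Gx t x)\<^sup>2 / 2 \<le> W\<^sup>2 / (2 * \<kappa>) * indicator {s - R..s + R} x"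
      proof (cases "w t x = 0")
        case True
        have "0 \<le> mu t x * (1 - mu t x) * (Gx t x)\<^sup>2 / 2"
          using mu(2)[of t x] by simp
        moreover have "0 \<le> W\<^sup>2 / (2 * \<kappa>) * indicator {s - R..s + R} x"
          using \<kappa>(1) by simp
        ultimately show ?thesis
          using True by simp
      next
        case False
        then have "x \<in> {s - R..s + R} \<and> \<bar>w t x\<bar> \<le> W"
          using w(2)[OF t, of x] by (cases "x \<in> {s - R..s + R}") simp_all
        then have x: "x \<in> {s - R..s + R}" and "\<bar>w t x\<bar> \<le> W"
          by auto
        then have "(w t x)\<^sup>2 \<le> W\<^sup>2"
          by (metis abs_ge_zero power2_abs power_mono)
        then have "(w t x)\<^sup>2 / (2 * \<kappa>) \<le> W\<^sup>2 / (2 * \<kappa>)"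
          using \<kappa>(1) by (intro divide_right_mono) auto
        moreover have "0 \<le> (w t x - \<kappa> * Gx t x)\<^sup>2 / (2 * \<kappa>)"
          using \<kappa>(1) by simp
        moreover have "(w t x - \<kappa> * Gx t x)\<^sup>2 / (2 * \<kappa>) = (w t x)\<^sup>2 / (2 * \<kappa>) - w t x * Gx t x + \<kappa> * (Gx t x)\<^sup>2 / 2"
          using \<kappa>(1) by (simp add: field_simps power2_eq_square)
        moreover have "\<kappa> * (Gx t x)\<^sup>2 \<le> mu t x * (1 - mu t x) * (Gx t x)\<^sup>2"
          using \<kappa>(2)[OF t False] by (intro mult_right_mono) auto
        ultimately show ?thesis
          using x by simp
      qed
    qed simp
    also have "\<dots> = R * W\<^sup>2 / \<kappa>"
      using \<open>0 \<le> R\<close> by simp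
    finally show "(LBINT x. w t x * Gx t x) - (LBINT x. mu t x * (1 - mu t x) * (Gx t x)\<^sup>2) / 2 \<le> R * W\<^sup>2 / \<kappa>" .
  qed simp
  also have "\<dots> = T * R * W\<^sup>2 / \<kappa>"
    using T by (simp add: set_lebesgue_integral_def)
  finally show "ereal (lfun T mu G Gt Gxx - qfun T mu Gx) \<le> ereal (T * R * W\<^sup>2 / \<kappa>)"
    by simp
qed

section \<open>Perturbations of the heat flow in conservative form\<close>

text \<open>As \<open>P\<close> is the derivative of \<open>Q\<close>, applying the forward heat
  operator to \<open>\<theta> t * P x\<close> gives minus the space derivative of
  \<open>\<theta> t * P' x / 2 - \<theta>' t * Q x\<close>. Hence only \<open>Gx\<close> survives,
  and that flux is the driving term required by the energy bound.\<close>

lemma perturbation_weak_form: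
  fixes P P' Q \<theta> \<theta>' :: "real \<Rightarrow> real"
  assumes C: "C12K G Gt Gx Gxx" and T: "0 \<le> T"
    and dQ: "\<And>x. (Q has_real_derivative P x) (at x)" and dP: "\<And>x. (P has_real_derivative P' x) (at x)"
    and cP': "continuous_on UNIV P'"
    and d\<theta>: "\<And>t. (\<theta> has_real_derivative \<theta>' t) (at t)" and c\<theta>': "continuous_on UNIV \<theta>'"
    and \<theta>: "\<theta> 0 = 0" "\<theta> T = 1"
  shows "(LBINT x. G T x * P x)
      - (LBINT t:{0..T}. (LBINT x. \<theta> t * P x * (Gt t x + Gxx t x / 2)))
    = (LBINT t:{0..T}. (LBINT x. (\<theta> t * P' x / 2 - \<theta>' t * Q x) * Gx t x))"
proof -
  note C' = C[unfolded C12K_def]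
  obtain L where L: "0 \<le> L" "\<And>t x. L < \<bar>x\<bar> \<Longrightarrow> G t x = 0 \<and> Gt t x = 0 \<and> Gx t x = 0 \<and> Gxx t x = 0"
    using C12K_support[OF C] by metis
  have cP: "continuous_on UNIV P" and cQ: "continuous_on UNIV Q" and c\<theta>: "continuous_on UNIV \<theta>"
    using dP dQ d\<theta> by (meson DERIV_isCont continuous_at_imp_continuous_on)+
  have cont: "continuous_on UNIV (\<lambda>(t, x). a t * b x * F t x)"
    if "continuous_on UNIV a" "continuous_on UNIV b" "continuous_on UNIV (\<lambda>(t, x). F t x)"
    for a b :: "real \<Rightarrow> real" and F :: "real \<Rightarrow> real \<Rightarrow> real"
    using that(3) unfolding split_beta'
    by (intro continuous_intros continuous_on_compose2[OF that(1)] continuous_on_compose2[OF that(2)]) auto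
  have int: "set_integrable lborel {0..T} (\<lambda>t. LBINT x. a t * b x * F t x)"
      "\<And>t. t \<in> {0..T} \<Longrightarrow> integrable lborel (\<lambda>x. a t * b x * F t x)"
    if "continuous_on UNIV a" "continuous_on UNIV b" "continuous_on UNIV (\<lambda>(t, x). F t x)" "\<And>t x. L < \<bar>x\<bar> \<Longrightarrow> F t x = 0"
    for a b :: "real \<Rightarrow> real" and F :: "real \<Rightarrow> real \<Rightarrow> real"
    using integrable_strip_product[of "\<lambda>t x. a t * b x * F t x" L "\<lambda>t x. 1" T 1] cont[OF that(1-3)] that(4) L(1) by auto
  note cG = C'[THEN conjunct2, THEN conjunct2, THEN conjunct2]
  \<comment> \<open>The terminal pairing is the time integral of the derivative of
    \<open>\<theta> t * P x * G t x\<close>; \<open>\<theta> 0 = 0\<close> removes the initial term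
    and \<open>\<theta> T = 1\<close> normalises the terminal one.\<close>
  have ibp_t: "(LBINT x. G T x * P x) =
      (LBINT t:{0..T}. (LBINT x. \<theta>' t * P x * G t x + \<theta> t * P x * Gt t x))"
  proof -
    let ?f = "\<lambda>t x. \<theta>' t * P x * G t x + \<theta> t * P x * Gt t x"
    have cf: "continuous_on UNIV (\<lambda>(t, x). ?f t x)"
      using continuous_on_add[OF cont[OF c\<theta>' cP, of G] cont[OF c\<theta> cP, of Gt]] cG by (simp add: split_beta')
    have "?f t x = 0" if "L < \<bar>x\<bar>" for t x
      using L(2)[OF that] by simp
    then obtain B where B: "\<And>t x. t \<in> {0..T} \<Longrightarrow> \<bar>?f t x\<bar> \<le> B"
      using continuous_strip_bounded[OF cf, of L 0 T] by blast
    have "(LBINT x. G T x * P x) = (LBINT x. (LBINT t. ?f t x * indicator {0..T} t))"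
    proof (rule Bochner_Integration.integral_cong[OF refl])
      fix x
      have "(LBINT t. ?f t x * indicator {0..T} t) = \<theta> T * P x * G T x - \<theta> 0 * P x * G 0 x"
      proof (rule integral_FTC_Icc_real[OF T])
        fix t
        show "((\<lambda>t. \<theta> t * P x * G t x) has_real_derivative ?f t x) (at t)"
          using C' by (auto intro!: derivative_eq_intros d\<theta>)
        show "isCont (\<lambda>t. ?f t x) t"
          using continuous_on_compose_pair[OF cf, of UNIV "\<lambda>t. t" "\<lambda>t. x"] by (simp add: continuous_on_eq_continuous_at)
      qed
      then show "G T x * P x = (LBINT t. ?f t x * indicator {0..T} t)"
        by (simp add: \<theta>)
    qed
    also have "\<dots> = (LBINT t. (LBINT x. ?f t x * indicator {0..T} t))"
    proof (rule Fubini_product_bound[where h="\<lambda>t. indicator {0..T} t" and k="\<lambda>x. B * indicator {-L..L} x"])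
      have [measurable]: "case_prod ?f \<in> borel_measurable (borel \<Otimes>\<^sub>M borel)"
        by (rule continuous_on_case_prod_measurable[OF cf])
      have "(\<lambda>p. case_prod ?f p * indicator {0..T} (fst p)) \<in> borel_measurable (borel \<Otimes>\<^sub>M borel)"
        by measurable
      then show "(\<lambda>(t, x). ?f t x * indicator {0..T} t) \<in> borel_measurable (borel \<Otimes>\<^sub>M borel)"
        by (simp add: split_beta')
      show "\<bar>?f t x * indicator {0..T} t\<bar> \<le> indicator {0..T} t * (B * indicator {-L..L} x)" for t x
        using B[of t x] L(2)[of x t] by (auto simp: indicator_def)
    qed auto
    finally show ?thesis
      by (simp add: set_lebesgue_integral_def mult.commute)
  qed
  have t_eq: "(LBINT x. \<theta>' t * P x * G t x + \<theta> t * P x * Gt t x) - (LBINT x. \<theta> t * P x * (Gt t x + Gxx t x / 2)) =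
      (LBINT x. (\<theta> t * P' x / 2 - \<theta>' t * Q x) * Gx t x)" if t: "t \<in> {0..T}" for t
  proof -
    have c: "continuous_on UNIV (G t)" "continuous_on UNIV (Gx t)" "continuous_on UNIV (Gxx t)"
      using cG by (auto intro: continuous_on_section)
    have z1: "(LBINT x. P x * G t x + Q x * Gx t x) = 0"
    proof (rule integral_derivative_compact_support[OF _ _ _ L(1)])
      show "((\<lambda>x. Q x * G t x) has_real_derivative P x * G t x + Q x * Gx t x) (at x)" for x
        using C' by (auto intro!: derivative_eq_intros dQ)
    qed (use L c cP cQ in \<open>auto intro!: continuous_intros\<close>)
    have z2: "(LBINT x. P' x * Gx t x + P x * Gxx t x) = 0"
    proof (rule integral_derivative_compact_support[OF _ _ _ L(1)])
      show "((\<lambda>x. P x * Gx t x) has_real_derivative P' x * Gx t x + P x * Gxx t x) (at x)" for x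
        using C' by (auto intro!: derivative_eq_intros dP)
    qed (use L c cP cP' in \<open>auto intro!: continuous_intros\<close>)
    have intx: "integrable lborel (\<lambda>x. b x * F t x)"
      if "continuous_on UNIV b" "continuous_on UNIV (\<lambda>(t, x). F t x)" "\<And>t x. L < \<bar>x\<bar> \<Longrightarrow> F t x = 0" for b :: "real \<Rightarrow> real" and F
      using int(2)[of "\<lambda>_. 1" b F] that t by auto
    have i: "integrable lborel (\<lambda>x. P x * G t x)" "integrable lborel (\<lambda>x. P x * Gt t x)" "integrable lborel (\<lambda>x. P x * Gxx t x)"
      "integrable lborel (\<lambda>x. P' x * Gx t x)" "integrable lborel (\<lambda>x. Q x * Gx t x)"
      using intx L(2) cP cP' cQ cG by blast+
    have 1: "(LBINT x. P x * G t x) + (LBINT x. Q x * Gx t x) = 0"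
      using z1 i by simp
    have 2: "(LBINT x. P' x * Gx t x) + (LBINT x. P x * Gxx t x) = 0"
      using z2 i by simp
    have "(LBINT x. \<theta>' t * P x * G t x + \<theta> t * P x * Gt t x) =
        \<theta>' t * (LBINT x. P x * G t x) + \<theta> t * (LBINT x. P x * Gt t x)"
      using i by (simp add: mult.assoc)
    moreover have "(LBINT x. \<theta> t * P x * (Gt t x + Gxx t x / 2)) =
        \<theta> t * ((LBINT x. P x * Gt t x) + (LBINT x. P x * Gxx t x) / 2)"
    proof -
      have "(\<lambda>x. \<theta> t * P x * (Gt t x + Gxx t x / 2)) = (\<lambda>x. \<theta> t * (P x * Gt t x + P x * Gxx t x / 2))"
        by (auto simp: algebra_simps)
      then show ?thesis
        using i by simp
    qed
    moreover have "(LBINT x. (\<theta> t * P' x / 2 - \<theta>' t * Q x) * Gx t x) =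
        \<theta> t / 2 * (LBINT x. P' x * Gx t x) - \<theta>' t * (LBINT x. Q x * Gx t x)"
    proof -
      have "(\<lambda>x. (\<theta> t * P' x / 2 - \<theta>' t * Q x) * Gx t x) = (\<lambda>x. \<theta> t / 2 * (P' x * Gx t x) - \<theta>' t * (Q x * Gx t x))"
        by (auto simp: algebra_simps)
      then show ?thesis
        using i by simp
    qed
    moreover have "(LBINT x. P x * Gxx t x) = - (LBINT x. P' x * Gx t x)"
      "(LBINT x. P x * G t x) = - (LBINT x. Q x * Gx t x)"
      using 1 2 by linarith+
    ultimately show ?thesis
      by (simp add: algebra_simps)
  qed
  have cGF: "continuous_on UNIV (\<lambda>(t, x). Gt t x + Gxx t x / 2)"
    by (rule C12K_combined[OF C])
  have s1: "set_integrable lborel {0..T} (\<lambda>t. LBINT x. \<theta>' t * P x * G t x + \<theta> t * P x * Gt t x)"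
  proof -
    have i: "set_integrable lborel {0..T} (\<lambda>t. (LBINT x. \<theta>' t * P x * G t x) + (LBINT x. \<theta> t * P x * Gt t x))"
      using cG L(2) c\<theta> c\<theta>' cP by (intro set_integral_add(1) int(1)) auto
    have eq: "(LBINT x. \<theta>' t * P x * G t x + \<theta> t * P x * Gt t x) =
        (LBINT x. \<theta>' t * P x * G t x) + (LBINT x. \<theta> t * P x * Gt t x)" if "t \<in> {0..T}" for t
      using cG L(2) c\<theta> c\<theta>' cP that by (intro Bochner_Integration.integral_add int(2)) auto
    show ?thesis
      by (rule set_integrable_cong[THEN iffD2, OF refl refl _ i]) (rule eq)
  qed
  have s2: "set_integrable lborel {0..T} (\<lambda>t. LBINT x. \<theta> t * P x * (Gt t x + Gxx t x / 2))"
    using int(1)[OF c\<theta> cP cGF] L(2) by auto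
  show ?thesis
    unfolding ibp_t set_integral_diff(2)[OF s1 s2, symmetric]
    by (rule set_lebesgue_integral_cong) (auto simp: t_eq)
qed


text \<open>\<open>lfun\<close> is additive along the decomposition and the heat flow contributes 0.
  Only times in [0,T] enter, which leaves the path free to be frozen afterwards.\<close>

lemma lfun_perturbed:
  fixes P P' Q \<theta> \<theta>' :: "real \<Rightarrow> real"
  assumes C: "C12K G Gt Gx Gxx" and T: "0 \<le> T" and g: "M1 g"
    and dQ: "\<And>x. (Q has_real_derivative P x) (at x)" and dP: "\<And>x. (P has_real_derivative P' x) (at x)"
    and cP': "continuous_on UNIV P'"
    and d\<theta>: "\<And>t. (\<theta> has_real_derivative \<theta>' t) (at t)" and c\<theta>': "continuous_on UNIV \<theta>'"
    and \<theta>: "\<theta> 0 = 0" "\<theta> T = 1"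
    and mu: "\<And>t x. t \<in> {0..T} \<Longrightarrow> mu t x = rho g t x + \<theta> t * P x"
  shows "lfun T mu G Gt Gxx = (LBINT t:{0..T}. (LBINT x. (\<theta> t * P' x / 2 - \<theta>' t * Q x) * Gx t x))"
proof -
  note C' = C[unfolded C12K_def]
  obtain L where L: "0 \<le> L" "\<And>t x. L < \<bar>x\<bar> \<Longrightarrow> G t x = 0 \<and> Gt t x = 0 \<and> Gx t x = 0 \<and> Gxx t x = 0"
    using C12K_support[OF C] by metis
  let ?F = "\<lambda>t x. Gt t x + Gxx t x / 2"
  have cF: "continuous_on UNIV (\<lambda>(t, x). ?F t x)"
    by (rule C12K_combined[OF C])
  have cP: "continuous_on UNIV P" and c\<theta>: "continuous_on UNIV \<theta>"
    using dP d\<theta> by (meson DERIV_isCont continuous_at_imp_continuous_on)+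
  have rb: "\<bar>rho g t x\<bar> \<le> 1" for t x
    using rho_nonneg[OF g, of t x] rho_le_1[OF g, of t x] by simp
  have r: "integrable lborel (\<lambda>x. rho g t x * F t x)" "set_integrable lborel {0..T} (\<lambda>t. LBINT x. rho g t x * F t x)"
    if "continuous_on UNIV (\<lambda>(t, x). F t x)" "\<And>t x. L < \<bar>x\<bar> \<Longrightarrow> F t x = 0" "t \<in> {0..T}" for F t
    using integrable_strip_product[of F L "rho g" T 1] that L(1) rho_measurable[OF g] rb by blast+
  have p: "integrable lborel (\<lambda>x. \<theta> t * P x * F t x)" "set_integrable lborel {0..T} (\<lambda>t. LBINT x. \<theta> t * P x * F t x)"
    if "continuous_on UNIV (\<lambda>(t, x). F t x)" "\<And>t x. L < \<bar>x\<bar> \<Longrightarrow> F t x = 0" "t \<in> {0..T}" for F t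
  proof -
    have "continuous_on UNIV (\<lambda>(t, x). \<theta> t * P x * F t x)"
      using that(1) unfolding split_beta'
      by (intro continuous_intros continuous_on_compose2[OF c\<theta>] continuous_on_compose2[OF cP]) auto
    then show "integrable lborel (\<lambda>x. \<theta> t * P x * F t x)" "set_integrable lborel {0..T} (\<lambda>t. LBINT x. \<theta> t * P x * F t x)"
      using integrable_strip_product[of "\<lambda>t x. \<theta> t * P x * F t x" L "\<lambda>t x. 1" T 1] that L(1) by auto
  qed
  have T': "T \<in> {0..T}" "0 \<in> {0..T}"
    using T by auto
  have "(LBINT x. G T x * mu T x) = (LBINT x. rho g T x * G T x + \<theta> T * P x * G T x)"
    by (simp add: mu[OF T'(1)] algebra_simps)
  also have "\<dots> = (LBINT x. G T x * rho g T x) + (LBINT x. G T x * P x)"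
    using r(1)[of G T] p(1)[of G T] C' L(2) T' by (subst Bochner_Integration.integral_add) (auto simp: \<theta> mult.commute)
  finally have 1: "(LBINT x. G T x * mu T x) = (LBINT x. G T x * rho g T x) + (LBINT x. G T x * P x)" .
  have 2: "(LBINT x. G 0 x * mu 0 x) = (LBINT x. G 0 x * rho g 0 x)"
    by (simp add: mu[OF T'(2)] \<theta>)
  have F0: "?F t x = 0" if "L < \<bar>x\<bar>" for t x
    using L(2)[OF that] by simp
  have "(LBINT t:{0..T}. (LBINT x. mu t x * ?F t x)) =
      (LBINT t:{0..T}. (LBINT x. rho g t x * ?F t x) + (LBINT x. \<theta> t * P x * ?F t x))"
  proof (rule set_lebesgue_integral_cong, simp, clarify)
    fix t assume t: "t \<in> {0..T}"
    show "(LBINT x. mu t x * ?F t x) = (LBINT x. rho g t x * ?F t x) + (LBINT x. \<theta> t * P x * ?F t x)"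
      unfolding mu[OF t] distrib_right[of "rho g t _"]
      by (intro Bochner_Integration.integral_add r(1)[of ?F] p(1)[of ?F] cF F0 t)
  qed
  also have "\<dots> = (LBINT t:{0..T}. (LBINT x. rho g t x * ?F t x)) + (LBINT t:{0..T}. (LBINT x. \<theta> t * P x * ?F t x))"
    by (intro set_integral_add(2) r(2)[of ?F, OF _ _ T'(1)] p(2)[of ?F, OF _ _ T'(1)] cF F0)
  finally have 3: "(LBINT t:{0..T}. (LBINT x. mu t x * ?F t x)) =
      (LBINT t:{0..T}. (LBINT x. rho g t x * ?F t x)) + (LBINT t:{0..T}. (LBINT x. \<theta> t * P x * ?F t x))" .
  show ?thesis
    using lfun_rho_eq_0[OF C g T] perturbation_weak_form[OF C T dQ dP cP' d\<theta> c\<theta>' \<theta>]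
    unfolding lfun_def 1 2 3 by linarith
qed

text \<open>\<open>density\<close> demands values in [0,1] at every real time, while a switch
  \<theta> may exceed 1 after T; \<open>min t T\<close> freezes the path at its terminal
  profile.\<close>

lemma density_perturbed:
  fixes P \<theta> :: "real \<Rightarrow> real"
  assumes g: "M1 g" and cP: "continuous_on UNIV P" and c\<theta>: "continuous_on UNIV \<theta>"
    and bounds: "\<And>t x. 0 \<le> rho g (min t T) x + \<theta> (min t T) * P x \<and> rho g (min t T) x + \<theta> (min t T) * P x \<le> 1"
  shows "density T (\<lambda>t x. rho g (min t T) x + \<theta> (min t T) * P x)"
  unfolding density_def
proof (intro conjI allI impI)
  have [measurable]: "P \<in> borel_measurable borel"
    by (rule borel_measurable_continuous_onI[OF cP])
  have [measurable]: "rho g t \<in> borel_measurable borel" for t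
    by (rule M1_measurable[OF M1_rho[OF g]])
  show "M1 (\<lambda>x. rho g (min t T) x + \<theta> (min t T) * P x)" for t
    using bounds by (simp add: M1_def)
  fix f assume f: "Cc f"
  then obtain L where cf: "continuous_on UNIV f" and L: "\<And>x. L < \<bar>x\<bar> \<Longrightarrow> f x = 0"
    by (auto simp: Cc_def)
  have [measurable]: "f \<in> borel_measurable borel"
    by (rule borel_measurable_continuous_onI[OF cf])
  obtain B where B: "\<And>x. \<bar>f x\<bar> \<le> B"
    using continuous_compact_support_bounded[OF cf, of L] L by auto
  have cfP: "continuous_on UNIV (\<lambda>x. f x * P x)"
    using cf cP by (intro continuous_intros)
  then obtain B' where B': "\<And>x. \<bar>f x * P x\<bar> \<le> B'"
    using continuous_compact_support_bounded[OF cfP, of L] L by auto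
  have i1: "integrable lborel (\<lambda>x. f x * rho g t x)" for t
    by (rule integrable_bounded_compact_support[where K=B and L=L]) (auto simp: L intro: abs_mult_M1_le M1_rho g B)
  have i2: "integrable lborel (\<lambda>x. f x * P x)"
    by (rule integrable_bounded_compact_support[where K=B' and L=L]) (auto simp: L B')
  let ?p = "\<lambda>t. (LBINT x. f x * rho g t x) + \<theta> t * (LBINT x. f x * P x)"
  have eq: "(\<lambda>t. LBINT x. f x * (rho g (min t T) x + \<theta> (min t T) * P x)) = (\<lambda>t. ?p (min t T))"
  proof
    fix t
    have "(LBINT x. f x * (rho g (min t T) x + \<theta> (min t T) * P x)) =
        (LBINT x. f x * rho g (min t T) x + \<theta> (min t T) * (f x * P x))"
      by (simp add: algebra_simps)
    then show "(LBINT x. f x * (rho g (min t T) x + \<theta> (min t T) * P x)) = ?p (min t T)"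
      using i1 i2 by simp
  qed
  have "continuous_on UNIV (\<lambda>t. LBINT x. f x * rho g t x)"
    using rho_vaguely_continuous[OF g f] by (simp add: continuous_at_imp_continuous_on)
  then have "continuous_on UNIV ?p"
    using c\<theta> by (intro continuous_intros)
  then have "continuous_on UNIV (\<lambda>t. ?p (min t T))"
    by (rule continuous_on_compose2) (auto intro!: continuous_intros)
  then have "isCont (\<lambda>t. ?p (min t T)) t" for t
    by (simp add: continuous_on_eq_continuous_at)
  then show "cadlag_on T (\<lambda>t. LBINT x. f x * (rho g (min t T) x + \<theta> (min t T) * P x))"
    unfolding eq cadlag_on_def isCont_def continuous_within
    by (blast intro: tendsto_within_subset)
qed

text \<open>The path follows the heat flow up to time \<open>T / 2\<close>, when it has become bounded away from
  \<open>0\<close> and \<open>1\<close>; then mass \<open>b\<close> is moved across \<open>s\<close> by a perturbation of height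
  \<open>O(\<bar>b\<bar> / R)\<close> and width \<open>R\<close>, with \<open>R\<close> of order \<open>1 + \<bar>b\<bar>\<close>.\<close>

lemma cheap_path_exists:
  assumes g: "M1 g" and T: "0 < T" and \<delta>: "0 < \<delta>" "\<And>t x. T / 2 \<le> t \<Longrightarrow> \<delta> \<le> rho g t x \<and> rho g t x \<le> 1 - \<delta>"
  shows "\<exists>C>0. \<forall>s b. \<exists>mu. density T mu \<and> mu 0 = g \<and> has_current (\<lambda>x. mu T x - rho g T x) s b \<and>
    I0 T mu \<le> ereal (C * b\<^sup>2 * (1 + \<bar>b\<bar>))"
\<comment> \<open>This is \<open>T * R * W\<^sup>2 / (\<delta> / 4)\<close> with
  \<open>W = \<bar>b\<bar> * (15 + 4 / T)\<close> and R at most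
  \<open>(1 + 12 / \<delta>) * (1 + \<bar>b\<bar>)\<close>, where
  \<open>b\<^sup>2 * (1 + \<bar>b\<bar>)\<close> is split off.\<close>
proof (intro exI[of _ "4 * T / \<delta> * (15 + 4 / T)\<^sup>2 * (1 + 12 / \<delta>)"] conjI allI)
  show "0 < 4 * T / \<delta> * (15 + 4 / T)\<^sup>2 * (1 + 12 / \<delta>)"
  proof -
    have "0 < 15 + 4 / T" "0 < 1 + 12 / \<delta>"
      using T \<delta> by (auto intro: add_pos_pos)
    then show ?thesis
      using T \<delta> by (intro mult_pos_pos divide_pos_pos) auto
  qed
  have \<delta>_le: "\<delta> \<le> 1 / 2"
    using \<delta>(2)[of T 0] T by linarith
  fix s b :: real
  \<comment> \<open>The derivative of the bump is at most 6, so the height is at most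
    \<open>6 * \<bar>b\<bar> / R\<close>, hence at most \<delta>/2. The summand 1 keeps the width,
    and with it the space derivatives, under control for small b.\<close>
  define R where "R = 1 + 12 * \<bar>b\<bar> / \<delta>"
  have R: "1 \<le> R" "12 * \<bar>b\<bar> \<le> \<delta> * R"
    using \<delta>(1) by (auto simp: R_def field_simps)
  define A where "A = b / R"
  have A: "\<bar>A\<bar> \<le> \<delta> / 12" "A * R = b"
    using R \<delta>(1) by (auto simp: A_def abs_divide divide_le_eq)
  \<comment> \<open>\<open>Q\<close> is -b at s and 0 beyond distance R, so its derivative
    \<open>P\<close> carries b to the right of s and, by symmetry, -b to the left.\<close>
  define Q where "Q x = - (A * R) * bump ((x - s) / R)" for x
  define P where "P x = - A * bump' ((x - s) / R)" for x
  define P' where "P' x = - (A / R) * bump'' ((x - s) / R)" for x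
  \<comment> \<open>The square makes the switch continuously differentiable at T/2.\<close>
  define \<theta> where "\<theta> t = max 0 (2 * t / T - 1) ^ 2" for t
  define \<theta>' where "\<theta>' t = 2 * max 0 (2 * t / T - 1) * (2 / T)" for t
  define mu where "mu t x = rho g (min t T) x + \<theta> (min t T) * P x" for t x
  have dx: "((\<lambda>x. (x - s) / R) has_real_derivative 1 / R) (at x)" for x
    using R by (auto intro!: derivative_eq_intros)
  have dQ: "(Q has_real_derivative P x) (at x)" for x
    using DERIV_cmult[OF DERIV_chain2[OF bump_deriv dx], of "- (A * R)" x] R
    by (simp add: Q_def[abs_def] P_def)
  have dP: "(P has_real_derivative P' x) (at x)" for x
    using DERIV_cmult[OF DERIV_chain2[OF bump'_deriv dx], of "- A" x] R
    by (simp add: P_def[abs_def] P'_def)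
  have cP: "continuous_on UNIV P" and cQ: "continuous_on UNIV Q" and cP': "continuous_on UNIV P'"
    unfolding P_def[abs_def] Q_def[abs_def] P'_def[abs_def] using R by (auto intro!: continuous_intros)
  have d\<theta>: "(\<theta> has_real_derivative \<theta>' t) (at t)" for t
    unfolding \<theta>_def[abs_def] \<theta>'_def using T by (auto intro!: derivative_eq_intros)
  have c\<theta>: "continuous_on UNIV \<theta>" and c\<theta>': "continuous_on UNIV \<theta>'"
    unfolding \<theta>_def[abs_def] \<theta>'_def[abs_def] using T by (auto intro!: continuous_intros)
  have \<theta>0: "\<theta> 0 = 0" "\<theta> T = 1"
    using T by (auto simp: \<theta>_def)
  have \<theta>_early: "\<theta> t = 0" "\<theta>' t = 0" if "t < T / 2" for t
    using that T by (auto simp: \<theta>_def \<theta>'_def max_def field_simps)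
  have \<theta>_bounds: "0 \<le> \<theta> t" "\<theta> t \<le> 1" "\<bar>\<theta>' t\<bar> \<le> 4 / T" if "t \<le> T" for t
  proof -
    have m: "0 \<le> max 0 (2 * t / T - 1)" "max 0 (2 * t / T - 1) \<le> 1"
      using that T by (auto simp: field_simps)
    then show "0 \<le> \<theta> t" "\<theta> t \<le> 1"
      by (auto simp: \<theta>_def intro: power_le_one)
    show "\<bar>\<theta>' t\<bar> \<le> 4 / T"
      using m T mult_right_mono[OF m(2), of "4 / T"] by (simp add: \<theta>'_def abs_mult mult.commute)
  qed
  have P_bound: "\<bar>P x\<bar> \<le> \<delta> / 2" for x
  proof -
    have "\<bar>A\<bar> * \<bar>bump' ((x - s) / R)\<bar> \<le> \<delta> / 12 * 6"
      using A bump_bounds(3) \<delta>(1) by (intro mult_mono) auto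
    then show ?thesis
      by (simp add: P_def abs_mult)
  qed
  have late: "\<delta> / 2 \<le> rho g t x + \<theta> t * P x \<and> rho g t x + \<theta> t * P x \<le> 1 - \<delta> / 2" if "T / 2 \<le> t" "t \<le> T" for t x
  proof -
    have "\<bar>\<theta> t * P x\<bar> \<le> 1 * (\<delta> / 2)"
      unfolding abs_mult using \<theta>_bounds[OF that(2)] P_bound by (intro mult_mono) auto
    then show ?thesis
      using \<delta>(2)[OF that(1), of x] by linarith
  qed
  have bounds: "0 \<le> rho g t x + \<theta> t * P x \<and> rho g t x + \<theta> t * P x \<le> 1" if "t \<le> T" for t x
  proof (cases "t < T / 2")
    case True
    then show ?thesis
      using rho_nonneg[OF g] rho_le_1[OF g] by (simp add: \<theta>_early)
  next
    case False
    then show ?thesis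
      using late[of t x] that \<delta>(1) by linarith
  qed
  have mu_bounds: "0 \<le> mu t x \<and> mu t x \<le> 1" for t x
    unfolding mu_def using bounds[of "min t T" x] by simp
  have dens: "density T mu"
    unfolding mu_def[abs_def] using bounds by (intro density_perturbed g cP c\<theta>) simp
  have mu0: "mu 0 = g"
    using T by (auto simp: mu_def \<theta>0)
  have cur: "has_current (\<lambda>x. mu T x - rho g T x) s b"
  proof -
    have "(LBINT x=ereal s..ereal L. mu T x - rho g T x) = Q L - Q s" if "s + R < L" for L
    proof -
      have "(LBINT x=ereal s..ereal L. P x) = Q L - Q s"
      proof (rule interval_integral_FTC_finite)
        show "continuous_on {min s L..max s L} P"
          by (rule continuous_on_subset[OF cP]) simp
        show "(Q has_vector_derivative P x) (at x within {min s L..max s L})" for x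
          using dQ by (auto simp: has_real_derivative_iff_has_vector_derivative[symmetric] intro: DERIV_subset)
      qed
      then show ?thesis
        by (simp add: mu_def \<theta>0)
    qed
    moreover have "Q L - Q s = b" if "s + R < L" for L
    proof -
      have "1 < \<bar>(L - s) / R\<bar>"
        using that R by (simp add: less_divide_eq)
      then show ?thesis
        using bump_outside A by (simp add: Q_def)
    qed
    ultimately have "\<forall>\<^sub>F L in at_top. b = (LBINT x=ereal s..ereal L. mu T x - rho g T x)"
      by (intro eventually_mono[OF eventually_gt_at_top[of "s + R"]]) auto
    then show ?thesis
      unfolding has_current_def by (rule Lim_transform_eventually[OF tendsto_const])
  qed
  define w where "w t x = \<theta> t * P' x / 2 - \<theta>' t * Q x" for t x
  \<comment> \<open>Half of the bound 30 on \<open>bump''\<close>, from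
    \<open>\<theta> t * P' x / 2\<close>, plus the bound 4/T on \<open>\<theta>'\<close>, from
    \<open>\<theta>' t * Q x\<close>.\<close>
  define W where "W = \<bar>b\<bar> * (15 + 4 / T)"
  have "I0 T mu \<le> ereal (T * R * W\<^sup>2 / (\<delta> / 4))"
  proof (rule I0_le_driven[where w=w and s=s])
    note [measurable (raw)] = rho_measurable[OF g, THEN measurable_case_prod_compose]
    have [measurable]: "P \<in> borel_measurable borel" "P' \<in> borel_measurable borel" "Q \<in> borel_measurable borel"
      "\<theta> \<in> borel_measurable borel" "\<theta>' \<in> borel_measurable borel"
      using cP cP' cQ c\<theta> c\<theta>' by (auto intro: borel_measurable_continuous_onI)
    show "case_prod mu \<in> borel_measurable (borel \<Otimes>\<^sub>M borel)"
      unfolding mu_def[abs_def] split_def by measurable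
    show "case_prod w \<in> borel_measurable (borel \<Otimes>\<^sub>M borel)"
      unfolding w_def[abs_def] split_def by measurable
    show "0 \<le> mu t x \<and> mu t x \<le> 1" for t x
      by (rule mu_bounds)
    show "lfun T mu G Gt Gxx = (LBINT t:{0..T}. (LBINT x. w t x * Gx t x))" if "C12K G Gt Gx Gxx" for G Gt Gx Gxx
      unfolding w_def using T
      by (intro lfun_perturbed[OF that _ g dQ dP cP' d\<theta> c\<theta>' \<theta>0]) (auto simp: mu_def min_def)
    show "\<bar>w t x\<bar> \<le> W * indicator {s - R..s + R} x" if t: "t \<in> {0..T}" for t x
    proof (cases "x \<in> {s - R..s + R}")
      case True
      have "\<bar>A\<bar> / R \<le> \<bar>b\<bar>" "\<bar>A\<bar> * R = \<bar>b\<bar>"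
      proof -
        show *: "\<bar>A\<bar> * R = \<bar>b\<bar>"
          using A(2) R by (metis abs_mult abs_of_nonneg order_trans zero_le_one)
        have "\<bar>A\<bar> / R \<le> \<bar>A\<bar> / 1"
          using R by (intro divide_left_mono) auto
        also have "\<bar>A\<bar> / 1 \<le> \<bar>A\<bar> * R"
          using R mult_left_mono[of 1 R "\<bar>A\<bar>"] by simp
        finally show "\<bar>A\<bar> / R \<le> \<bar>b\<bar>"
          by (simp add: *)
      qed
      then have "\<bar>A\<bar> / R * \<bar>bump'' ((x - s) / R)\<bar> \<le> \<bar>b\<bar> * 30"
        "\<bar>A\<bar> * R * \<bar>bump ((x - s) / R)\<bar> \<le> \<bar>b\<bar> * 1"
        using bump_bounds[of "(x - s) / R"] by (intro mult_mono; simp)+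
      then have P': "\<bar>P' x\<bar> \<le> \<bar>b\<bar> * 30" and Q: "\<bar>Q x\<bar> \<le> \<bar>b\<bar> * 1"
        using R by (simp_all add: P'_def Q_def abs_mult)
      have "\<bar>\<theta> t * P' x\<bar> \<le> 1 * (\<bar>b\<bar> * 30)" "\<bar>\<theta>' t * Q x\<bar> \<le> 4 / T * (\<bar>b\<bar> * 1)"
        unfolding abs_mult using P' Q \<theta>_bounds[of t] t T by (intro mult_mono; simp)+
      then have "\<bar>w t x\<bar> \<le> \<bar>b\<bar> * 30 / 2 + 4 / T * \<bar>b\<bar>"
        unfolding w_def by (simp add: abs_le_iff)
      then show ?thesis
        using True by (simp add: W_def algebra_simps)
    next
      case False
      then have "1 < \<bar>(x - s) / R\<bar>"
        using R by (auto simp: abs_divide less_divide_eq)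
      then show ?thesis
        using bump_outside False by (simp add: w_def P'_def Q_def)
    qed
    show "\<delta> / 4 \<le> mu t x * (1 - mu t x)" if t: "t \<in> {0..T}" and "w t x \<noteq> 0" for t x
    proof -
      have "T / 2 \<le> t"
        using \<theta>_early[of t] that(2) by (force simp: w_def)
      then have m: "\<delta> / 2 \<le> mu t x" "mu t x \<le> 1 - \<delta> / 2"
        using late[of t x] t by (auto simp: mu_def min_def)
      \<comment> \<open>Expanding this product shows that the mobility m(1 - m) on
        [\<delta>/2, 1 - \<delta>/2] is smallest at the endpoints; \<delta> at most 1/2 then gives
        \<delta>/4.\<close>
      have "0 \<le> (mu t x - \<delta> / 2) * (1 - \<delta> / 2 - mu t x)"
        using m by (intro mult_nonneg_nonneg) auto
      then have "\<delta> / 2 * (1 - \<delta> / 2) \<le> mu t x * (1 - mu t x)"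
        by (simp add: algebra_simps)
      moreover have "\<delta> / 2 * (1 / 2) \<le> \<delta> / 2 * (1 - \<delta> / 2)"
        using \<delta>_le \<delta>(1) by (intro mult_left_mono) auto
      ultimately show ?thesis
        by simp
    qed
  qed (use T \<delta> R in auto)
  also have "T * R * W\<^sup>2 / (\<delta> / 4) = 4 * T / \<delta> * (15 + 4 / T)\<^sup>2 * b\<^sup>2 * R"
    by (simp add: W_def power_mult_distrib)
  also have "\<dots> \<le> 4 * T / \<delta> * (15 + 4 / T)\<^sup>2 * b\<^sup>2 * ((1 + 12 / \<delta>) * (1 + \<bar>b\<bar>))"
  proof (intro ereal_less_eq(3)[THEN iffD2] mult_left_mono)
    have "(1 + 12 / \<delta>) * (1 + \<bar>b\<bar>) = R + \<bar>b\<bar> + 12 / \<delta>"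
      by (simp add: R_def algebra_simps add_divide_distrib)
    then show "R \<le> (1 + 12 / \<delta>) * (1 + \<bar>b\<bar>)"
      using \<delta>(1) by simp
  qed (use T \<delta> in auto)
  finally have "I0 T mu \<le> ereal (4 * T / \<delta> * (15 + 4 / T)\<^sup>2 * (1 + 12 / \<delta>) * b\<^sup>2 * (1 + \<bar>b\<bar>))"
    by (simp add: mult_ac)
  then show "\<exists>mu. density T mu \<and> mu 0 = g \<and> has_current (\<lambda>x. mu T x - rho g T x) s b \<and>
      I0 T mu \<le> ereal (4 * T / \<delta> * (15 + 4 / T)\<^sup>2 * (1 + 12 / \<delta>) * b\<^sup>2 * (1 + \<bar>b\<bar>))"
    using dens mu0 cur by blast
qed

section \<open>Lower bounds\<close>

text \<open>Abel summation: the smoothly cut off integral is the average of the sharply cut off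
  integrals with weight \<open>- bump'\<close>.\<close>

lemma has_current_bump_limit:
  assumes h: "h \<in> borel_measurable borel" "\<And>x. \<bar>h x\<bar> \<le> 1" and cur: "has_current h s b"
  shows "(\<lambda>n. LBINT x. indicator {s<..} x * bump ((x - s) / real (Suc n)) * h x) \<longlonglongrightarrow> b"
proof -
  note [measurable] = h(1)
  have bm: "bounded_measurable h"
    using h unfolding bounded_measurable_def by blast
  have ind_le: "\<bar>indicator A x * h x\<bar> \<le> indicator A x" for A x
    using h(2) by (auto simp: indicator_def)
  define H where "H L = (LBINT x=ereal s..ereal L. h x)" for L
  have H_Icc: "H L = (LBINT x. indicator {s..L} x * h x)" if "s \<le> L" for L
    using that by (simp add: H_def interval_integral_Icc set_lebesgue_integral_def)
  have H_Ioc: "H L = (LBINT x. indicator {s<..L} x * h x)" if "s \<le> L" for L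
    using that by (simp add: H_def interval_integral_Ioc set_lebesgue_integral_def)
  have H_lin: "\<bar>H L\<bar> \<le> L - s" if "s \<le> L" for L
  proof -
    have "\<bar>H L\<bar> \<le> (LBINT x. indicator {s..L} x)"
      unfolding H_Icc[OF that] by (rule abs_integral_le[OF integrable_indicator_Icc ind_le])
    then show ?thesis
      using that by simp
  qed
  have lim: "(H \<longlongrightarrow> b) at_top"
    using cur unfolding has_current_def H_def[abs_def] .
  then have "\<forall>\<^sub>F L in at_top. dist (H L) b < 1"
    by (rule tendstoD) simp
  then obtain L0 where L0: "\<And>L. L0 \<le> L \<Longrightarrow> dist (H L) b < 1"
    by (auto simp: eventually_at_top_linorder)
  \<comment> \<open>From L0 on the integral is within 1 of b; before L0 it is at most the length of
    the interval. This bound feeds dominated convergence.\<close>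
  define B where "B = \<bar>b\<bar> + 1 + \<bar>L0 - s\<bar>"
  have H_bound: "\<bar>H L\<bar> \<le> B" if "s \<le> L" for L
  proof (cases "L0 \<le> L")
    case True
    then show ?thesis
      using L0[of L] by (simp add: B_def dist_real_def)
  next
    case False
    then show ?thesis
      using H_lin[OF that] by (simp add: B_def)
  qed
  have H_meas [measurable]: "H \<in> borel_measurable borel"
  proof -
    have lip: "\<bar>H L - H M\<bar> \<le> \<bar>L - M\<bar>" for L M
    proof -
      have *: "\<bar>H L - H M\<bar> \<le> L - M" if "M \<le> L" for L M
      proof -
        have "H L - H M = (LBINT x=ereal M..ereal L. h x)"
          unfolding H_def using interval_integral_split[OF bm, of s M L] by simp
        also have "\<dots> = (LBINT x. indicator {M..L} x * h x)"
          using that by (simp add: interval_integral_Icc set_lebesgue_integral_def)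
        also have "\<bar>\<dots>\<bar> \<le> (LBINT x. indicator {M..L} x)"
          by (rule abs_integral_le[OF integrable_indicator_Icc ind_le])
        finally show ?thesis
          using that by simp
      qed
      show ?thesis
        using *[of L M] *[of M L] by linarith
    qed
    have "continuous_on UNIV H"
      unfolding continuous_on_iff dist_real_def using lip by (meson order_le_less_trans)
    then show ?thesis
      by (rule borel_measurable_continuous_onI)
  qed
  have bump'_meas [measurable]: "bump' \<in> borel_measurable borel"
    by (rule borel_measurable_continuous_onI) (use continuous_on_bump(2)[of UNIV "\<lambda>x. x"] in \<open>simp add: continuous_on_id\<close>)
  have bump_int: "bump v = (LBINT u. indicator {v..1} u * - bump' u)" if "v \<le> 1" for v
  proof -
    have "isCont (\<lambda>u. - bump' u) u" for u
      using continuous_on_bump(2)[of UNIV "\<lambda>x. x"] by (simp add: continuous_on_eq_continuous_at continuous_on_id)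
    then have "(LBINT u. - bump' u * indicator {v..1} u) = - bump 1 - (- bump v)"
      using that by (intro integral_FTC_Icc_real DERIV_minus bump_deriv) auto
    moreover have "bump 1 = 0"
      by (simp add: bump_def)
    ultimately show ?thesis
      by (simp add: mult.commute)
  qed
  have eq: "(LBINT x. indicator {s<..} x * bump ((x - s) / N) * h x) =
      (LBINT u. indicator {0..1} u * - bump' u * H (s + N * u))" if N: "0 < N" for N
  proof -
    let ?f = "\<lambda>u x. indicator {0..1} u * - bump' u * (indicator {s<..s + N * u} x * h x)"
    have "(LBINT x. indicator {s<..} x * bump ((x - s) / N) * h x) = (LBINT x. (LBINT u. ?f u x))"
    proof (rule Bochner_Integration.integral_cong[OF refl])
      fix x
      show "indicator {s<..} x * bump ((x - s) / N) * h x = (LBINT u. ?f u x)"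
      proof (cases "s < x \<and> x \<le> s + N")
        case True
        then have v: "0 \<le> (x - s) / N" "(x - s) / N \<le> 1"
          using N by (auto simp: divide_le_eq)
        have feq: "?f u x = (indicator {(x - s) / N..1} u * - bump' u) * h x" for u
        proof -
          have "x \<le> s + N * u \<longleftrightarrow> (x - s) / N \<le> u"
            using N by (simp add: pos_divide_le_eq algebra_simps)
          then have "indicat_real {0..1} u * indicator {s<..s + N * u} x = indicator {(x - s) / N..1} u"
            using True v by (auto simp: indicator_def dest: order_trans[OF v(1)])
          moreover have "?f u x = (indicat_real {0..1} u * indicator {s<..s + N * u} x) * - bump' u * h x"
            by simp
          ultimately show ?thesis
            by (simp only:)
        qed
        have "(LBINT u. ?f u x) = bump ((x - s) / N) * h x"
          unfolding bump_int[OF v(2)] feq by (rule integral_mult_left_zero)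
        moreover have "indicator {s<..} x * bump ((x - s) / N) * h x = bump ((x - s) / N) * h x"
          using True by simp
        ultimately show ?thesis
          by (simp only:)
      next
        case False
        have "?f u x = 0" for u
        proof -
          have "N * u \<le> N" if "u \<le> 1"
            using that N by simp
          then show ?thesis
            using False by (auto simp: indicator_def)
        qed
        moreover have "indicator {s<..} x * bump ((x - s) / N) = 0"
        proof (cases "s < x")
          case True
          then have "1 < \<bar>(x - s) / N\<bar>"
            using False N by (simp add: less_divide_eq)
          then show ?thesis
            using bump_outside by simp
        qed simp
        ultimately show ?thesis
          by (simp only: mult_zero_left integral_zero)
      qed
    qed
    also have "\<dots> = (LBINT u. (LBINT x. ?f u x))"
    proof (rule Fubini_product_bound[where h="\<lambda>u. 6 * indicator {0..1} u" and k="\<lambda>x. indicator {s..s + N} x"])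
      have "Measurable.pred (borel \<Otimes>\<^sub>M borel) (\<lambda>p::real \<times> real. snd p \<in> {s<..s + N * fst p})"
        unfolding greaterThanAtMost_iff by measurable
      then have [measurable]: "(\<lambda>p. indicat_real {s<..s + N * fst p} (snd p)) \<in> borel_measurable (borel \<Otimes>\<^sub>M borel)"
        by (simp add: indicator_def)
      show "case_prod ?f \<in> borel_measurable (borel \<Otimes>\<^sub>M borel)"
        unfolding split_beta' by measurable
      fix u x
      have "N * u \<le> N" if "u \<le> 1"
        using that N by simp
      moreover have "\<bar>bump' u\<bar> * \<bar>h x\<bar> \<le> 6 * 1"
        using bump_bounds(3)[of u] h(2)[of x] by (intro mult_mono) auto
      ultimately show "\<bar>?f u x\<bar> \<le> 6 * indicator {0..1} u * indicator {s..s + N} x"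
        by (auto simp: indicator_def abs_mult)
    qed auto
    also have "\<dots> = (LBINT u. indicator {0..1} u * - bump' u * H (s + N * u))"
      by (rule Bochner_Integration.integral_cong[OF refl]) (use N in \<open>auto simp: H_Ioc indicator_def\<close>)
    finally show ?thesis .
  qed
  have "(\<lambda>n. LBINT u. indicator {0..1} u * - bump' u * H (s + real (Suc n) * u)) \<longlonglongrightarrow>
      (LBINT u. indicator {0..1} u * - bump' u * b)"
  proof (rule integral_dominated_convergence[where w="\<lambda>u. 6 * B * indicator {0..1} u"])
    \<comment> \<open>The upper limit \<open>s + real (Suc n) * u\<close> runs to infinity only for
      positive u; the single point 0 is negligible.\<close>
    have "AE u in lborel. u \<noteq> (0::real)"
      by (rule AE_lborel_singleton)
    then show "AE u in lborel. (\<lambda>n. indicator {0..1} u * - bump' u * H (s + real (Suc n) * u)) \<longlonglongrightarrow> indicator {0..1} u * - bump' u * b"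
    proof eventually_elim
      case (elim u)
      show ?case
      proof (cases "0 < u")
        case True
        have "filterlim (\<lambda>n. s + real (Suc n) * u) at_top sequentially"
          by (intro filterlim_tendsto_add_at_top[OF tendsto_const] filterlim_at_top_mult_tendsto_pos[OF tendsto_const True]
              filterlim_compose[OF filterlim_real_sequentially filterlim_Suc])
        then have "(\<lambda>n. H (s + real (Suc n) * u)) \<longlonglongrightarrow> b"
          by (rule filterlim_compose[OF lim])
        then show ?thesis
          by (intro tendsto_mult tendsto_const)
      next
        case False
        then show ?thesis
          using elim by simp
      qed
    qed
    show "AE u in lborel. norm (indicator {0..1} u * - bump' u * H (s + real (Suc n) * u)) \<le> 6 * B * indicator {0..1} u" for n
    proof (rule AE_I2)
      fix u :: real
      have "\<bar>bump' u\<bar> * \<bar>H (s + real (Suc n) * u)\<bar> \<le> 6 * B" if "0 \<le> u"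
        using bump_bounds(3)[of u] H_bound[of "s + real (Suc n) * u"] that by (intro mult_mono) auto
      then show "norm (indicator {0..1} u * - bump' u * H (s + real (Suc n) * u)) \<le> 6 * B * indicator {0..1} u"
        by (auto simp: indicator_def abs_mult)
    qed
  qed auto
  moreover have "(LBINT u. indicator {0..1} u * - bump' u * b) = b"
    using bump_int[of 0] by simp
  ultimately show ?thesis
    by (simp add: eq)
qed

lemma integrable_std_normal_affine:
  assumes "0 < (c::real)"
  shows "integrable lborel (\<lambda>x. std_normal_density ((x - s) / c) / c)"
    and "(LBINT x. std_normal_density ((x - s) / c) / c) = 1"
    and "integrable lborel (\<lambda>x. \<bar>(x - s) / c\<bar> * std_normal_density ((x - s) / c) / c)"
    and "(LBINT x. \<bar>(x - s) / c\<bar> * std_normal_density ((x - s) / c) / c) \<le> 1"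
proof -
  have e: "(x - s) / c = - s / c + (1 / c) * x" for x
    by (simp add: diff_divide_distrib)
  have i: "integrable lborel (\<lambda>x. f ((x - s) / c) / c)" "(LBINT x. f ((x - s) / c) / c) = (LBINT x. f x)"
    if "integrable lborel f" for f :: "real \<Rightarrow> real"
  proof -
    have "integrable lborel (\<lambda>x. f (- s / c + (1 / c) * x))"
      using assms that by (intro lborel_integrable_real_affine) auto
    then show "integrable lborel (\<lambda>x. f ((x - s) / c) / c)"
      unfolding e by simp
    show "(LBINT x. f ((x - s) / c) / c) = (LBINT x. f x)"
      unfolding e using assms lborel_integral_real_affine[of "1 / c" f "- s / c"] by simp
  qed
  have i2: "integrable lborel (\<lambda>z. \<bar>z\<bar> * std_normal_density z)"
    using integrable_std_normal_moment_abs[of 1] by (simp add: mult.commute)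
  show "integrable lborel (\<lambda>x. std_normal_density ((x - s) / c) / c)"
    "(LBINT x. std_normal_density ((x - s) / c) / c) = 1"
    using i[of std_normal_density] by auto
  show "integrable lborel (\<lambda>x. \<bar>(x - s) / c\<bar> * std_normal_density ((x - s) / c) / c)"
    "(LBINT x. \<bar>(x - s) / c\<bar> * std_normal_density ((x - s) / c) / c) \<le> 1"
    using i[OF i2] integral_std_normal_abs_le by (auto simp: mult.commute)
qed

section \<open>Testing a density against a smoothed step\<close>

text \<open>The identity for the heat flow is subtracted. The time-0 terms cancel because both paths
  start at \<open>g\<close> almost everywhere, which is where (DIC) enters. Each of the two paths
  contributes at most \<open>T * E\<close> through the heat operator; E is uniform over all profiles
  so that it serves both.\<close>

lemma lfun_rho_difference:
  assumes C: "C12K G Gt Gx Gxx" and g: "M1 g" and T: "0 \<le> T"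
    and mu: "\<And>t. M1 (mu t)" "AE x in lborel. mu 0 x = g x"
    and E: "\<And>t u. t \<in> {0..T} \<Longrightarrow> M1 u \<Longrightarrow> \<bar>LBINT x. u x * (Gt t x + Gxx t x / 2)\<bar> \<le> E"
  shows "(LBINT x. G T x * (mu T x - rho g T x)) - 2 * T * E \<le> lfun T mu G Gt Gxx"
proof -
  obtain L where L: "0 \<le> L" "\<And>t x. L < \<bar>x\<bar> \<Longrightarrow> G t x = 0 \<and> Gt t x = 0 \<and> Gx t x = 0 \<and> Gxx t x = 0"
    using C12K_support[OF C] by metis
  have cG: "continuous_on UNIV (G t)" for t
    using C by (intro continuous_on_section) (simp add: C12K_def)
  have [measurable]: "G t \<in> borel_measurable borel" "mu t \<in> borel_measurable borel" "g \<in> borel_measurable borel" for t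
    using borel_measurable_continuous_onI[OF cG] M1_measurable[OF mu(1)] M1_measurable[OF g] by auto
  have i: "integrable lborel (\<lambda>x. G T x * u x)" if u: "M1 u" for u
  proof -
    have [measurable]: "u \<in> borel_measurable borel"
      by (rule M1_measurable[OF u])
    obtain B where B: "\<And>x. \<bar>G T x\<bar> \<le> B"
      using continuous_compact_support_bounded[OF cG, of L T] L by auto
    show ?thesis
      by (rule integrable_bounded_compact_support[where K=B and L=L]) (use L in \<open>auto intro: abs_mult_M1_le u B\<close>)
  qed
  have bound: "\<bar>LBINT t:{0..T}. (LBINT x. v t x * (Gt t x + Gxx t x / 2))\<bar> \<le> T * E"
    if "\<And>t. M1 (v t)" for v
    using abs_set_integral_Icc_le[OF T, of "\<lambda>t. LBINT x. v t x * (Gt t x + Gxx t x / 2)" E] E that by simp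
  have "(LBINT x. G 0 x * mu 0 x) = (LBINT x. G 0 x * rho g 0 x)"
    using mu(2) by (intro integral_cong_AE) auto
  moreover have "(LBINT x. G T x * (mu T x - rho g T x)) = (LBINT x. G T x * mu T x) - (LBINT x. G T x * rho g T x)"
    unfolding right_diff_distrib by (intro Bochner_Integration.integral_diff i mu M1_rho g)
  moreover note bound[of mu] bound[of "rho g"] mu(1) M1_rho[OF g] lfun_rho_eq_0[OF C g T]
  ultimately show ?thesis
    unfolding lfun_def by (simp add: abs_le_iff) 
qed

text \<open>The mobility is at most 1/4, and \<open>qfun\<close> has a further factor 1/2. The
  majorants \<open>h\<close> and \<open>B\<close> carry the integrability in place of the integrand
  itself.\<close>

lemma qfun_upper:
  assumes T: "0 \<le> T" and mu: "\<And>t. M1 (mu t)"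
    and B: "set_integrable lborel {0..T} B" "\<And>t. t \<in> {0..T} \<Longrightarrow> integrable lborel (h t)"
      "\<And>t x. t \<in> {0..T} \<Longrightarrow> (Gx t x)\<^sup>2 \<le> h t x" "\<And>t. t \<in> {0..T} \<Longrightarrow> (LBINT x. h t x) \<le> B t"
  shows "qfun T mu Gx \<le> (LBINT t:{0..T}. B t) / 8"
proof -
  have "\<bar>LBINT t:{0..T}. (LBINT x. mu t x * (1 - mu t x) * (Gx t x)\<^sup>2)\<bar> \<le> (LBINT t:{0..T}. B t / 4)"
  proof (rule abs_set_integral_le)
    fix t assume t: "t \<in> {0..T}"
    have "\<bar>LBINT x. mu t x * (1 - mu t x) * (Gx t x)\<^sup>2\<bar> \<le> (LBINT x. h t x / 4)"
    proof (rule abs_integral_le)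
      show "integrable lborel (\<lambda>x. h t x / 4)"
        using B(2)[OF t] by simp
      fix x
      have m: "0 \<le> mu t x * (1 - mu t x)" "mu t x * (1 - mu t x) \<le> 1 / 4"
      proof -
        show "0 \<le> mu t x * (1 - mu t x)"
          using M1_bounds[OF mu, of t x] by simp
        have "0 \<le> (mu t x - 1 / 2)\<^sup>2"
          by simp
        then show "mu t x * (1 - mu t x) \<le> 1 / 4"
          by (simp add: power2_eq_square algebra_simps)
      qed
      then have "mu t x * (1 - mu t x) * (Gx t x)\<^sup>2 \<le> 1 / 4 * h t x"
        using B(3)[OF t, of x] by (intro mult_mono) auto
      then show "\<bar>mu t x * (1 - mu t x) * (Gx t x)\<^sup>2\<bar> \<le> h t x / 4"
        using m(1) by simp
    qed
    also have "\<dots> \<le> B t / 4"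
      using B(4)[OF t] by simp
    finally show "\<bar>LBINT x. mu t x * (1 - mu t x) * (Gx t x)\<^sup>2\<bar> \<le> B t / 4" .
  qed (use B(1) in simp)
  then show ?thesis
    unfolding qfun_def by simp
qed

text \<open>The test function is \<open>\<lambda> \<Phi>((x - s) / \<surd>\<tau>(t))\<close>, cut off at distance \<open>n\<close> from \<open>s\<close>.
  It solves the backward heat equation exactly where \<open>\<tau>' = -1\<close>.\<close>

lemma I0_lower_bound_profile:
  fixes \<tau> \<tau>' :: "real \<Rightarrow> real"
  assumes g: "M1 g" and T: "0 < T"
    and mu: "\<And>t. M1 (mu t)" "AE x in lborel. mu 0 x = g x"
    and cur: "has_current (\<lambda>x. mu T x - rho g T x) s b"
    and \<tau>: "\<And>t. 0 < \<tau> t" "\<And>t. (\<tau> has_real_derivative \<tau>' t) (at t)" "continuous_on UNIV \<tau>'"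
    and D: "\<And>t. t \<in> {0..T} \<Longrightarrow> \<bar>1 + \<tau>' t\<bar> / sqrt (\<tau> t) \<le> D"
    and K: "(LBINT t:{0..T}. 1 / sqrt (\<tau> t)) \<le> K"
  shows "ereal (l * b - \<bar>l\<bar> * (2 * pi * sqrt (\<tau> T) + T * D) - l\<^sup>2 * K / 4) \<le> I0 T mu"
proof -
  define \<eta> where "\<eta> x = mu T x - rho g T x" for x
  have [measurable]: "\<eta> \<in> borel_measurable borel"
    unfolding \<eta>_def[abs_def] using M1_measurable[OF mu(1)] M1_measurable[OF M1_rho[OF g]] by simp
  have \<eta>_le: "\<bar>\<eta> x\<bar> \<le> 1" for x
    unfolding \<eta>_def using M1_bounds[OF mu(1), of T x] M1_bounds[OF M1_rho[OF g], of T x] by auto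
  define c where "c t = sqrt (\<tau> t)" for t
  have c: "0 < c t" for t
    using \<tau>(1) by (simp add: c_def)
  have c_cont: "continuous_on UNIV c"
  proof -
    have "continuous_on UNIV \<tau>"
      using \<tau>(2) by (meson DERIV_isCont continuous_at_imp_continuous_on)
    then show ?thesis
      unfolding c_def[abs_def] by (intro continuous_intros)
  qed
  have c_deriv: "(c has_real_derivative \<tau>' t / (2 * c t)) (at t)" for t
    unfolding c_def[abs_def] using DERIV_chain2[OF DERIV_real_sqrt[OF \<tau>(1)] \<tau>(2), of t]
    by (simp add: field_simps)
  define u where "u t x = (x - s) / c t" for t x
  define p where "p t x = std_normal_density (u t x) / c t" for t x
  define q where "q t x = - u t x * std_normal_density (u t x) / (c t)\<^sup>2" for t x
  have u_x: "((\<lambda>x. u t x) has_real_derivative 1 / c t) (at x)" for t x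
    unfolding u_def using c[of t] by (auto intro!: derivative_eq_intros)
  have u_t: "((\<lambda>t. u t x) has_real_derivative - ((x - s) * (\<tau>' t / (2 * c t))) / (c t)\<^sup>2) (at t)" for t x
    unfolding u_def using c[of t] by (auto intro!: derivative_eq_intros c_deriv simp: power2_eq_square)
  have Phi_x: "((\<lambda>x. Phi (u t x)) has_real_derivative p t x) (at x)" for t x
    using DERIV_chain2[OF Phi_has_derivative u_x, of t x] by (simp add: p_def)
  have p_x: "((\<lambda>x. p t x) has_real_derivative q t x) (at x)" for t x
    using DERIV_cmult[OF DERIV_chain2[OF std_normal_density_deriv u_x], of "1 / c t" t x] c[of t]
    by (simp add: p_def q_def power2_eq_square)
  \<comment> \<open>\<open>q\<close> is also the second space derivative of
    \<open>Phi (u t x)\<close>, so the backward heat operator leaves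
    \<open>(1 + \<tau>' t) / 2 * q t x\<close>; this residue is what D controls.\<close>
  have Phi_t: "((\<lambda>t. Phi (u t x)) has_real_derivative \<tau>' t / 2 * q t x) (at t)" for t x
    using DERIV_chain2[OF Phi_has_derivative u_t, of x t] c[of t]
    by (simp add: q_def u_def power2_eq_square field_simps)
  have cont_u: "continuous_on UNIV (\<lambda>(t, x). u t x)"
    unfolding u_def split_beta' using c by (intro continuous_intros continuous_on_compose2[OF c_cont]) (auto simp: less_imp_neq[symmetric])
  have cont_c: "continuous_on UNIV (\<lambda>p::real \<times> real. c (fst p))"
    by (intro continuous_intros continuous_on_compose2[OF c_cont]) auto
  have c_neq: "c t \<noteq> 0" for t
    using c[of t] by simp
  have cont_Phi: "continuous_on UNIV (\<lambda>(t, x). Phi (u t x))"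
  proof -
    have "continuous_on UNIV Phi"
      using Phi_has_derivative by (meson DERIV_isCont continuous_at_imp_continuous_on)
    then show ?thesis
      using cont_u unfolding split_beta' by (auto intro: continuous_on_compose2)
  qed
  have cont_p: "continuous_on UNIV (\<lambda>(t, x). p t x)" and cont_q: "continuous_on UNIV (\<lambda>(t, x). q t x)"
    unfolding p_def q_def split_beta' using cont_u cont_c c_neq by (auto intro!: continuous_intros simp: split_beta')
  have cont_\<tau>': "continuous_on UNIV (\<lambda>p::real \<times> real. \<tau>' (fst p))"
    by (intro continuous_intros continuous_on_compose2[OF \<tau>(3)]) auto
  have p_int: "integrable lborel (p t)" "(LBINT x. p t x) = 1" for t
    using integrable_std_normal_affine(1,2)[OF c[of t], of s] by (simp_all add: p_def[abs_def] u_def)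
  have q_abs: "\<bar>q t x\<bar> = 1 / c t * (\<bar>u t x\<bar> * std_normal_density (u t x) / c t)" for t x
    using c[of t] by (simp add: q_def abs_mult power2_eq_square)
  have q_int: "integrable lborel (\<lambda>x. \<bar>q t x\<bar>)" "(LBINT x. \<bar>q t x\<bar>) \<le> 1 / c t" for t
  proof -
    show "integrable lborel (\<lambda>x. \<bar>q t x\<bar>)"
      unfolding q_abs u_def by (intro integrable_mult_right integrable_std_normal_affine(3) c)
    have "1 / c t * (LBINT x. \<bar>u t x\<bar> * std_normal_density (u t x) / c t) \<le> 1 / c t * 1"
      unfolding u_def using c[of t] by (intro mult_left_mono integrable_std_normal_affine(4)) auto
    then show "(LBINT x. \<bar>q t x\<bar>) \<le> 1 / c t"
      unfolding q_abs by simp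
  qed
  have p_nonneg: "0 \<le> p t x" for t x
    using c[of t] by (simp add: p_def)
  \<comment> \<open>With cut-off distance N = n + 1 the errors are explicit. In the heat operator,
    36/N is 6/N from \<open>p * X1\<close> plus 30/N from \<open>Phi * X2 / 2\<close> on an interval
    of length 2N. In the energy, 18 T / N is 144 T / (8 N) from the square of
    \<open>Phi * X1\<close>. Both vanish in the limit.\<close>
  have main: "l * (LBINT x. indicator {s<..} x * bump ((x - s) / real (Suc n)) * \<eta> x) - \<bar>l\<bar> * (2 * pi * c T)
      - 2 * T * (\<bar>l\<bar> * (D / 2 + 36 / real (Suc n))) - l\<^sup>2 * (K / 4 + 18 * T / real (Suc n)) \<le> I0 T mu" for n
  proof -
    define N where "N = real (Suc n)"
    have N: "1 \<le> N" "0 < N"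
      by (simp_all add: N_def)
    define X where "X x = bump ((x - s) / N)" for x
    define X1 where "X1 x = bump' ((x - s) / N) / N" for x
    define X2 where "X2 x = bump'' ((x - s) / N) / N\<^sup>2" for x
    have v: "((\<lambda>x. (x - s) / N) has_real_derivative 1 / N) (at x)" for x
      using N by (auto intro!: derivative_eq_intros)
    have dX: "(X has_real_derivative X1 x) (at x)" for x
      using DERIV_chain2[OF bump_deriv v, of x] by (simp add: X_def[abs_def] X1_def)
    have dX1: "(X1 has_real_derivative X2 x) (at x)" for x
      using DERIV_cmult[OF DERIV_chain2[OF bump'_deriv v], of "1 / N" x] by (simp add: X1_def[abs_def] X2_def power2_eq_square)
    have cont_X: "continuous_on UNIV (\<lambda>p::real \<times> real. X (snd p))" "continuous_on UNIV (\<lambda>p::real \<times> real. X1 (snd p))"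
      "continuous_on UNIV (\<lambda>p::real \<times> real. X2 (snd p))"
      unfolding X_def X1_def X2_def using N by (auto intro!: continuous_intros)
    have X_le: "0 \<le> X x" "X x \<le> 1" for x
      using bump_bounds by (auto simp: X_def)
    have X_out: "X x = 0 \<and> X1 x = 0 \<and> X2 x = 0" if "x \<notin> {s - N..s + N}" for x
    proof -
      have "1 < \<bar>(x - s) / N\<bar>"
        using that N by (auto simp: abs_divide less_divide_eq)
      then show ?thesis
        using bump_outside by (simp add: X_def X1_def X2_def)
    qed
    have X1_le: "\<bar>X1 x\<bar> \<le> 6 / N * indicator {s - N..s + N} x" and X2_le: "\<bar>X2 x\<bar> \<le> 30 / N\<^sup>2 * indicator {s - N..s + N} x" for x
      using X_out[of x] bump_bounds(3,4)[of "(x - s) / N"] N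
      by (cases "x \<in> {s - N..s + N}"; simp add: X1_def X2_def abs_divide divide_right_mono)+
    define G where "G t x = l * (Phi (u t x) * X x)" for t x
    define Gt where "Gt t x = l * (\<tau>' t / 2 * q t x * X x)" for t x
    define Gx where "Gx t x = l * (p t x * X x + Phi (u t x) * X1 x)" for t x
    define Gxx where "Gxx t x = l * (q t x * X x + 2 * p t x * X1 x + Phi (u t x) * X2 x)" for t x
    have C: "C12K G Gt Gx Gxx"
      unfolding C12K_def
    proof (intro conjI allI)
      show "((\<lambda>s. G s x) has_real_derivative Gt t x) (at t)" for t x
        unfolding G_def Gt_def by (auto intro!: derivative_eq_intros Phi_t)
      show "((\<lambda>y. G t y) has_real_derivative Gx t x) (at x)" for t x
        unfolding G_def Gx_def by (auto intro!: derivative_eq_intros Phi_x dX)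
      show "((\<lambda>y. Gx t y) has_real_derivative Gxx t x) (at x)" for t x
        unfolding Gx_def Gxx_def by (auto intro!: derivative_eq_intros Phi_x dX dX1 p_x)
      show "continuous_on UNIV (\<lambda>(t, x). G t x)" "continuous_on UNIV (\<lambda>(t, x). Gt t x)"
        "continuous_on UNIV (\<lambda>(t, x). Gx t x)" "continuous_on UNIV (\<lambda>(t, x). Gxx t x)"
        unfolding G_def Gt_def Gx_def Gxx_def split_beta'
        using cont_Phi cont_p cont_q cont_X cont_\<tau>' by (auto intro!: continuous_intros simp: split_beta')
      have "G t x = 0" if "\<bar>s\<bar> + N < \<bar>x\<bar>" for t x
      proof -
        have "x \<notin> {s - N..s + N}"
          using that by auto
        then show ?thesis
          using X_out by (simp add: G_def)
      qed
      then show "\<exists>L. \<forall>t x. L < \<bar>x\<bar> \<longrightarrow> G t x = 0"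
        by blast
    qed
    have Phi01: "\<bar>Phi y\<bar> \<le> 1" for y
      using Phi_nonneg[of y] Phi_le_1[of y] by simp
    have E: "\<bar>LBINT x. w x * (Gt t x + Gxx t x / 2)\<bar> \<le> \<bar>l\<bar> * (D / 2 + 36 / N)" if t: "t \<in> {0..T}" and w: "M1 w" for t w
    proof -
      let ?h = "\<lambda>x. \<bar>1 + \<tau>' t\<bar> / 2 * \<bar>q t x\<bar> + 6 / N * p t x + 15 / N\<^sup>2 * indicator {s - N..s + N} x"
      have ih: "integrable lborel ?h"
        using q_int(1) p_int(1) by auto
      have "\<bar>LBINT x. w x * (Gt t x + Gxx t x / 2)\<bar> \<le> (LBINT x. \<bar>l\<bar> * ?h x)"
      proof (rule abs_integral_le)
        show "integrable lborel (\<lambda>x. \<bar>l\<bar> * ?h x)"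
          using ih by simp
        fix x
        have eq: "Gt t x + Gxx t x / 2 = l * ((1 + \<tau>' t) / 2 * q t x * X x + p t x * X1 x + Phi (u t x) * X2 x / 2)"
          unfolding Gt_def Gxx_def by (simp add: algebra_simps add_divide_distrib)
        have 1: "\<bar>(1 + \<tau>' t) / 2 * q t x * X x\<bar> \<le> \<bar>1 + \<tau>' t\<bar> / 2 * \<bar>q t x\<bar>"
          using X_le[of x] by (simp add: abs_mult mult_left_le)
        have "p t x * \<bar>X1 x\<bar> \<le> p t x * (6 / N)"
          using X1_le[of x] N p_nonneg[of t x]
          by (intro mult_left_mono) (auto simp: indicator_def intro: order_trans)
        then have 2: "\<bar>p t x * X1 x\<bar> \<le> 6 / N * p t x"
          using p_nonneg[of t x] by (simp add: abs_mult mult.commute)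
        have "\<bar>Phi (u t x)\<bar> * \<bar>X2 x\<bar> \<le> 1 * (30 / N\<^sup>2 * indicator {s - N..s + N} x)"
          using X2_le[of x] Phi01 by (intro mult_mono) auto
        then have 3: "\<bar>Phi (u t x) * X2 x / 2\<bar> \<le> 15 / N\<^sup>2 * indicator {s - N..s + N} x"
          by (simp add: abs_mult)
        have "\<bar>w x\<bar> * \<bar>Gt t x + Gxx t x / 2\<bar> \<le> 1 * (\<bar>l\<bar> * ?h x)"
        proof (rule mult_mono)
          show "\<bar>Gt t x + Gxx t x / 2\<bar> \<le> \<bar>l\<bar> * ?h x"
            unfolding eq abs_mult[of l] using 1 2 3 by (intro mult_left_mono) linarith+
        qed (use M1_bounds[OF w, of x] in auto)
        then show "\<bar>w x * (Gt t x + Gxx t x / 2)\<bar> \<le> \<bar>l\<bar> * ?h x"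
          by (simp add: abs_mult)
      qed
      also have "\<dots> = \<bar>l\<bar> * (\<bar>1 + \<tau>' t\<bar> / 2 * (LBINT x. \<bar>q t x\<bar>) + 6 / N + 15 / N\<^sup>2 * (2 * N))"
        using q_int(1) p_int N by simp
      also have "\<dots> \<le> \<bar>l\<bar> * (D / 2 + 36 / N)"
      proof (rule mult_left_mono)
        have "\<bar>1 + \<tau>' t\<bar> / 2 * (LBINT x. \<bar>q t x\<bar>) \<le> \<bar>1 + \<tau>' t\<bar> / 2 * (1 / c t)"
          by (intro mult_left_mono q_int(2)) simp
        also have "\<dots> \<le> D / 2"
          using D[OF t] by (simp add: c_def)
        finally show "\<bar>1 + \<tau>' t\<bar> / 2 * (LBINT x. \<bar>q t x\<bar>) + 6 / N + 15 / N\<^sup>2 * (2 * N) \<le> D / 2 + 36 / N"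
          using N by (simp add: power2_eq_square)
      qed simp
      finally show ?thesis .
    qed
    have lf: "(LBINT x. G T x * \<eta> x) - 2 * T * (\<bar>l\<bar> * (D / 2 + 36 / N)) \<le> lfun T mu G Gt Gxx"
      unfolding \<eta>_def
    proof (rule lfun_rho_difference[OF C g])
      show "\<bar>LBINT x. w x * (Gt t x + Gxx t x / 2)\<bar> \<le> \<bar>l\<bar> * (D / 2 + 36 / N)" if "t \<in> {0..T}" "M1 w" for t w
        by (rule E[OF that])
    qed (use T mu in auto)
    have qf: "qfun T mu Gx \<le> l\<^sup>2 * (K / 4 + 18 * T / N)"
    proof -
      let ?B = "\<lambda>t. l\<^sup>2 * (2 / c t + 144 / N)"
      have ic: "set_integrable lborel {0..T} (\<lambda>t. 1 / c t)"
        using c_neq by (intro borel_integrable_atLeastAtMost' continuous_intros continuous_on_subset[OF c_cont]) auto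
      then have iB: "set_integrable lborel {0..T} (\<lambda>t. 2 * l\<^sup>2 * (1 / c t) + l\<^sup>2 * 144 / N)"
        by (intro set_integral_add(1) set_integrable_mult_right) auto
      have B_eq: "?B = (\<lambda>t. 2 * l\<^sup>2 * (1 / c t) + l\<^sup>2 * 144 / N)"
        by (simp add: algebra_simps)
      let ?h = "\<lambda>t x. l\<^sup>2 * (2 / c t * p t x + 72 / N\<^sup>2 * indicator {s - N..s + N} x)"
      have "qfun T mu Gx \<le> (LBINT t:{0..T}. ?B t) / 8"
      proof (rule qfun_upper[where h="?h"])
        show "set_integrable lborel {0..T} ?B"
          unfolding B_eq by (rule iB)
        fix t assume t: "t \<in> {0..T}"
        show "integrable lborel (?h t)"
          using p_int(1) by auto
        show "(LBINT x. ?h t x) \<le> ?B t"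
          using p_int[of t] N by (simp add: power2_eq_square)
        fix x
        \<comment> \<open>One factor \<open>p\<close> is bounded by 1/c, the other integrates to 1;
          so the energy at time t is of order \<open>1 / sqrt (\<tau> t)\<close>, whose time
          integral is bounded by K.\<close>
        have "(p t x * X x)\<^sup>2 \<le> 1 / c t * p t x"
        proof -
          have "p t x \<le> 1 / c t"
            unfolding p_def using c[of t] std_normal_density_le_1 by (intro divide_right_mono) auto
          then have "p t x * p t x \<le> 1 / c t * p t x"
            using p_nonneg by (intro mult_right_mono) auto
          moreover have "(X x)\<^sup>2 \<le> 1"
            using X_le[of x] by (intro power_le_one) auto
          then have "(p t x)\<^sup>2 * (X x)\<^sup>2 \<le> (p t x)\<^sup>2 * 1"
            by (intro mult_left_mono) auto
          ultimately show ?thesis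
            by (simp add: power2_eq_square mult_ac)
        qed
        moreover have "(Phi (u t x) * X1 x)\<^sup>2 \<le> 36 / N\<^sup>2 * indicator {s - N..s + N} x"
        proof -
          have "\<bar>Phi (u t x)\<bar> * \<bar>X1 x\<bar> \<le> 1 * (6 / N * indicator {s - N..s + N} x)"
            using Phi01 X1_le by (intro mult_mono) auto
          then have "\<bar>Phi (u t x) * X1 x\<bar>\<^sup>2 \<le> (6 / N * indicator {s - N..s + N} x)\<^sup>2"
            by (intro power_mono) (auto simp: abs_mult)
          then show ?thesis
            by (cases "x \<in> {s - N..s + N}") (simp_all add: power_divide)
        qed
        moreover have "(p t x * X x + Phi (u t x) * X1 x)\<^sup>2 \<le> 2 * (p t x * X x)\<^sup>2 + 2 * (Phi (u t x) * X1 x)\<^sup>2"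
          using zero_le_power2[of "p t x * X x - Phi (u t x) * X1 x"] by (simp add: power2_eq_square algebra_simps)
        ultimately have "(p t x * X x + Phi (u t x) * X1 x)\<^sup>2 \<le> 2 / c t * p t x + 72 / N\<^sup>2 * indicator {s - N..s + N} x"
          by simp
        then show "(Gx t x)\<^sup>2 \<le> ?h t x"
          unfolding Gx_def power_mult_distrib[of l] by (intro mult_left_mono) auto
      qed (use T mu(1) in auto)
      also have "(LBINT t:{0..T}. ?B t) = 2 * l\<^sup>2 * (LBINT t:{0..T}. 1 / c t) + l\<^sup>2 * 144 / N * T"
      proof -
        have "(LBINT t:{0..T}. ?B t) =
            (LBINT t:{0..T}. 2 * l\<^sup>2 * (1 / c t)) + (LBINT t:{0..T}. l\<^sup>2 * 144 / N)"
          unfolding B_eq by (intro set_integral_add(2) set_integrable_mult_right ic) auto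
        moreover have "(LBINT t:{0..T}. 2 * l\<^sup>2 * (1 / c t)) = 2 * l\<^sup>2 * (LBINT t:{0..T}. 1 / c t)"
          by (rule set_integral_mult_right)
        moreover have "(LBINT t:{0..T}. l\<^sup>2 * 144 / N) = l\<^sup>2 * 144 / N * T"
          using T by (simp add: set_lebesgue_integral_def)
        ultimately show ?thesis
          by (simp only:)
      qed
      also have "\<dots> / 8 \<le> l\<^sup>2 * (K / 4 + 18 * T / N)"
        using mult_left_mono[OF K, of "l\<^sup>2"] unfolding c_def by (simp add: algebra_simps)
      finally show ?thesis .
    qed
    \<comment> \<open>The bound |\<eta>| \<le> 1 is decisive here: replacing the smoothed step by
      the sharp one costs the integral of the Cauchy majorant, \<open>2 * pi * c T\<close>,
      independently of N.\<close>
    have gt: "l * (LBINT x. indicator {s<..} x * X x * \<eta> x) - \<bar>l\<bar> * (2 * pi * c T) \<le> (LBINT x. G T x * \<eta> x)"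
    proof -
      have [measurable]: "X \<in> borel_measurable borel"
        using dX by (meson DERIV_isCont borel_measurable_continuous_onI continuous_at_imp_continuous_on)
      have [measurable]: "(\<lambda>x. Phi (u T x)) \<in> borel_measurable borel"
        using Phi_x by (meson DERIV_isCont borel_measurable_continuous_onI continuous_at_imp_continuous_on)
      have X_ind: "\<bar>X x\<bar> \<le> indicator {s - N..s + N} x" for x
        using X_out[of x] X_le[of x] by (cases "x \<in> {s - N..s + N}") auto
      have b: "\<bar>f x * X x * \<eta> x\<bar> \<le> indicator {s - N..s + N} x" if "\<bar>f x\<bar> \<le> 1" for f :: "real \<Rightarrow> real" and x
      proof -
        have "\<bar>f x\<bar> * \<bar>X x\<bar> * \<bar>\<eta> x\<bar> \<le> 1 * indicator {s - N..s + N} x * 1"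
          using that X_ind \<eta>_le by (intro mult_mono) auto
        then show ?thesis
          by (simp add: abs_mult)
      qed
      have i: "integrable lborel (\<lambda>x. f x * X x * \<eta> x)" if [measurable]: "f \<in> borel_measurable borel" and "\<And>x. \<bar>f x\<bar> \<le> 1" for f
        by (rule Bochner_Integration.integrable_bound[OF integrable_indicator_Icc[of "s - N" "s + N"]])
           (use b[of f, OF that(2)] in \<open>auto intro!: AE_I2\<close>)
      have i1: "integrable lborel (\<lambda>x. Phi (u T x) * X x * \<eta> x)"
        using Phi01 by (intro i) auto
      have i2: "integrable lborel (\<lambda>x. indicator {s<..} x * X x * \<eta> x)"
        by (intro i) (auto simp: indicator_def)
      have "\<bar>(LBINT x. Phi (u T x) * X x * \<eta> x - indicator {s<..} x * X x * \<eta> x)\<bar> \<le>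
          (LBINT x. 2 * (1 / (1 + ((x - s) / c T)\<^sup>2)))"
      proof (rule abs_integral_le)
        show "integrable lborel (\<lambda>x. 2 * (1 / (1 + ((x - s) / c T)\<^sup>2)))"
          by (intro integrable_mult_right integrable_inverse_square_affine c)
        fix x
        have "0 < u T x \<longleftrightarrow> s < x"
          using c[of T] by (simp add: u_def zero_less_divide_iff)
        then have "\<bar>Phi (u T x) - indicator {s<..} x\<bar> \<le> 2 / (1 + (u T x)\<^sup>2)"
          using Phi_step_bound[of "u T x"] by (auto simp: indicator_def)
        then have "\<bar>Phi (u T x) - indicator {s<..} x\<bar> * \<bar>X x\<bar> * \<bar>\<eta> x\<bar> \<le> 2 / (1 + (u T x)\<^sup>2) * 1 * 1"
          using X_le \<eta>_le by (intro mult_mono) (auto simp: add_nonneg_nonneg)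
        then show "\<bar>Phi (u T x) * X x * \<eta> x - indicator {s<..} x * X x * \<eta> x\<bar> \<le> 2 * (1 / (1 + ((x - s) / c T)\<^sup>2))"
          by (simp add: u_def abs_mult flip: left_diff_distrib)
      qed
      also have "\<dots> = 2 * pi * c T"
        by (subst integral_mult_right_zero) (simp only: integral_inverse_square_affine[OF c] mult_ac)
      finally have "\<bar>(LBINT x. Phi (u T x) * X x * \<eta> x) - (LBINT x. indicator {s<..} x * X x * \<eta> x)\<bar> \<le> 2 * pi * c T"
        using i1 i2 by simp
      then have "\<bar>l\<bar> * \<bar>(LBINT x. Phi (u T x) * X x * \<eta> x) - (LBINT x. indicator {s<..} x * X x * \<eta> x)\<bar> \<le> \<bar>l\<bar> * (2 * pi * c T)"
        by (intro mult_left_mono) auto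
      then have "\<bar>l * (LBINT x. Phi (u T x) * X x * \<eta> x) - l * (LBINT x. indicator {s<..} x * X x * \<eta> x)\<bar> \<le> \<bar>l\<bar> * (2 * pi * c T)"
        by (simp only: abs_mult[symmetric] right_diff_distrib)
      moreover have "(LBINT x. G T x * \<eta> x) = l * (LBINT x. Phi (u T x) * X x * \<eta> x)"
        by (simp add: G_def mult.assoc)
      ultimately show ?thesis
        by linarith
    qed
    have "ereal (lfun T mu G Gt Gxx - qfun T mu Gx) \<le> I0 T mu"
      unfolding I0_def using C by (intro Sup_upper) blast
    moreover have "l * (LBINT x. indicator {s<..} x * X x * \<eta> x) - \<bar>l\<bar> * (2 * pi * c T)
      - 2 * T * (\<bar>l\<bar> * (D / 2 + 36 / N)) - l\<^sup>2 * (K / 4 + 18 * T / N) \<le> lfun T mu G Gt Gxx - qfun T mu Gx"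
      using lf qf gt by linarith
    ultimately show ?thesis
      unfolding X_def N_def by (meson ereal_less_eq(3) order_trans)
  qed
  have lim: "(\<lambda>n. LBINT x. indicator {s<..} x * bump ((x - s) / real (Suc n)) * \<eta> x) \<longlonglongrightarrow> b"
  proof (rule has_current_bump_limit)
    show "has_current \<eta> s b"
      using cur by (simp add: \<eta>_def[abs_def])
  qed (use \<eta>_le in auto)
  have inv: "(\<lambda>n. a / real (Suc n)) \<longlonglongrightarrow> 0" for a
    by (rule LIMSEQ_Suc) (rule lim_const_over_n)
  have "(\<lambda>n. ereal (l * (LBINT x. indicator {s<..} x * bump ((x - s) / real (Suc n)) * \<eta> x) - \<bar>l\<bar> * (2 * pi * c T)
      - 2 * T * (\<bar>l\<bar> * (D / 2 + 36 / real (Suc n))) - l\<^sup>2 * (K / 4 + 18 * T / real (Suc n)))) \<longlonglongrightarrow>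
      ereal (l * b - \<bar>l\<bar> * (2 * pi * c T) - 2 * T * (\<bar>l\<bar> * (D / 2 + 0)) - l\<^sup>2 * (K / 4 + 0))"
    by (intro tendsto_intros lim inv)
  then have "ereal (l * b - \<bar>l\<bar> * (2 * pi * c T) - 2 * T * (\<bar>l\<bar> * (D / 2 + 0)) - l\<^sup>2 * (K / 4 + 0)) \<le> I0 T mu"
    by (rule LIMSEQ_le_const2) (use main in blast)
  then show ?thesis
    by (simp add: c_def algebra_simps)
qed

lemma I0_quadratic_lower_bound:
  assumes g: "M1 g" and T: "0 < T"
    and mu: "\<And>t. M1 (mu t)" "AE x in lborel. mu 0 x = g x"
    and cur: "has_current (\<lambda>x. mu T x - rho g T x) s b"
  shows "ereal (b\<^sup>2 / (2 * sqrt T)) \<le> I0 T mu"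
proof -
  \<comment> \<open>The maximiser of \<open>l * b - l\<^sup>2 * sqrt T / 2\<close>, which is the
    limit of the bound below as e tends to 0: the heat residue is zero and the terminal width sqrt e
    disappears.\<close>
  define l where "l = b / sqrt T"
  have bound: "ereal (l * b - \<bar>l\<bar> * (2 * pi * sqrt e) - l\<^sup>2 * (2 * sqrt (T + e)) / 4) \<le> I0 T mu" if e: "0 < e" for e
  proof -
    \<comment> \<open>The profile bound asks for a positive, continuously differentiable \<tau> on
      the whole line; the quadratic term prevents a zero after T and changes nothing on
      [0,T].\<close>
    define \<tau> where "\<tau> t = T + e - t + max 0 (t - T) ^ 2 / e" for t
    define \<tau>' where "\<tau>' t = - 1 + 2 * max 0 (t - T) / e" for t
    have \<tau>_eq: "\<tau> t = T + e - t" "\<tau>' t = - 1" if "t \<le> T" for t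
      using that by (simp_all add: \<tau>_def \<tau>'_def max_absorb1)
    have pos: "0 < \<tau> t" for t
    proof (cases "t \<le> T")
      case True
      then show ?thesis
        using e by (simp add: \<tau>_eq)
    next
      case False
      have "0 < (e - (t - T) / 2)\<^sup>2 + 3 * (t - T)\<^sup>2 / 4"
        using False by (intro add_nonneg_pos) auto
      also have "\<dots> = e * \<tau> t"
        using False e by (simp add: \<tau>_def power2_eq_square field_simps)
      finally show ?thesis
        using e by (simp add: zero_less_mult_iff)
    qed
    have deriv: "(\<tau> has_real_derivative \<tau>' t) (at t)" for t
      unfolding \<tau>_def[abs_def] \<tau>'_def using e by (auto intro!: derivative_eq_intros)
    have cont: "continuous_on UNIV \<tau>'"
      unfolding \<tau>'_def[abs_def] using e by (auto intro!: continuous_intros)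
    have K: "(LBINT t:{0..T}. 1 / sqrt (\<tau> t)) \<le> 2 * sqrt (T + e)"
    proof -
      have "(LBINT t:{0..T}. 1 / sqrt (\<tau> t)) = (LBINT t. 1 / sqrt (T + e - t) * indicator {0..T} t)"
        unfolding set_lebesgue_integral_def
        by (rule Bochner_Integration.integral_cong[OF refl]) (auto simp: indicator_def \<tau>_eq)
      also have "\<dots> = - 2 * sqrt (T + e - T) - (- 2 * sqrt (T + e - 0))"
      proof (rule integral_FTC_Icc_real)
        fix t assume t: "0 \<le> t" "t \<le> T"
        then have "0 < T + e - t"
          using e by simp
        then show "((\<lambda>t. - 2 * sqrt (T + e - t)) has_real_derivative 1 / sqrt (T + e - t)) (at t)"
          by (auto intro!: derivative_eq_intros simp: field_simps)
        show "isCont (\<lambda>t. 1 / sqrt (T + e - t)) t"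
          using \<open>0 < T + e - t\<close> by (intro continuous_intros) auto
      qed (use T in simp)
      also have "\<dots> \<le> 2 * sqrt (T + e)"
        using e by simp
      finally show ?thesis .
    qed
    have "ereal (l * b - \<bar>l\<bar> * (2 * pi * sqrt (\<tau> T) + T * 0) - l\<^sup>2 * (2 * sqrt (T + e)) / 4) \<le> I0 T mu"
      by (rule I0_lower_bound_profile[OF g T mu cur pos deriv cont _ K]) (simp add: \<tau>_eq)
    then show ?thesis
      by (simp add: \<tau>_eq)
  qed
  have inv: "(\<lambda>n. 1 / real (Suc n)) \<longlonglongrightarrow> 0"
    by (rule LIMSEQ_Suc) (rule lim_const_over_n)
  have "(\<lambda>n. ereal (l * b - \<bar>l\<bar> * (2 * pi * sqrt (1 / real (Suc n))) - l\<^sup>2 * (2 * sqrt (T + 1 / real (Suc n))) / 4)) \<longlonglongrightarrow>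
      ereal (l * b - \<bar>l\<bar> * (2 * pi * sqrt 0) - l\<^sup>2 * (2 * sqrt (T + 0)) / 4)"
    by (intro tendsto_intros inv) auto
  then have "ereal (l * b - \<bar>l\<bar> * (2 * pi * sqrt 0) - l\<^sup>2 * (2 * sqrt (T + 0)) / 4) \<le> I0 T mu"
    by (rule LIMSEQ_le_const2) (use bound[of "1 / real (Suc n)" for n] in \<open>auto simp del: of_nat_Suc\<close>)
  moreover have "l * b - \<bar>l\<bar> * (2 * pi * sqrt 0) - l\<^sup>2 * (2 * sqrt (T + 0)) / 4 = b\<^sup>2 / (2 * sqrt T)"
    using T by (simp add: l_def power_divide power2_eq_square field_simps)
  ultimately show ?thesis
    by simp
qed

text \<open>A step of constant width R costs energy of order \<open>l\<^sup>2 * T / R\<close> and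
  leaves a heat residue \<open>\<bar>l\<bar> * T / R\<close>. With R proportional to |b| both permit
  l of order \<open>b\<^sup>2 / T\<close>, which makes the gain \<open>l * b\<close> cubic.\<close>

lemma I0_cubic_lower_bound:
  assumes g: "M1 g" and T: "0 < T"
    and mu: "\<And>t. M1 (mu t)" "AE x in lborel. mu 0 x = g x"
    and cur: "has_current (\<lambda>x. mu T x - rho g T x) s b"
    and b: "128 * T \<le> b\<^sup>2"
  shows "ereal (\<bar>b\<bar> ^ 3 / (128 * T)) \<le> I0 T mu"
proof -
  define B where "B = \<bar>b\<bar>"
  have B: "0 < B" "B\<^sup>2 = b\<^sup>2"
    using b T by (auto simp: B_def)
  \<comment> \<open>As pi < 4, the smoothing error \<open>2 * pi * R\<close> is at most |b|/2, so
    half of the gain is left.\<close>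
  define R where "R = B / 16"
  have R: "0 < R"
    using B by (simp add: R_def)
  define l where "l = sgn b * B\<^sup>2 / (16 * T)"
  have l: "l * b = B ^ 3 / (16 * T)" "\<bar>l\<bar> = B\<^sup>2 / (16 * T)" "l\<^sup>2 = B ^ 4 / (256 * T\<^sup>2)"
    using T B by (auto simp: l_def abs_mult abs_sgn_eq B_def power_divide power_mult_distrib sgn_if power3_eq_cube power2_eq_square power4_eq_xxxx)
  have "ereal (l * b - \<bar>l\<bar> * (2 * pi * sqrt (R\<^sup>2) + T * (1 / R)) - l\<^sup>2 * (T / R) / 4) \<le> I0 T mu"
    by (rule I0_lower_bound_profile[OF g T mu cur, where \<tau>'="\<lambda>t. 0"])
       (use R T in \<open>auto simp: set_lebesgue_integral_def\<close>)
  moreover have "B ^ 3 / (128 * T) \<le> l * b - \<bar>l\<bar> * (2 * pi * sqrt (R\<^sup>2) + T * (1 / R)) - l\<^sup>2 * (T / R) / 4"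
  proof -
    have "pi * B \<le> 4 * B"
      using pi_less_4 B by (intro mult_right_mono) auto
    moreover have "sqrt (R\<^sup>2) = B / 16"
      using R by (simp add: R_def)
    ultimately have "2 * pi * sqrt (R\<^sup>2) + T * (1 / R) \<le> B / 2 + 16 * T / B"
      by (simp add: R_def mult_ac)
    then have "\<bar>l\<bar> * (2 * pi * sqrt (R\<^sup>2) + T * (1 / R)) \<le> \<bar>l\<bar> * (B / 2 + 16 * T / B)"
      by (intro mult_left_mono) auto
    also have "\<dots> = B ^ 3 / (32 * T) + B"
      unfolding l(2) using B(1) T by (simp add: field_simps power2_eq_square power3_eq_cube)
    finally have 1: "\<bar>l\<bar> * (2 * pi * sqrt (R\<^sup>2) + T * (1 / R)) \<le> B ^ 3 / (32 * T) + B" .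
    have 2: "l\<^sup>2 * (T / R) / 4 = B ^ 3 / (64 * T)"
      unfolding l(3) R_def using B(1) T by (simp add: field_simps power2_eq_square power3_eq_cube power4_eq_xxxx)
    have "B * (128 * T) \<le> B * B\<^sup>2"
      using b B by (intro mult_left_mono) auto
    then have 3: "B \<le> B ^ 3 / (128 * T)"
      using T by (simp add: le_divide_eq power2_eq_square power3_eq_cube)
    \<comment> \<open>In units of \<open>B ^ 3 / (128 * T)\<close>: gain 8, smoothing error at most
      4, energy 2, heat residue B at most 1 by the assumption on b. At least one unit
      remains.\<close>
    have 4: "B ^ 3 / (16 * T) = 8 * (B ^ 3 / (128 * T))" "B ^ 3 / (32 * T) = 4 * (B ^ 3 / (128 * T))" "B ^ 3 / (64 * T) = 2 * (B ^ 3 / (128 * T))"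
      by simp_all
    show ?thesis
      using 1 3 unfolding 2 l(1) 4 by linarith
  qed
  ultimately show ?thesis
    unfolding B_def by (meson ereal_less_eq(3) order_trans)
qed

section \<open>The rate functions\<close>

lemma has_current_add:
  assumes "bounded_measurable f" "bounded_measurable h" "has_current f s b" "has_current h s c"
  shows "has_current (\<lambda>x. f x + h x) s (b + c)"
proof -
  have "(LBINT x=ereal s..ereal L. f x + h x) = (LBINT x=ereal s..ereal L. f x) + (LBINT x=ereal s..ereal L. h x)" for L
    using assms by (intro interval_lebesgue_integral_add interval_integrable_bounded_measurable)
  then show ?thesis
    using assms(3,4) unfolding has_current_def by (simp add: tendsto_add)
qed

lemma hent_self: "hent g g = 0"
proof -
  have "bent p p = 0" for p
    by (simp add: bent_def)
  then show ?thesis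
    by (simp add: hent_def zero_ennreal.rep_eq)
qed

text \<open>The entropy of \<open>g\<close> relative to itself is 0, so a path that starts exactly
  at \<open>g\<close> has the same cost under both initial conditions.\<close>

lemma Igam_eq_I0:
  assumes "density T mu" "mu 0 = g"
  shows "Igam m T g mu = I0 T mu"
  using assms by (cases m) (simp_all add: Igam_def hent_self)

lemma density_M1: "density T mu \<Longrightarrow> M1 (mu t)"
  by (simp add: density_def)

lemma Jrate_le:
  assumes g: "M1_bc rl rr g" and T: "0 < T" and mu: "density T mu" "mu 0 = g"
    and cur: "has_current (\<lambda>x. mu T x - rho g T x) 0 (a - vT T g)" and le: "I0 T mu \<le> ereal c"
  shows "Jrate m T g a \<le> ereal c"
proof -
  have M: "M1 g"
    using g by (simp add: M1_bc_def)
  have "has_current (\<lambda>x. (mu T x - rho g T x) + (rho g T x - g x)) 0 (a - vT T g + vT T g)"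
    by (intro has_current_add cur has_current_vT[OF g T] bounded_measurable_diff bounded_measurable_M1 M1_rho M density_M1[OF mu(1)])
  then have "has_current (\<lambda>x. mu T x - mu 0 x) 0 a"
    by (simp add: mu(2))
  moreover have I: "Igam m T g mu \<le> ereal c"
    using Igam_eq_I0[OF mu] le by simp
  moreover have "Igam m T g mu < \<infinity>"
    using I by (rule order_le_less_trans) simp
  ultimately have "Jrate m T g a \<le> Igam m T g mu"
    unfolding Jrate_def has_current_def by (intro Inf_lower) blast
  then show ?thesis
    using I by (rule order_trans)
qed

text \<open>Moving the base point from 0 to a turns the tagged-particle constraint into a current of
  \<open>mu T - g\<close> through a equal to the integral of \<open>g\<close> over [0,a].
  Subtracting the heat flow's current through a leaves the stated excess over
  \<open>rho g T\<close>.\<close>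

lemma Irate_le:
  assumes g: "M1_bc rl rr g" and T: "0 < T" and mu: "density T mu" "mu 0 = g"
    and cur: "has_current (\<lambda>x. mu T x - rho g T x) a ((LBINT x=ereal 0..ereal a. rho g T x) - vT T g)"
    and le: "I0 T mu \<le> ereal c"
  shows "Irate m T g a \<le> ereal c"
proof -
  have M: "M1 g"
    using g by (simp add: M1_bc_def)
  have bm: "bounded_measurable g" "bounded_measurable (rho g T)" "bounded_measurable (mu T)"
    by (intro bounded_measurable_M1 M1_rho M density_M1[OF mu(1)])+
  note bmd = bounded_measurable_diff[OF bm(2,1)] bounded_measurable_diff[OF bm(3,1)] bounded_measurable_diff[OF bm(3,2)]
  have 1: "has_current (\<lambda>x. rho g T x - g x) a (vT T g - (LBINT x=ereal 0..ereal a. rho g T x - g x))"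
    by (rule has_current_shift[OF bmd(1) has_current_vT[OF g T]])
  have "has_current (\<lambda>x. (mu T x - rho g T x) + (rho g T x - g x)) a
      ((LBINT x=ereal 0..ereal a. rho g T x) - vT T g + (vT T g - (LBINT x=ereal 0..ereal a. rho g T x - g x)))"
    by (rule has_current_add[OF bmd(3,1) cur 1])
  then have "has_current (\<lambda>x. mu T x - g x) a (LBINT x=ereal 0..ereal a. g x)"
    by (simp add: interval_integral_diff_bm[OF bm(2,1)])
  from has_current_shift[OF bmd(2) this, of 0]
  have "has_current (\<lambda>x. mu T x - g x) 0 ((LBINT x=ereal 0..ereal a. g x) - (LBINT x=ereal a..ereal 0. mu T x - g x))" .
  also have "(LBINT x=ereal 0..ereal a. g x) - (LBINT x=ereal a..ereal 0. mu T x - g x) = (LBINT x=ereal 0..ereal a. mu T x)"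
    by (subst interval_integral_endpoints_reverse) (simp only: interval_integral_diff_bm[OF bm(3,1)] algebra_simps)
  finally have "has_current (\<lambda>x. mu T x - mu 0 x) 0 (LBINT x=ereal 0..ereal a. mu T x)"
    by (simp only: mu(2))
  moreover have I: "Igam m T g mu \<le> ereal c"
    using Igam_eq_I0[OF mu] le by simp
  moreover have "Igam m T g mu < \<infinity>"
    using I by (rule order_le_less_trans) simp
  ultimately have "Irate m T g a \<le> Igam m T g mu"
    unfolding Irate_def has_current_def by (intro Inf_lower) blast
  then show ?thesis
    using I by (rule order_trans)
qed

lemma Igam_DIC_finite:
  assumes "Igam DIC T g mu < \<infinity>"
  shows "density T mu" "AE x in lborel. mu 0 x = g x" "Igam DIC T g mu = I0 T mu"
  using assms by (auto simp: Igam_def split: if_splits)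

lemma Jrate_DIC_ge:
  assumes g: "M1_bc rl rr g" and T: "0 < T"
    and le: "\<And>mu. density T mu \<Longrightarrow> AE x in lborel. mu 0 x = g x \<Longrightarrow>
      has_current (\<lambda>x. mu T x - rho g T x) 0 (a - vT T g) \<Longrightarrow> ereal c \<le> I0 T mu"
  shows "ereal c \<le> Jrate DIC T g a"
  unfolding Jrate_def
proof (rule Inf_greatest, clarify)
  fix mu
  assume fin: "Igam DIC T g mu < \<infinity>"
    and lim: "((\<lambda>L. LBINT x=ereal 0..ereal L. mu T x - mu 0 x) \<longlongrightarrow> a) at_top"
  note mu = Igam_DIC_finite[OF fin]
  have M: "M1 g"
    using g by (simp add: M1_bc_def)
  have bm: "bounded_measurable g" "bounded_measurable (rho g T)" "bounded_measurable (mu T)" "bounded_measurable (mu 0)"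
    by (intro bounded_measurable_M1 M1_rho M density_M1[OF mu(1)])+
  have cur: "has_current (\<lambda>x. mu T x - mu 0 x) 0 a"
    using lim by (simp only: has_current_def)
  have "AE x in lborel. mu T x - mu 0 x = mu T x - g x"
    using mu(2) by eventually_elim simp
  then have "has_current (\<lambda>x. mu T x - g x) 0 a"
    by (rule has_current_AE_cong[OF bounded_measurable_diff[OF bm(3,4)] bounded_measurable_diff[OF bm(3,1)] _ cur])
  then have "has_current (\<lambda>x. (mu T x - g x) - (rho g T x - g x)) 0 (a - vT T g)"
    by (rule has_current_diff[OF bounded_measurable_diff[OF bm(3,1)] bounded_measurable_diff[OF bm(2,1)] _ has_current_vT[OF g T]])
  then show "ereal c \<le> Igam DIC T g mu"
    unfolding mu(3) using mu(1,2) by (intro le) simp_all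
qed

text \<open>The computation of \<open>Irate_le\<close> run backwards; initial data agree only almost
  everywhere, hence the passage from \<open>mu 0\<close> to \<open>g\<close> under the
  integral.\<close>

lemma Irate_DIC_ge:
  assumes g: "M1_bc rl rr g" and T: "0 < T"
    and le: "\<And>mu. density T mu \<Longrightarrow> AE x in lborel. mu 0 x = g x \<Longrightarrow>
      has_current (\<lambda>x. mu T x - rho g T x) a ((LBINT x=ereal 0..ereal a. rho g T x) - vT T g) \<Longrightarrow> ereal c \<le> I0 T mu"
  shows "ereal c \<le> Irate DIC T g a"
  unfolding Irate_def
proof (rule Inf_greatest, clarify)
  fix mu
  assume fin: "Igam DIC T g mu < \<infinity>"
    and lim: "((\<lambda>L. LBINT x=ereal 0..ereal L. mu T x - mu 0 x) \<longlongrightarrow> (LBINT x=ereal 0..ereal a. mu T x)) at_top"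
  note mu = Igam_DIC_finite[OF fin]
  have M: "M1 g"
    using g by (simp add: M1_bc_def)
  have bm: "bounded_measurable g" "bounded_measurable (rho g T)" "bounded_measurable (mu T)" "bounded_measurable (mu 0)"
    by (intro bounded_measurable_M1 M1_rho M density_M1[OF mu(1)])+
  have cur: "has_current (\<lambda>x. mu T x - mu 0 x) 0 (LBINT x=ereal 0..ereal a. mu T x)"
    using lim by (simp only: has_current_def)
  have "AE x in lborel. mu T x - mu 0 x = mu T x - g x"
    using mu(2) by eventually_elim simp
  then have "has_current (\<lambda>x. mu T x - g x) 0 (LBINT x=ereal 0..ereal a. mu T x)"
    by (rule has_current_AE_cong[OF bounded_measurable_diff[OF bm(3,4)] bounded_measurable_diff[OF bm(3,1)] _ cur])
  then have "has_current (\<lambda>x. (mu T x - g x) - (rho g T x - g x)) 0 ((LBINT x=ereal 0..ereal a. mu T x) - vT T g)"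
    by (rule has_current_diff[OF bounded_measurable_diff[OF bm(3,1)] bounded_measurable_diff[OF bm(2,1)] _ has_current_vT[OF g T]])
  then have "has_current (\<lambda>x. mu T x - rho g T x) 0 ((LBINT x=ereal 0..ereal a. mu T x) - vT T g)"
    by simp
  from has_current_shift[OF bounded_measurable_diff[OF bm(3,2)] this, of a]
  have "has_current (\<lambda>x. mu T x - rho g T x) a ((LBINT x=ereal 0..ereal a. rho g T x) - vT T g)"
    unfolding interval_integral_diff_bm[OF bm(3,2)] by simp
  then show "ereal c \<le> Igam DIC T g mu"
    unfolding mu(3) by (intro le mu)
qed

section \<open>Asymptotics\<close>

text \<open>One bound serves both regimes. Within distance 1 of v the last factor is at most 2. For
  |a| at least 1 + |v|, \<open>\<bar>a - v\<bar>\<close> is at most 2|a| and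
  \<open>1 + \<bar>a - v\<bar>\<close> at most 3|a|, giving 4 * 3 = 12.\<close>

lemma rate_Limsup_bounds:
  fixes R :: "real \<Rightarrow> ereal"
  assumes "0 < T" "0 < C" and R: "\<And>a. R a \<le> ereal (C * (a - v)\<^sup>2 * (1 + \<bar>a - v\<bar>))"
  shows "Limsup (at v) (\<lambda>a. ereal (sqrt T / (a - v)\<^sup>2) * R a) \<le> ereal (2 * sqrt T * C)"
    and "Limsup at_infinity (\<lambda>a. ereal (T / \<bar>a\<bar> ^ 3) * R a) \<le> ereal (12 * T * C)"
proof -
  show "Limsup (at v) (\<lambda>a. ereal (sqrt T / (a - v)\<^sup>2) * R a) \<le> ereal (2 * sqrt T * C)"
  proof (rule Limsup_bounded)
    have "\<forall>\<^sub>F a in at v. a \<noteq> v \<and> dist a v < 1"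
      by (auto simp: eventually_at intro: exI[of _ 1])
    then show "\<forall>\<^sub>F a in at v. ereal (sqrt T / (a - v)\<^sup>2) * R a \<le> ereal (2 * sqrt T * C)"
    proof eventually_elim
      case (elim a)
      have "ereal (sqrt T / (a - v)\<^sup>2) * R a \<le> ereal (sqrt T / (a - v)\<^sup>2) * ereal (C * (a - v)\<^sup>2 * (1 + \<bar>a - v\<bar>))"
        using \<open>0 < T\<close> by (intro ereal_mult_left_mono R) simp
      also have "\<dots> = ereal (sqrt T * C * (1 + \<bar>a - v\<bar>))"
        using elim by simp
      also have "\<dots> \<le> ereal (sqrt T * C * 2)"
        using elim assms by (intro ereal_less_eq(3)[THEN iffD2] mult_left_mono) (auto simp: dist_real_def)
      finally show ?case
        by (simp add: mult_ac)
    qed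
  qed
  show "Limsup at_infinity (\<lambda>a. ereal (T / \<bar>a\<bar> ^ 3) * R a) \<le> ereal (12 * T * C)"
  proof (rule Limsup_bounded)
    have "\<forall>\<^sub>F a in at_infinity. 1 + \<bar>v\<bar> \<le> \<bar>a::real\<bar>"
      by (auto simp: eventually_at_infinity)
    then show "\<forall>\<^sub>F a in at_infinity. ereal (T / \<bar>a\<bar> ^ 3) * R a \<le> ereal (12 * T * C)"
    proof eventually_elim
      case (elim a)
      have a: "0 < \<bar>a\<bar>" "\<bar>a - v\<bar> \<le> 2 * \<bar>a\<bar>" "1 + \<bar>a - v\<bar> \<le> 3 * \<bar>a\<bar>"
        using elim by linarith+
      have "(a - v)\<^sup>2 \<le> (2 * \<bar>a\<bar>)\<^sup>2"
        using power_mono[OF a(2), of 2] by simp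
      then have "(a - v)\<^sup>2 * (1 + \<bar>a - v\<bar>) \<le> (2 * \<bar>a\<bar>)\<^sup>2 * (3 * \<bar>a\<bar>)"
        using a by (intro mult_mono) auto
      then have le: "C * (a - v)\<^sup>2 * (1 + \<bar>a - v\<bar>) \<le> 12 * C * \<bar>a\<bar> ^ 3"
        using \<open>0 < C\<close> mult_left_mono[of "(a - v)\<^sup>2 * (1 + \<bar>a - v\<bar>)" "(2 * \<bar>a\<bar>)\<^sup>2 * (3 * \<bar>a\<bar>)" C]
        by (simp add: power2_eq_square power3_eq_cube mult_ac)
      have "ereal (T / \<bar>a\<bar> ^ 3) * R a \<le> ereal (T / \<bar>a\<bar> ^ 3) * ereal (12 * C * \<bar>a\<bar> ^ 3)"
        using \<open>0 < T\<close> le by (intro ereal_mult_left_mono order_trans[OF R]) simp_all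
      also have "\<dots> = ereal (12 * T * C)"
        using a(1) by simp
      finally show ?case .
    qed
  qed
qed

text \<open>Once |a| exceeds 2|v|, the distance to v is at least |a|/2; its cube accounts for the
  8.\<close>

lemma rate_Liminf_bounds:
  fixes R :: "real \<Rightarrow> ereal"
  assumes "0 < T" "0 < k" and R2: "\<And>a. ereal (k * (a - v)\<^sup>2) \<le> R a"
    and R3: "\<And>a. B \<le> \<bar>a - v\<bar> \<Longrightarrow> ereal (k * \<bar>a - v\<bar> ^ 3) \<le> R a"
  shows "ereal (sqrt T * k) \<le> Liminf (at v) (\<lambda>a. ereal (sqrt T / (a - v)\<^sup>2) * R a)"
    and "ereal (T * k / 8) \<le> Liminf at_infinity (\<lambda>a. ereal (T / \<bar>a\<bar> ^ 3) * R a)"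
proof -
  show "ereal (sqrt T * k) \<le> Liminf (at v) (\<lambda>a. ereal (sqrt T / (a - v)\<^sup>2) * R a)"
  proof (rule Liminf_bounded)
    have "\<forall>\<^sub>F a in at v. a \<noteq> v"
      by (auto simp: eventually_at intro: exI[of _ 1])
    then show "\<forall>\<^sub>F a in at v. ereal (sqrt T * k) \<le> ereal (sqrt T / (a - v)\<^sup>2) * R a"
    proof eventually_elim
      case (elim a)
      then have "ereal (sqrt T * k) = ereal (sqrt T / (a - v)\<^sup>2) * ereal (k * (a - v)\<^sup>2)"
        by simp
      also have "\<dots> \<le> ereal (sqrt T / (a - v)\<^sup>2) * R a"
        using \<open>0 < T\<close> by (intro ereal_mult_left_mono R2) simp
      finally show ?case .
    qed
  qed
  show "ereal (T * k / 8) \<le> Liminf at_infinity (\<lambda>a. ereal (T / \<bar>a\<bar> ^ 3) * R a)"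
  proof (rule Liminf_bounded)
    have "\<forall>\<^sub>F a in at_infinity. 1 + 2 * \<bar>v\<bar> + 2 * \<bar>B\<bar> \<le> \<bar>a::real\<bar>"
      by (auto simp: eventually_at_infinity)
    then show "\<forall>\<^sub>F a in at_infinity. ereal (T * k / 8) \<le> ereal (T / \<bar>a\<bar> ^ 3) * R a"
    proof eventually_elim
      case (elim a)
      have a: "0 < \<bar>a\<bar>" "\<bar>a\<bar> / 2 \<le> \<bar>a - v\<bar>" "B \<le> \<bar>a - v\<bar>"
        using elim by linarith+
      have "(\<bar>a\<bar> / 2) ^ 3 \<le> \<bar>a - v\<bar> ^ 3"
        using a by (intro power_mono) auto
      then have "k * (\<bar>a\<bar> / 2) ^ 3 \<le> k * \<bar>a - v\<bar> ^ 3"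
        using \<open>0 < k\<close> by (intro mult_left_mono) auto
      then have le: "ereal (k * (\<bar>a\<bar> / 2) ^ 3) \<le> R a"
        using R3[OF a(3)] by (meson ereal_less_eq(3) order_trans)
      have "ereal (T * k / 8) = ereal (T / \<bar>a\<bar> ^ 3) * ereal (k * (\<bar>a\<bar> / 2) ^ 3)"
        using a(1) by (simp add: power_divide)
      also have "\<dots> \<le> ereal (T / \<bar>a\<bar> ^ 3) * R a"
        using \<open>0 < T\<close> le by (intro ereal_mult_left_mono) simp_all
      finally show ?case .
    qed
  qed
qed

lemma admissible_M1_bc: "admissible m rl rr g \<Longrightarrow> M1_bc rl rr g"
  by (cases m) (auto simp: admissible_def LEM_profile_def DIC_profile_def)

theorem theorem1p2:
  fixes T rl rr :: real and g :: "real \<Rightarrow> real"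
  assumes "T > 0" and "0 < rl" and "rl < 1" and "0 < rr" and "rr < 1"
  shows "(\<forall>m. admissible m rl rr g \<longrightarrow> (\<exists>c1::real.
            Limsup (at (vT T g)) (\<lambda>a. ereal (sqrt T / (a - vT T g)\<^sup>2) * Jrate m T g a) \<le> ereal c1 \<and>
            Limsup at_infinity (\<lambda>a. ereal (T / \<bar>a\<bar> ^ 3) * Jrate m T g a) \<le> ereal c1 \<and>
            Limsup (at (uT T g)) (\<lambda>a. ereal (sqrt T / (a - uT T g)\<^sup>2) * Irate m T g a) \<le> ereal c1 \<and>
            Limsup at_infinity (\<lambda>a. ereal (T / \<bar>a\<bar> ^ 3) * Irate m T g a) \<le> ereal c1))
       \<and> (DIC_profile rl rr g \<longrightarrow> (\<exists>c2::real. c2 > 0 \<and>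
            Liminf (at (vT T g)) (\<lambda>a. ereal (sqrt T / (a - vT T g)\<^sup>2) * Jrate DIC T g a) \<ge> ereal c2 \<and>
            Liminf at_infinity (\<lambda>a. ereal (T / \<bar>a\<bar> ^ 3) * Jrate DIC T g a) \<ge> ereal c2 \<and>
            Liminf (at (uT T g)) (\<lambda>a. ereal (sqrt T / (a - uT T g)\<^sup>2) * Irate DIC T g a) \<ge> ereal c2 \<and>
            Liminf at_infinity (\<lambda>a. ereal (T / \<bar>a\<bar> ^ 3) * Irate DIC T g a) \<ge> ereal c2))"
proof (intro conjI allI impI)
  fix m assume "admissible m rl rr g"
  then have g: "M1_bc rl rr g"
    by (rule admissible_M1_bc)
  then have M: "M1 g"
    by (simp add: M1_bc_def)
  obtain \<delta> where \<delta>: "0 < \<delta>" "\<And>t x. T / 2 \<le> t \<Longrightarrow> \<delta> \<le> rho g t x \<and> rho g t x \<le> 1 - \<delta>"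
    using rho_two_sided_bound[OF g, of "T / 2"] assms by auto
  have \<delta>T: "\<delta> \<le> rho g T x" for x
    using \<delta>(2)[of T x] \<open>0 < T\<close> by simp
  obtain C where C: "0 < C" "\<And>s b. \<exists>mu. density T mu \<and> mu 0 = g \<and> has_current (\<lambda>x. mu T x - rho g T x) s b \<and>
      I0 T mu \<le> ereal (C * b\<^sup>2 * (1 + \<bar>b\<bar>))"
    using cheap_path_exists[OF M \<open>0 < T\<close> \<delta>] by blast
  have J: "Jrate m T g a \<le> ereal (C * (a - vT T g)\<^sup>2 * (1 + \<bar>a - vT T g\<bar>))" for a
    using C(2)[of 0 "a - vT T g"] Jrate_le[OF g \<open>0 < T\<close>] by blast
  have I: "Irate m T g a \<le> ereal (C * (a - uT T g)\<^sup>2 * (1 + \<bar>a - uT T g\<bar>))" for a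
  proof -
    define b where "b = (LBINT x=ereal 0..ereal a. rho g T x) - vT T g"
    have "Irate m T g a \<le> ereal (C * b\<^sup>2 * (1 + \<bar>b\<bar>))"
      using C(2)[of a b] Irate_le[OF g \<open>0 < T\<close>] unfolding b_def by blast
    moreover have b: "\<bar>b\<bar> \<le> \<bar>a - uT T g\<bar>"
      unfolding b_def by (rule uT_estimate(2)[OF g \<open>0 < T\<close> \<delta>(1) \<delta>T])
    then have "b\<^sup>2 \<le> (a - uT T g)\<^sup>2"
      by (simp add: abs_le_square_iff)
    then have "C * b\<^sup>2 * (1 + \<bar>b\<bar>) \<le> C * (a - uT T g)\<^sup>2 * (1 + \<bar>a - uT T g\<bar>)"
      using b C(1) by (intro mult_mono) auto
    ultimately show ?thesis
      by (meson ereal_less_eq(3) order_trans)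
  qed
  define c where "c = max (2 * sqrt T * C) (12 * T * C)"
  have c: "ereal (2 * sqrt T * C) \<le> ereal c" "ereal (12 * T * C) \<le> ereal c"
    unfolding ereal_less_eq(3) c_def by linarith+
  note J_lim = rate_Limsup_bounds[OF \<open>0 < T\<close> C(1) J]
  note I_lim = rate_Limsup_bounds[OF \<open>0 < T\<close> C(1) I]
  show "\<exists>c1::real. Limsup (at (vT T g)) (\<lambda>a. ereal (sqrt T / (a - vT T g)\<^sup>2) * Jrate m T g a) \<le> ereal c1 \<and>
      Limsup at_infinity (\<lambda>a. ereal (T / \<bar>a\<bar> ^ 3) * Jrate m T g a) \<le> ereal c1 \<and>
      Limsup (at (uT T g)) (\<lambda>a. ereal (sqrt T / (a - uT T g)\<^sup>2) * Irate m T g a) \<le> ereal c1 \<and>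
      Limsup at_infinity (\<lambda>a. ereal (T / \<bar>a\<bar> ^ 3) * Irate m T g a) \<le> ereal c1"
    by (intro exI[of _ c] conjI order_trans[OF J_lim(1) c(1)] order_trans[OF J_lim(2) c(2)]
        order_trans[OF I_lim(1) c(1)] order_trans[OF I_lim(2) c(2)])
next
  assume "DIC_profile rl rr g"
  then have g: "M1_bc rl rr g"
    by (simp add: DIC_profile_def)
  then have M: "M1 g"
    by (simp add: M1_bc_def)
  obtain \<delta> where \<delta>: "0 < \<delta>" "\<And>x. \<delta> \<le> rho g T x"
    using rho_lower_bound[OF g, of T] assms by auto
  \<comment> \<open>A common constant below those of the quadratic and the cubic lower
    bound.\<close>
  define k where "k = min (1 / (2 * sqrt T)) (1 / (128 * T))"
  have k: "0 < k" "k * b\<^sup>2 \<le> b\<^sup>2 / (2 * sqrt T)" "k * \<bar>b\<bar> ^ 3 \<le> \<bar>b\<bar> ^ 3 / (128 * T)" for b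
    using \<open>0 < T\<close> mult_right_mono[of k "1 / (2 * sqrt T)" "b\<^sup>2"] mult_right_mono[of k "1 / (128 * T)" "\<bar>b\<bar> ^ 3"]
    by (auto simp: k_def)
  have low: "ereal (k * b\<^sup>2) \<le> I0 T mu" "sqrt (128 * T) \<le> \<bar>b\<bar> \<Longrightarrow> ereal (k * \<bar>b\<bar> ^ 3) \<le> I0 T mu"
    if "density T mu" "AE x in lborel. mu 0 x = g x" "has_current (\<lambda>x. mu T x - rho g T x) s b" for mu s b
  proof -
    note lower = M \<open>0 < T\<close> density_M1[OF that(1)] that(2,3)
    show "ereal (k * b\<^sup>2) \<le> I0 T mu"
      using I0_quadratic_lower_bound[OF lower] k(2) by (meson ereal_less_eq(3) order_trans)
    assume "sqrt (128 * T) \<le> \<bar>b\<bar>"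
    then have "128 * T \<le> b\<^sup>2"
      by (simp add: real_sqrt_le_iff flip: real_sqrt_abs)
    then show "ereal (k * \<bar>b\<bar> ^ 3) \<le> I0 T mu"
      using I0_cubic_lower_bound[OF lower] k(3) by (meson ereal_less_eq(3) order_trans)
  qed
  have J: "ereal (k * (a - vT T g)\<^sup>2) \<le> Jrate DIC T g a"
    "sqrt (128 * T) \<le> \<bar>a - vT T g\<bar> \<Longrightarrow> ereal (k * \<bar>a - vT T g\<bar> ^ 3) \<le> Jrate DIC T g a" for a
    using low by (intro Jrate_DIC_ge[OF g \<open>0 < T\<close>]; blast)+
  \<comment> \<open>The excess is at least \<delta> times the distance from \<open>uT\<close>;
    squaring and cubing this gives the two factors, and the threshold on the distance grows by
    1/\<delta>.\<close>
  define d where "d = k * min (\<delta>\<^sup>2) (\<delta> ^ 3)"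
  have d: "0 < d" "d \<le> k * \<delta>\<^sup>2" "d \<le> k * \<delta> ^ 3"
    using k(1) \<delta>(1) by (auto simp: d_def)
  have I: "ereal (d * (a - uT T g)\<^sup>2) \<le> Irate DIC T g a"
    "sqrt (128 * T) / \<delta> \<le> \<bar>a - uT T g\<bar> \<Longrightarrow> ereal (d * \<bar>a - uT T g\<bar> ^ 3) \<le> Irate DIC T g a" for a
  proof -
    define b where "b = (LBINT x=ereal 0..ereal a. rho g T x) - vT T g"
    have b: "\<delta> * \<bar>a - uT T g\<bar> \<le> \<bar>b\<bar>"
      unfolding b_def by (rule uT_estimate(1)[OF g \<open>0 < T\<close> \<delta>])
    have b0: "0 \<le> \<delta> * \<bar>a - uT T g\<bar>"
      using \<delta>(1) by simp
    have "d * (a - uT T g)\<^sup>2 \<le> k * \<delta>\<^sup>2 * (a - uT T g)\<^sup>2"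
      using d by (intro mult_right_mono) auto
    also have "\<dots> = k * (\<delta> * \<bar>a - uT T g\<bar>)\<^sup>2"
      by (simp add: power_mult_distrib)
    also have "\<dots> \<le> k * b\<^sup>2"
      using k(1) power_mono[OF b b0, of 2] by (intro mult_left_mono) auto
    finally have 2: "d * (a - uT T g)\<^sup>2 \<le> k * b\<^sup>2" .
    have "ereal (k * b\<^sup>2) \<le> Irate DIC T g a"
      using low(1) unfolding b_def by (intro Irate_DIC_ge[OF g \<open>0 < T\<close>]) blast
    with 2 show "ereal (d * (a - uT T g)\<^sup>2) \<le> Irate DIC T g a"
      by (meson ereal_less_eq(3) order_trans)
    assume "sqrt (128 * T) / \<delta> \<le> \<bar>a - uT T g\<bar>"
    then have "sqrt (128 * T) \<le> \<delta> * \<bar>a - uT T g\<bar>"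
      using \<delta>(1) by (simp add: pos_divide_le_eq mult.commute)
    then have big: "sqrt (128 * T) \<le> \<bar>b\<bar>"
      using b by linarith
    have "d * \<bar>a - uT T g\<bar> ^ 3 \<le> k * \<delta> ^ 3 * \<bar>a - uT T g\<bar> ^ 3"
      using d by (intro mult_right_mono) auto
    also have "\<dots> = k * (\<delta> * \<bar>a - uT T g\<bar>) ^ 3"
      by (simp add: power_mult_distrib)
    also have "\<dots> \<le> k * \<bar>b\<bar> ^ 3"
      using k(1) power_mono[OF b b0, of 3] by (intro mult_left_mono) auto
    finally have 3: "d * \<bar>a - uT T g\<bar> ^ 3 \<le> k * \<bar>b\<bar> ^ 3" .
    have "ereal (k * \<bar>b\<bar> ^ 3) \<le> Irate DIC T g a"
      using low(2) big unfolding b_def by (intro Irate_DIC_ge[OF g \<open>0 < T\<close>]) blast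
    with 3 show "ereal (d * \<bar>a - uT T g\<bar> ^ 3) \<le> Irate DIC T g a"
      by (meson ereal_less_eq(3) order_trans)
  qed
  define c where "c = min (min (sqrt T * k) (T * k / 8)) (min (sqrt T * d) (T * d / 8))"
  have c: "ereal c \<le> ereal (sqrt T * k)" "ereal c \<le> ereal (T * k / 8)"
    "ereal c \<le> ereal (sqrt T * d)" "ereal c \<le> ereal (T * d / 8)"
    unfolding ereal_less_eq(3) c_def by linarith+
  note J_lim = rate_Liminf_bounds[OF \<open>0 < T\<close> k(1), of "vT T g" "Jrate DIC T g" "sqrt (128 * T)", OF J]
  note I_lim = rate_Liminf_bounds[OF \<open>0 < T\<close> d(1), of "uT T g" "Irate DIC T g" "sqrt (128 * T) / \<delta>", OF I]
  have "0 < c"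
    using \<open>0 < T\<close> k(1) d(1) by (simp add: c_def)
  then show "\<exists>c2::real. c2 > 0 \<and>
      Liminf (at (vT T g)) (\<lambda>a. ereal (sqrt T / (a - vT T g)\<^sup>2) * Jrate DIC T g a) \<ge> ereal c2 \<and>
      Liminf at_infinity (\<lambda>a. ereal (T / \<bar>a\<bar> ^ 3) * Jrate DIC T g a) \<ge> ereal c2 \<and>
      Liminf (at (uT T g)) (\<lambda>a. ereal (sqrt T / (a - uT T g)\<^sup>2) * Irate DIC T g a) \<ge> ereal c2 \<and>
      Liminf at_infinity (\<lambda>a. ereal (T / \<bar>a\<bar> ^ 3) * Irate DIC T g a) \<ge> ereal c2"
    by (intro exI[of _ c] conjI order_trans[OF c(1) J_lim(1)] order_trans[OF c(2) J_lim(2)]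
        order_trans[OF c(3) I_lim(1)] order_trans[OF c(4) I_lim(2)])
qed

end
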